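(* Let $k^{-m}<p\le 1$. For $Q$-almost all $(\eta,\omega)\in I^{\mathbb N}\times\Omega$, the $\alpha$-mean porosity $\kappa(K_\omega,x(\eta),\alpha)$ exists and $$\kappa(K_\omega,x(\eta),\alpha)=E_Q[\chi_0^\alpha]\quad\text{for all }\alpha\in(0,1)\setminus D.$$ In particular, for $Q$-almost all $(\eta,\omega)\in I^{\mathbb N}\times\Omega$, the function $\alpha\mapsto\kappa(K_\omega,x(\eta),\alpha)$ is defined and continuous at all $\alpha\in(0,1)\setminus D$.
   Context: Mandelbrot percolation. $\mathbb N=\{1,2,\dots\}$. Fix integers $m\ge 1$, $k\ge 2$ and a probability $p$. Let $I=\{1,\dots,k^m\}$ and $I^*=\bigcup_{i\ge 0}I^i$ (finite words, $I^0$ consisting of the empty word $\emptyset$), let $|\sigma|$ be the length of a word, $\eta|_i$ the prefix of length $i$ of $\eta\in I^*\cup I^{\mathbb N}$, $\sigma*\tau$ concatenation, and write $\sigma\prec\tau$ (or $\tau\succ\sigma$) if $\tau$ starts with $\sigma$. Let $J_\emptyset=[0,1]^m$; each closed cube $J_\sigma$ of side length $k^{-|\sigma|}$ is divided into $k^m$ closed $k$-adic subcubes $J_{\sigma*1},\dots,J_{\sigma*k^m}$ of side length $k^{-|\sigma|-1}$ (in a fixed enumeration). For $\eta\in I^{\mathbb N}$, $x(\eta)$ is the unique point of $\bigcap_{i\ge0}J_{\eta|_i}$. $\Omega$ is the set of functions $\omega:I^*\to\{c,n\}$ ($c$ = chosen, $n$ = neglected) with the product topology. $P$ is the Borel probability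 measure on $\Omega$ such that $\omega(\emptyset)=c$ almost surely and, going from each level to the next, if $\omega(\sigma)=c$ then each $\sigma*j$, $j\in I$, is chosen independently with probability $p$, while if $\omega(\sigma)=n$ then $\omega(\sigma*j)=n$ for all $j$. The limit set is $K_\omega=\bigcap_{i\ge0}\bigcup_{\sigma\in I^i,\ \omega(\sigma)=c}J_\sigma$. The measure $Q$. Let $d=\log(k^mp)/\log k$. For $\sigma\in I^*$ let $N_{j,\sigma}=\operatorname{card}\{\tau\in I^*: |\tau|=|\sigma|+j,\ \tau\succ\sigma,\ \omega(\tau)=c\}$ and let $X_\sigma(\omega)=\lim_{j\to\infty}N_{j,\sigma}k^{-jd}$ (a $P$-almost sure finite martingale limit). For $P$-almost every $\omega$, $\mu_\omega$ is the Borel measure on $I^{\mathbb N}$ with $\mu_\omega(\{\eta:\eta|_{|\sigma|}=\sigma\})=(\operatorname{diam}J_\emptyset)^dk^{-|\sigma|d}X_\sigma(\omega)$ for all $\sigma\in I^*$. $Q$ is the Borel probability measure on $I^{\mathbb N}\times\Omega$ given by $Q(B)=(\operatorname{diam}J_\emptyset)^{-d}\int\mu_\omega(\{\eta:(\eta,\omega)\in B\})\,dP(\omega)$; $E_Q$ is expectation with respect to $Q$. Holes and mean porosity. $B_\varrho(z,r)$ is the open ball of the maximum metric $\varrho(x,y)=\max_i|x_i-y_i|$ in $\mathbb R^m$. For $j\in\mathbb N\cup\{0\}$, $Q_j^k(x)$ is the half-open $k$-adic cube $\prod_i[a_ik^{-j},(a_i+1)k^{-j})$, $a_i\in\mathbb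 Z$, containing $x$. A set $A\subset\mathbb R^m$ has an $\alpha$-hole at scale $j$ near $x$ if there is $z\in Q_j^k(x)$ with $B_\varrho(z,\tfrac12\alpha k^{-j})\subset Q_j^k(x)\setminus A$. Let $N_i(A,x,\alpha)$ be the number of $j\in\{1,\dots,i\}$ such that $A$ has an $\alpha$-hole at scale $j$ near $x$. The $\alpha$-mean porosity is $\kappa(A,x,\alpha)=\lim_{i\to\infty}N_i(A,x,\alpha)/i$ when this limit exists. Exceptional set. For $\alpha\in[0,1]$, $\chi_0^\alpha(\eta,\omega)=1$ if $K_\omega$ has an $\alpha$-hole at scale $0$ near $x(\eta)$, and $\chi_0^\alpha(\eta,\omega)=0$ otherwise. $D$ is the (countable) set of $\alpha\in(0,1)$ at which the decreasing function $\beta\mapsto E_Q[\chi_0^\beta]$ is discontinuous. *)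

theory Defs
  imports "HOL-Probability.Probability" "HOL-Library.Sublist"
begin

text \<open>The dimension \<open>m\<close> is \<open>CARD('m)\<close>, and \<open>\<real>\<^sup>m\<close> is \<^typ>\<open>real ^ 'm\<close>.  The finite words over the
  alphabet \<open>I = {1..k ^ m}\<close> are the elements of \<open>lists I\<close>.  An infinite word is a sequence
  \<open>\<eta> :: nat \<Rightarrow> nat\<close> whose letters are \<open>\<eta> 0, \<eta> 1, \<dots>\<close>, so its prefix of length \<open>i\<close> is
  \<open>map \<eta> [0..<i]\<close>.  In a realisation \<open>\<omega> :: nat list \<Rightarrow> bool\<close>, \<open>True\<close> means chosen and \<open>False\<close>
  means neglected.\<close>

definition alphabet :: "nat \<Rightarrow> nat \<Rightarrow> nat set" where
  "alphabet k m = {1..k ^ m}"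

abbreviation fin_words :: "nat \<Rightarrow> nat \<Rightarrow> nat list set" where
  "fin_words k m \<equiv> lists (alphabet k m)"

definition level :: "nat \<Rightarrow> nat \<Rightarrow> nat \<Rightarrow> nat list set" where
  "level k m i = {\<sigma> \<in> fin_words k m. length \<sigma> = i}"

text \<open>Both spaces are countable products of finite discrete spaces, so the product
  \<open>\<sigma>\<close>-algebras below are the Borel \<open>\<sigma>\<close>-algebras of the product topologies.\<close>

definition inf_words :: "nat \<Rightarrow> nat \<Rightarrow> (nat \<Rightarrow> nat) measure" where
  "inf_words k m = PiM UNIV (\<lambda>_. count_space (alphabet k m))"

definition realisations :: "nat \<Rightarrow> nat \<Rightarrow> (nat list \<Rightarrow> bool) measure" where
  "realisations k m = PiM (fin_words k m) (\<lambda>_. count_space UNIV)"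

definition cylinder :: "nat \<Rightarrow> nat \<Rightarrow> nat list \<Rightarrow> (nat \<Rightarrow> nat) set" where
  "cylinder k m \<sigma> = {\<eta> \<in> space (inf_words k m). map \<eta> [0..<length \<sigma>] = \<sigma>}"


subsection \<open>The cubes and the limit set\<close>

definition closed_adic_cube :: "nat \<Rightarrow> nat \<Rightarrow> ('m \<Rightarrow> int) \<Rightarrow> (real ^ 'm) set" where
  "closed_adic_cube k j a =
     {x. \<forall>i. real_of_int (a i) / real k ^ j \<le> x $ i \<and> x $ i \<le> (real_of_int (a i) + 1) / real k ^ j}"

text \<open>For each word \<open>\<sigma>\<close>, the map \<open>j \<mapsto> J (\<sigma> @ [j])\<close> is required to enumerate the \<open>k\<close>-adic subcubes of
  \<open>J \<sigma>\<close> of the next generation; the choice of the enumeration is left open.\<close>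

definition cube_system :: "nat \<Rightarrow> (nat list \<Rightarrow> (real ^ 'm) set) \<Rightarrow> bool" where
  "cube_system k J \<longleftrightarrow>
     J [] = {x. \<forall>i. 0 \<le> x $ i \<and> x $ i \<le> 1} \<and>
     (\<forall>\<sigma> \<in> fin_words k CARD('m).
        bij_betw (\<lambda>j. J (\<sigma> @ [j])) (alphabet k CARD('m))
          {C. (\<exists>a. C = closed_adic_cube k (Suc (length \<sigma>)) a) \<and> C \<subseteq> J \<sigma>})"

definition point_of :: "(nat list \<Rightarrow> (real ^ 'm) set) \<Rightarrow> (nat \<Rightarrow> nat) \<Rightarrow> real ^ 'm" where
  "point_of J \<eta> = (THE x. x \<in> (\<Inter>i. J (map \<eta> [0..<i])))"

definition limit_set ::
    "nat \<Rightarrow> (nat list \<Rightarrow> (real ^ 'm) set) \<Rightarrow> (nat list \<Rightarrow> bool) \<Rightarrow> (real ^ 'm) set" where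
  "limit_set k J \<omega> = (\<Inter>i. \<Union>\<sigma> \<in> {\<sigma> \<in> level k CARD('m) i. \<omega> \<sigma>}. J \<sigma>)"


subsection \<open>The percolation law\<close>

definition child_law :: "real \<Rightarrow> bool \<Rightarrow> bool pmf" where
  "child_law p c = (if c then bernoulli_pmf p else return_pmf False)"

text \<open>The last clause says that, given the states of all words of length at most \<open>i\<close>, the states of
  the words \<open>\<sigma> @ [j]\<close> of length \<open>i + 1\<close> are independent with laws \<open>child_law p (\<omega> \<sigma>)\<close>.\<close>

definition percolation_law :: "nat \<Rightarrow> nat \<Rightarrow> real \<Rightarrow> (nat list \<Rightarrow> bool) measure \<Rightarrow> bool" where
  "percolation_law k m p P \<longleftrightarrow>
     prob_space P \<and> sets P = sets (realisations k m) \<and> (AE \<omega> in P. \<omega> []) \<and>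
     (\<forall>i a. measure P {\<omega> \<in> space P. \<forall>l \<le> Suc i. \<forall>\<sigma> \<in> level k m l. \<omega> \<sigma> = a \<sigma>} =
        measure P {\<omega> \<in> space P. \<forall>l \<le> i. \<forall>\<sigma> \<in> level k m l. \<omega> \<sigma> = a \<sigma>} *
        (\<Prod>\<sigma> \<in> level k m i. \<Prod>j \<in> alphabet k m. pmf (child_law p (a \<sigma>)) (a (\<sigma> @ [j]))))"


text \<open>A measure with this property exists: delete the words independently with probability
  \<open>1 - p\<close> and choose those words none of whose nonempty prefixes is deleted.\<close>

definition survive :: "nat \<Rightarrow> nat \<Rightarrow> (nat list \<Rightarrow> bool) \<Rightarrow> nat list \<Rightarrow> bool" where
  "survive k m b = (\<lambda>\<sigma> \<in> fin_words k m. \<forall>i < length \<sigma>. b (take (Suc i) \<sigma>))"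

lemma finite_level: "finite (level k m i)"
proof -
  have "level k m i = {\<sigma>. set \<sigma> \<subseteq> alphabet k m \<and> length \<sigma> = i}"
    by (auto simp: level_def in_lists_conv_set)
  then show ?thesis by (simp add: finite_lists_length_eq alphabet_def)
qed

lemma survive_Nil: "survive k m b []"
  by (simp add: survive_def)

lemma survive_snoc:
  assumes "\<sigma> \<in> fin_words k m" "j \<in> alphabet k m"
  shows "survive k m b (\<sigma> @ [j]) \<longleftrightarrow> survive k m b \<sigma> \<and> b (\<sigma> @ [j])"
  using assms by (auto simp: survive_def less_Suc_eq)

lemma level_Suc: "level k m (Suc i) = (\<lambda>(\<sigma>, j). \<sigma> @ [j]) ` (level k m i \<times> alphabet k m)"
proof (intro set_eqI iffI)
  fix \<tau> assume t: "\<tau> \<in> level k m (Suc i)"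
  then have "\<tau> \<noteq> []" by (auto simp: level_def)
  then obtain \<sigma> j where "\<tau> = \<sigma> @ [j]" by (metis rev_exhaust)
  with t show "\<tau> \<in> (\<lambda>(\<sigma>, j). \<sigma> @ [j]) ` (level k m i \<times> alphabet k m)"
    by (auto simp: level_def image_iff)
qed (auto simp: level_def)

lemma level_0: "level k m 0 = {[]}"
  by (auto simp: level_def)

lemma ex_percolation_law:
  assumes p: "0 \<le> p" "p \<le> 1"
  shows "\<exists>P. percolation_law k m p P"
proof -
  define B where "B = PiM (fin_words k m) (\<lambda>_. measure_pmf (bernoulli_pmf p))"
  interpret B: product_prob_space "\<lambda>_. measure_pmf (bernoulli_pmf p)" "fin_words k m"
    by (unfold_locales)
  have pB: "prob_space B"
    unfolding B_def by (rule B.prob_space_axioms)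
  interpret PB: prob_space B by (fact pB)
  have meas: "survive k m \<in> B \<rightarrow>\<^sub>M realisations k m"
    unfolding realisations_def survive_def
  proof (rule measurable_restrict)
    fix \<sigma> assume s: "\<sigma> \<in> fin_words k m"
    have "(\<lambda>b. b (take (Suc i) \<sigma>)) \<in> B \<rightarrow>\<^sub>M count_space UNIV" for i
    proof -
      have "take (Suc i) \<sigma> \<in> fin_words k m"
        using s by (auto simp: in_lists_conv_set dest: in_set_takeD)
      then show ?thesis
        unfolding B_def using measurable_component_singleton[of "take (Suc i) \<sigma>" "fin_words k m"
            "\<lambda>_. measure_pmf (bernoulli_pmf p)"] by simp
    qed
    then show "(\<lambda>b. \<forall>i<length \<sigma>. b (take (Suc i) \<sigma>)) \<in> B \<rightarrow>\<^sub>M count_space UNIV"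
      by measurable
  qed
  define P where "P = distr B (realisations k m) (survive k m)"
  have prP: "prob_space P"
    unfolding P_def by (rule PB.prob_space_distr[OF meas])
  have spP: "space P = space (realisations k m)" and seP: "sets P = sets (realisations k m)"
    by (simp_all add: P_def)
  define S where "S a i = (\<Union>l<i. (\<lambda>(\<sigma>, j). \<sigma> @ [j]) ` ({\<sigma> \<in> level k m l. a \<sigma>} \<times> alphabet k m))"
    for a :: "nat list \<Rightarrow> bool" and i
  define E where "E a i = {b \<in> space B. \<forall>l \<le> i. \<forall>\<sigma> \<in> level k m l. survive k m b \<sigma> = a \<sigma>}"
    for a :: "nat list \<Rightarrow> bool" and i
  define w where "w a i = (\<Prod>\<sigma> \<in> level k m i. \<Prod>j \<in> alphabet k m.
      pmf (child_law p (a \<sigma>)) (a (\<sigma> @ [j])))" for a :: "nat list \<Rightarrow> bool" and i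
  have cylP: "measure P {\<omega> \<in> space P. \<forall>l \<le> i. \<forall>\<sigma> \<in> level k m l. \<omega> \<sigma> = a \<sigma>} = measure B (E a i)"
    for a i
  proof -
    have *: "(\<lambda>\<omega>. \<omega> \<sigma>) \<in> realisations k m \<rightarrow>\<^sub>M count_space UNIV" if "\<sigma> \<in> level k m l" for \<sigma> l
      using that unfolding realisations_def level_def
      by (intro measurable_component_singleton) auto
    have "{\<omega> \<in> space (realisations k m). \<forall>l \<in> {..i}. \<forall>\<sigma> \<in> level k m l. \<omega> \<sigma> = a \<sigma>} \<in> sets (realisations k m)"
    proof (intro sets.sets_Collect_finite_All finite_level finite_atMost)
      fix l \<sigma> assume "\<sigma> \<in> level k m l"
      note *[OF this, measurable]
      show "{\<omega> \<in> space (realisations k m). \<omega> \<sigma> = a \<sigma>} \<in> sets (realisations k m)"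
        by measurable
    qed
    then have m: "{\<omega> \<in> space P. \<forall>l \<le> i. \<forall>\<sigma> \<in> level k m l. \<omega> \<sigma> = a \<sigma>} \<in> sets (realisations k m)"
      by (simp only: spP Ball_def atMost_iff)
    have "survive k m -` {\<omega> \<in> space P. \<forall>l \<le> i. \<forall>\<sigma> \<in> level k m l. \<omega> \<sigma> = a \<sigma>} \<inter> space B = E a i"
      using measurable_space[OF meas] by (auto simp: E_def spP)
    with measure_distr[OF meas m] show ?thesis
      by (simp only: P_def)
  qed
  have E_empty: "E a i = {}" if "\<not> a []" for a i
    using that by (force simp: E_def level_0 survive_Nil)
  have E_empty2: "E a i = {}" if "l < i" "\<sigma> \<in> level k m l" "j \<in> alphabet k m" "\<not> a \<sigma>" "a (\<sigma> @ [j])" for a i l \<sigma> j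
  proof (rule ccontr)
    assume "E a i \<noteq> {}"
    then obtain b where b: "\<And>l \<tau>. l \<le> i \<Longrightarrow> \<tau> \<in> level k m l \<Longrightarrow> survive k m b \<tau> = a \<tau>"
      unfolding E_def by blast
    have "\<sigma> @ [j] \<in> level k m (Suc l)" using that by (auto simp: level_def)
    with b[of "Suc l" "\<sigma> @ [j]"] b[of l \<sigma>] that survive_snoc[of \<sigma> k m j b] show False
      by (auto simp: level_def)
  qed
  have E_rect: "E a i = {b \<in> space B. \<forall>\<tau> \<in> S a i. b \<tau> \<in> {a \<tau>}}"
    if "a []" and her: "\<And>l \<sigma> j. l < i \<Longrightarrow> \<sigma> \<in> level k m l \<Longrightarrow> j \<in> alphabet k m \<Longrightarrow> a (\<sigma> @ [j]) \<Longrightarrow> a \<sigma>"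
    for a i
    using her
  proof (induction i)
    case 0
    then show ?case using \<open>a []\<close> by (auto simp: E_def S_def level_0 survive_Nil)
  next
    case (Suc i)
    have IH: "E a i = {b \<in> space B. \<forall>\<tau> \<in> S a i. b \<tau> \<in> {a \<tau>}}"
      using Suc.prems by (intro Suc.IH) (auto simp: less_Suc_eq)
    have "E a (Suc i) = {b \<in> E a i. \<forall>\<tau> \<in> level k m (Suc i). survive k m b \<tau> = a \<tau>}"
      by (auto simp: E_def le_Suc_eq)
    also have "\<dots> = {b \<in> E a i. \<forall>\<sigma> \<in> level k m i. \<forall>j \<in> alphabet k m. a \<sigma> \<longrightarrow> b (\<sigma> @ [j]) = a (\<sigma> @ [j])}"
    proof (intro Collect_cong conj_cong refl)
      fix b assume b: "b \<in> E a i"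
      have "survive k m b (\<sigma> @ [j]) = a (\<sigma> @ [j]) \<longleftrightarrow> (a \<sigma> \<longrightarrow> b (\<sigma> @ [j]) = a (\<sigma> @ [j]))"
        if "\<sigma> \<in> level k m i" "j \<in> alphabet k m" for \<sigma> j
      proof -
        have "survive k m b \<sigma> = a \<sigma>" using b that by (auto simp: E_def)
        moreover have "a (\<sigma> @ [j]) \<Longrightarrow> a \<sigma>" using Suc.prems[of i \<sigma> j] that by auto
        ultimately show ?thesis using survive_snoc[of \<sigma> k m j b] that by (auto simp: level_def)
      qed
      then show "(\<forall>\<tau> \<in> level k m (Suc i). survive k m b \<tau> = a \<tau>) \<longleftrightarrow>
        (\<forall>\<sigma> \<in> level k m i. \<forall>j \<in> alphabet k m. a \<sigma> \<longrightarrow> b (\<sigma> @ [j]) = a (\<sigma> @ [j]))"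
        unfolding level_Suc by auto
    qed
    also have "\<dots> = {b \<in> space B. \<forall>\<tau> \<in> S a (Suc i). b \<tau> \<in> {a \<tau>}}"
    proof -
      have "(\<forall>\<tau> \<in> S a (Suc i). b \<tau> \<in> {a \<tau>}) \<longleftrightarrow> (\<forall>\<tau> \<in> S a i. b \<tau> \<in> {a \<tau>}) \<and>
        (\<forall>\<sigma> \<in> level k m i. \<forall>j \<in> alphabet k m. a \<sigma> \<longrightarrow> b (\<sigma> @ [j]) = a (\<sigma> @ [j]))" for b
      proof -
        have "S a (Suc i) = (\<lambda>(\<sigma>, j). \<sigma> @ [j]) ` ({\<sigma> \<in> level k m i. a \<sigma>} \<times> alphabet k m) \<union> S a i"
          unfolding S_def lessThan_Suc by (rule UN_insert)
        then show ?thesis by (auto simp: ball_Un)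
      qed
      then show ?thesis by (simp only: IH mem_Collect_eq conj_assoc)
    qed
    finally show ?case .
  qed
  have E_measure: "measure B (E a i) = (if a [] then \<Prod>l<i. w a l else 0)" for a i
  proof (cases "a [] \<and> (\<forall>l < i. \<forall>\<sigma> \<in> level k m l. \<forall>j \<in> alphabet k m. a (\<sigma> @ [j]) \<longrightarrow> a \<sigma>)")
    case True
    have inj: "inj_on (\<lambda>(\<sigma>, j). \<sigma> @ [j]) X" for X :: "(nat list \<times> nat) set"
      by (auto simp: inj_on_def)
    have finA: "finite (alphabet k m)" by (simp add: alphabet_def)
    have finS: "finite (S a i)"
      unfolding S_def using finite_level finA by auto
    have "measure B (E a i) = measure B {b \<in> space B. \<forall>\<tau> \<in> S a i. b \<tau> \<in> {a \<tau>}}"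
      using True by (subst E_rect) auto
    also have "emeasure B {b \<in> space B. \<forall>\<tau> \<in> S a i. b \<tau> \<in> {a \<tau>}} =
      (\<Prod>\<tau> \<in> S a i. emeasure (measure_pmf (bernoulli_pmf p)) {a \<tau>})"
      unfolding B_def by (rule B.emeasure_PiM_Collect[OF _ finS]) (auto simp: S_def level_def)
    then have "measure B {b \<in> space B. \<forall>\<tau> \<in> S a i. b \<tau> \<in> {a \<tau>}} =
      (\<Prod>\<tau> \<in> S a i. pmf (bernoulli_pmf p) (a \<tau>))"
      by (simp add: measure_def emeasure_pmf_single prod_ennreal prod_nonneg)
    also have "\<dots> = (\<Prod>l<i. \<Prod>\<tau> \<in> (\<lambda>(\<sigma>, j). \<sigma> @ [j]) ` ({\<sigma> \<in> level k m l. a \<sigma>} \<times> alphabet k m).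
        pmf (bernoulli_pmf p) (a \<tau>))"
      unfolding S_def by (rule prod.UNION_disjoint) (auto simp: finite_level finA, auto simp: level_def)
    also have "\<dots> = (\<Prod>l<i. w a l)"
    proof (rule prod.cong[OF refl])
      fix l assume l: "l \<in> {..<i}"
      have her: "\<not> a (\<sigma> @ [j])" if "\<sigma> \<in> level k m l" "j \<in> alphabet k m" "\<not> a \<sigma>" for \<sigma> j
        using True l that by blast
      have "(\<Prod>\<tau> \<in> (\<lambda>(\<sigma>, j). \<sigma> @ [j]) ` ({\<sigma> \<in> level k m l. a \<sigma>} \<times> alphabet k m). pmf (bernoulli_pmf p) (a \<tau>)) =
        (\<Prod>(\<sigma>, j) \<in> {\<sigma> \<in> level k m l. a \<sigma>} \<times> alphabet k m. pmf (bernoulli_pmf p) (a (\<sigma> @ [j])))"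
        by (subst prod.reindex[OF inj]) (simp add: case_prod_unfold)
      also have "\<dots> = (\<Prod>\<sigma> \<in> {\<sigma> \<in> level k m l. a \<sigma>}. \<Prod>j \<in> alphabet k m. pmf (bernoulli_pmf p) (a (\<sigma> @ [j])))"
        by (rule prod.cartesian_product[symmetric])
      also have "\<dots> = w a l"
        unfolding w_def using her finite_level finA
        by (intro prod.mono_neutral_cong_left ballI prod.neutral prod.cong refl)
           (auto simp: child_law_def indicator_def)
      finally show "(\<Prod>\<tau> \<in> (\<lambda>(\<sigma>, j). \<sigma> @ [j]) ` ({\<sigma> \<in> level k m l. a \<sigma>} \<times> alphabet k m).
        pmf (bernoulli_pmf p) (a \<tau>)) = w a l" .
    qed
    finally show ?thesis using True by simp
  next
    case False
    show ?thesis
    proof (cases "a []")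
      case True
      with False obtain l \<sigma> j where *: "l < i" "\<sigma> \<in> level k m l" "j \<in> alphabet k m" "\<not> a \<sigma>" "a (\<sigma> @ [j])"
        by auto
      have "(\<Prod>j \<in> alphabet k m. pmf (child_law p (a \<sigma>)) (a (\<sigma> @ [j]))) = 0"
        using * by (intro prod_zero bexI[of _ j]) (auto simp: child_law_def alphabet_def)
      then have "w a l = 0"
        unfolding w_def using * finite_level by (intro prod_zero[OF _ bexI[of _ \<sigma>]]) auto
      then have "(\<Prod>l<i. w a l) = 0"
        using * by (intro prod_zero bexI[of _ l]) auto
      then show ?thesis using E_empty2[OF *] True by simp
    qed (simp add: E_empty)
  qed
  have "AE \<omega> in P. \<omega> []"
    unfolding P_def
  proof (subst AE_distr_iff[OF meas])
    have "(\<lambda>\<omega>. \<omega> []) \<in> realisations k m \<rightarrow>\<^sub>M count_space UNIV"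
      unfolding realisations_def by (intro measurable_component_singleton) auto
    then show "{\<omega> \<in> space (realisations k m). \<omega> []} \<in> sets (realisations k m)"
      by measurable
  qed (simp add: survive_Nil)
  then have "percolation_law k m p P"
    using prP seP unfolding percolation_law_def cylP E_measure by (simp add: w_def)
  then show ?thesis ..
qed


subsection \<open>The measures \<open>\<mu>\<^sub>\<omega>\<close> and \<open>Q\<close>\<close>

definition dim_exp :: "nat \<Rightarrow> nat \<Rightarrow> real \<Rightarrow> real" where
  "dim_exp k m p = ln (real k ^ m * p) / ln (real k)"

definition descendants :: "nat \<Rightarrow> nat \<Rightarrow> (nat list \<Rightarrow> bool) \<Rightarrow> nat \<Rightarrow> nat list \<Rightarrow> nat" where
  "descendants k m \<omega> j \<sigma> =
     card {\<tau> \<in> fin_words k m. length \<tau> = length \<sigma> + j \<and> prefix \<sigma> \<tau> \<and> \<omega> \<tau>}"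

definition martingale_limit :: "nat \<Rightarrow> nat \<Rightarrow> real \<Rightarrow> (nat list \<Rightarrow> bool) \<Rightarrow> nat list \<Rightarrow> real" where
  "martingale_limit k m p \<omega> \<sigma> =
     lim (\<lambda>j. real (descendants k m \<omega> j \<sigma>) * real k powr (- (real j * dim_exp k m p)))"

text \<open>The values on cylinders determine the measure.  It exists for almost every \<open>\<omega>\<close>; on the
  exceptional null set the description operator returns an unspecified measure, which does not
  influence the integral defining \<open>Q\<close>.\<close>

definition branch_measure ::
    "nat \<Rightarrow> real \<Rightarrow> (nat list \<Rightarrow> (real ^ 'm) set) \<Rightarrow> (nat list \<Rightarrow> bool) \<Rightarrow> (nat \<Rightarrow> nat) measure" where
  "branch_measure k p J \<omega> = (THE M. sets M = sets (inf_words k CARD('m)) \<and>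
     (\<forall>\<sigma> \<in> fin_words k CARD('m). emeasure M (cylinder k CARD('m) \<sigma>) =
        ennreal (diameter (J []) powr dim_exp k CARD('m) p *
          real k powr (- (real (length \<sigma>) * dim_exp k CARD('m) p)) *
          martingale_limit k CARD('m) p \<omega> \<sigma>)))"

definition size_biased_measure ::
    "nat \<Rightarrow> real \<Rightarrow> (nat list \<Rightarrow> (real ^ 'm) set) \<Rightarrow> (nat list \<Rightarrow> bool) measure \<Rightarrow>
      ((nat \<Rightarrow> nat) \<times> (nat list \<Rightarrow> bool)) measure" where
  "size_biased_measure k p J P =
     measure_of (space (inf_words k CARD('m) \<Otimes>\<^sub>M P)) (sets (inf_words k CARD('m) \<Otimes>\<^sub>M P))
       (\<lambda>B. ennreal (diameter (J []) powr (- dim_exp k CARD('m) p)) *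
          (\<integral>\<^sup>+\<omega>. emeasure (branch_measure k p J \<omega>) {\<eta>. (\<eta>, \<omega>) \<in> B} \<partial>P))"


subsection \<open>Holes and mean porosity\<close>

text \<open>The maximum metric is \<open>\<lambda>x y. infnorm (x - y)\<close>.\<close>

definition max_ball :: "real ^ 'm \<Rightarrow> real \<Rightarrow> (real ^ 'm) set" where
  "max_ball z r = {y. infnorm (y - z) < r}"

definition half_open_adic_cube :: "nat \<Rightarrow> nat \<Rightarrow> ('m \<Rightarrow> int) \<Rightarrow> (real ^ 'm) set" where
  "half_open_adic_cube k j a =
     {y. \<forall>i. real_of_int (a i) / real k ^ j \<le> y $ i \<and> y $ i < (real_of_int (a i) + 1) / real k ^ j}"

definition adic_cube_at :: "nat \<Rightarrow> nat \<Rightarrow> real ^ 'm \<Rightarrow> (real ^ 'm) set" where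
  "adic_cube_at k j x = half_open_adic_cube k j (\<lambda>i. \<lfloor>x $ i * real k ^ j\<rfloor>)"

lemma adic_cube_at_self: "k > 0 \<Longrightarrow> x \<in> adic_cube_at k j x"
  unfolding adic_cube_at_def half_open_adic_cube_def
  by (simp add: field_simps floor_le_iff) (simp add: add.commute[of 1])

definition has_hole :: "nat \<Rightarrow> (real ^ 'm) set \<Rightarrow> real \<Rightarrow> nat \<Rightarrow> real ^ 'm \<Rightarrow> bool" where
  "has_hole k A \<alpha> j x \<longleftrightarrow>
     (\<exists>z \<in> adic_cube_at k j x. max_ball z (1/2 * \<alpha> / real k ^ j) \<subseteq> adic_cube_at k j x - A)"

definition hole_count :: "nat \<Rightarrow> (real ^ 'm) set \<Rightarrow> real ^ 'm \<Rightarrow> real \<Rightarrow> nat \<Rightarrow> nat" where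
  "hole_count k A x \<alpha> i = card {j \<in> {1..i}. has_hole k A \<alpha> j x}"

definition mean_porosity_exists :: "nat \<Rightarrow> (real ^ 'm) set \<Rightarrow> real ^ 'm \<Rightarrow> real \<Rightarrow> bool" where
  "mean_porosity_exists k A x \<alpha> \<longleftrightarrow> convergent (\<lambda>i. real (hole_count k A x \<alpha> i) / real i)"

definition mean_porosity :: "nat \<Rightarrow> (real ^ 'm) set \<Rightarrow> real ^ 'm \<Rightarrow> real \<Rightarrow> real" where
  "mean_porosity k A x \<alpha> = lim (\<lambda>i. real (hole_count k A x \<alpha> i) / real i)"

definition hole_indicator ::
    "nat \<Rightarrow> (nat list \<Rightarrow> (real ^ 'm) set) \<Rightarrow> real \<Rightarrow> (nat \<Rightarrow> nat) \<times> (nat list \<Rightarrow> bool) \<Rightarrow> real" where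
  "hole_indicator k J \<alpha> = (\<lambda>(\<eta>, \<omega>). if has_hole k (limit_set k J \<omega>) \<alpha> 0 (point_of J \<eta>) then 1 else 0)"

definition expected_hole ::
    "nat \<Rightarrow> real \<Rightarrow> (nat list \<Rightarrow> (real ^ 'm) set) \<Rightarrow> (nat list \<Rightarrow> bool) measure \<Rightarrow> real \<Rightarrow> real" where
  "expected_hole k p J P \<alpha> = integral\<^sup>L (size_biased_measure k p J P) (hole_indicator k J \<alpha>)"

definition exceptional_set ::
    "nat \<Rightarrow> real \<Rightarrow> (nat list \<Rightarrow> (real ^ 'm) set) \<Rightarrow> (nat list \<Rightarrow> bool) measure \<Rightarrow> real set" where
  "exceptional_set k p J P = {\<alpha> \<in> {0<..<1}. \<not> isCont (expected_hole k p J P) \<alpha>}"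

end

theory Submission
  imports Defs "HOL-Library.Discrete_Functions"
begin

text \<open>Under the size-biased measure the porosity of the limit set along a random branch is a law of
  large numbers for a stationary sequence.  The proof makes this explicit by realising the
  size-biased measure on a product of independent, identically distributed sites.

  \<^bold>\<open>The spine.\<close>  On the words of length at most \<open>n\<close> the size-biased measure gives a prefix \<open>\<sigma>\<close> of
  length \<open>n\<close> and a configuration containing \<open>\<sigma>\<close> the weight \<open>(k ^ m * p) ^ (- n)\<close> times the
  percolation probability of the configuration (\<open>emeasure_Q_atom\<close>).  Here the martingale limits enter
  only through their conditional expectations: the increments of the normalised descendant numbers
  have geometrically decreasing second moments, so the limits exist almost surely and in mean.  The
  same weights arise as follows.  Choose the letters of a branch independently and uniformly, declare
  every prefix of the branch to be chosen, and run the ordinary percolation in all subtrees that leave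
  the branch.  The letter at height \<open>j\<close> together with the randomness of the subtrees leaving the
  branch at that height forms a site, and the sites are independent with one common law.  Both
  descriptions agree on finite generations, hence they are the same measure (\<open>Q_eq_distr_model\<close>).

  \<^bold>\<open>Self-similarity.\<close>  The enumeration of the subcubes may differ from cube to cube, so the model uses
  digit vectors, the positions of the subcubes in their parent, in place of letters.  In these
  coordinates a hole at scale \<open>j\<close> is literally a hole at scale \<open>0\<close> of the sequence of sites shifted by
  \<open>j\<close> (\<open>has_hole_model_iff\<close>).  Only open balls inside half-open cubes matter, so neighbouring cubes
  are irrelevant, and almost surely the branch point lies on no upper face of any of its cubes.

  \<^bold>\<open>Finite blocks.\<close>  A hole at scale \<open>0\<close> depends on all sites.  Fill in the cube of generation \<open>n\<close>
  around the branch point: holes of the enlarged set depend on the first \<open>n\<close> sites only, and they are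
  holes of the original set.  Conversely the branch point belongs to the limit set, so a hole avoids
  it, and a hole shrunk by the side length \<open>k ^ (- n)\<close> on every side avoids the whole cube.  Thus holes
  of parameter \<open>\<beta>\<close> produce block events of parameter \<open>\<alpha>\<close>, which produce holes of parameter \<open>\<alpha>\<close>,
  whenever \<open>\<alpha> + 2 / k ^ n \<le> \<beta>\<close>.  Blocks of length \<open>n\<close> that start at least \<open>n\<close> apart are
  independent, which gives a strong law by second moments along the squares (\<open>slln_block_factor\<close>).

  \<^bold>\<open>Conclusion.\<close>  Almost surely, for all rational \<open>0 < \<alpha> < \<beta>\<close>, the lower frequency of holes of
  parameter \<open>\<alpha>\<close> is at least \<open>E \<chi>\<^sup>\<beta>\<close> and the upper frequency of holes of parameter \<open>\<beta>\<close> is at most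
  \<open>E \<chi>\<^sup>\<alpha>\<close> (\<open>AE_squeezed\<close>).  Frequencies are monotone in the parameter, so at a continuity point of
  the expectation they converge to it, and nearby frequencies stay close to it.\<close>

section \<open>Measures determined by finite partitions\<close>

lemma measurable_Collect_subset:
  assumes A: "finite A" and p: "\<And>a. a \<in> A \<Longrightarrow> Measurable.pred M (\<lambda>x. p x a)"
  shows "(\<lambda>x. {a \<in> A. p x a}) \<in> M \<rightarrow>\<^sub>M count_space UNIV"
proof -
  have "(\<lambda>x. {a \<in> A. p x a}) \<in> M \<rightarrow>\<^sub>M count_space (Pow A)"
  proof (subst measurable_count_space_eq2)
    show "finite (Pow A)" using A by simp
    show "(\<lambda>x. {a \<in> A. p x a}) \<in> space M \<rightarrow> Pow A \<and>
      (\<forall>B\<in>Pow A. (\<lambda>x. {a \<in> A. p x a}) -` {B} \<inter> space M \<in> sets M)"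
    proof (intro conjI ballI)
      fix B assume B: "B \<in> Pow A"
      have "(\<lambda>x. {a \<in> A. p x a}) -` {B} \<inter> space M = {x \<in> space M. \<forall>a\<in>A. p x a \<longleftrightarrow> a \<in> B}"
        using B by auto
      also have "\<dots> \<in> sets M"
        using A p by (intro sets.sets_Collect_finite_All) (auto simp: pred_def)
      finally show "(\<lambda>x. {a \<in> A. p x a}) -` {B} \<inter> space M \<in> sets M" .
    qed auto
  qed
  then show ?thesis
    by (rule measurable_compose) simp
qed

text \<open>The atoms of the successively finer partitions into the level sets of \<open>f 0, f 1, \<dots>\<close> are nested or
  disjoint, so they form a generator that is stable under intersection.\<close>

lemma measure_eqI_filtration:
  fixes f :: "nat \<Rightarrow> 'a \<Rightarrow> 'b" and M N :: "'a measure"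
  defines "\<F> \<equiv> {f n -` {c} \<inter> space N | n c. True}"
  assumes MN: "sets M = sets N" and fin: "finite_measure N"
    and atoms: "\<F> \<subseteq> sets N" and gen: "(\<lambda>x. x) \<in> measurable (sigma (space N) \<F>) N"
    and refine: "\<And>n x y. x \<in> space N \<Longrightarrow> y \<in> space N \<Longrightarrow> f (Suc n) x = f (Suc n) y \<Longrightarrow> f n x = f n y"
    and total: "emeasure M (space N) = emeasure N (space N)"
    and eq: "\<And>n c. emeasure M (f n -` {c} \<inter> space N) = emeasure N (f n -` {c} \<inter> space N)"
  shows "M = N"
proof -
  interpret N: finite_measure N by fact
  have mono: "f n x = f n y" if "n \<le> m" "x \<in> space N" "y \<in> space N" "f m x = f m y" for n m x y
    using that by (induction rule: dec_induct) (auto dest: refine)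
  define E where "E = insert {} (insert (space N) \<F>)"
  have sub: "E \<subseteq> sets N" using atoms by (auto simp: E_def)
  have two: "A \<inter> B \<in> E" if AB: "A = f n -` {c} \<inter> space N" "B = f m -` {d} \<inter> space N" "n \<le> m" for A B n m c d
  proof (cases "A \<inter> B = {}")
    case False
    then obtain z where z: "z \<in> A" "z \<in> B" by auto
    have "B \<subseteq> A"
    proof
      fix x assume x: "x \<in> B"
      then have "f n x = f n z" using AB z by (intro mono[of n m]) auto
      then show "x \<in> A" using AB z x by auto
    qed
    then have "A \<inter> B = B" by auto
    then show ?thesis using AB by (auto simp: E_def \<F>_def)
  qed (simp add: E_def)
  have Fsub: "A \<in> \<F> \<Longrightarrow> A \<subseteq> space N" for A by (auto simp: \<F>_def)
  have stable: "Int_stable E"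
  proof (rule Int_stableI)
    fix A B assume "A \<in> E" "B \<in> E"
    then consider "A = {} \<or> B = {}" | "A = space N" "B \<in> \<F>" | "B = space N" "A \<in> \<F>"
      | "A = space N" "B = space N" | "A \<in> \<F>" "B \<in> \<F>"
      by (auto simp: E_def)
    then show "A \<inter> B \<in> E"
    proof cases
      case 5
      then obtain n c m d where *: "A = f n -` {c} \<inter> space N" "B = f m -` {d} \<inter> space N"
        by (auto simp: \<F>_def)
      show ?thesis
        using two[OF *] two[OF *(2,1)] by (cases "n \<le> m") (auto simp: Int_commute)
    qed (use Fsub in \<open>auto simp: E_def Int_absorb1 Int_absorb2\<close>)
  qed
  have "sets N \<subseteq> sigma_sets (space N) \<F>"
  proof
    fix A assume A: "A \<in> sets N"
    have "(\<lambda>x. x) -` A \<inter> space (sigma (space N) \<F>) \<in> sets (sigma (space N) \<F>)"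
      by (rule measurable_sets[OF gen A])
    then show "A \<in> sigma_sets (space N) \<F>"
      using sets.sets_into_space[OF A] Fsub by (simp add: sets_measure_of Pow_def subset_iff Int_absorb2)
  qed
  also have "\<dots> \<subseteq> sigma_sets (space N) E"
    by (intro sigma_sets_mono') (auto simp: E_def)
  finally have sN: "sets N = sigma_sets (space N) E"
    using sub by (intro equalityI sets.sigma_sets_subset) auto
  show ?thesis
  proof (rule measure_eqI_generator_eq[OF stable, where \<Omega> = "space N" and A = "\<lambda>_. space N"])
    show "E \<subseteq> Pow (space N)" using Fsub by (auto simp: E_def)
    show "emeasure M X = emeasure N X" if "X \<in> E" for X
      using that eq total by (auto simp: E_def \<F>_def)
    show "sets M = sigma_sets (space N) E" "sets N = sigma_sets (space N) E"
      using sN MN by auto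
  qed (auto simp: E_def total)
qed

text \<open>A function of \<open>f n\<close> has preimages that are finite unions of atoms.\<close>

lemma measurable_of_atoms:
  fixes f :: "nat \<Rightarrow> 'a \<Rightarrow> 'b"
  assumes fin: "finite (f n ` \<Omega>)"
    and g: "\<And>x y. x \<in> \<Omega> \<Longrightarrow> y \<in> \<Omega> \<Longrightarrow> f n x = f n y \<Longrightarrow> g x = g y"
    and sp: "g \<in> \<Omega> \<rightarrow> C"
  shows "g \<in> sigma \<Omega> {f n -` {c} \<inter> \<Omega> | n c. True} \<rightarrow>\<^sub>M count_space C"
proof (rule measurableI)
  have sub: "{f n -` {c} \<inter> \<Omega> | n c. True} \<subseteq> Pow \<Omega>" by auto
  show "g x \<in> space (count_space C)" if "x \<in> space (sigma \<Omega> {f n -` {c} \<inter> \<Omega> | n c. True})" for x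
    using that sp unfolding space_measure_of[OF sub] by auto
  fix A assume "A \<in> sets (count_space C)"
  have "g -` A \<inter> \<Omega> = (\<Union>c \<in> f n ` (g -` A \<inter> \<Omega>). f n -` {c} \<inter> \<Omega>)"
  proof (intro set_eqI iffI)
    fix x assume "x \<in> (\<Union>c \<in> f n ` (g -` A \<inter> \<Omega>). f n -` {c} \<inter> \<Omega>)"
    then obtain y where "y \<in> g -` A \<inter> \<Omega>" "f n x = f n y" "x \<in> \<Omega>" by auto
    then show "x \<in> g -` A \<inter> \<Omega>" using g[of x y] by simp
  next
    fix x assume "x \<in> g -` A \<inter> \<Omega>"
    then show "x \<in> (\<Union>c \<in> f n ` (g -` A \<inter> \<Omega>). f n -` {c} \<inter> \<Omega>)"
      by (intro UN_I[of "f n x"] imageI) simp_all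
  qed
  also have "\<dots> \<in> sigma_sets \<Omega> {f n -` {c} \<inter> \<Omega> | n c. True}"
  proof -
    interpret sigma_algebra \<Omega> "sigma_sets \<Omega> {f n -` {c} \<inter> \<Omega> | n c. True}"
      by (rule sigma_algebra_sigma_sets[OF sub])
    show ?thesis
      by (intro finite_UN finite_subset[OF _ fin] image_mono Int_lower2) blast
  qed
  finally show "g -` A \<inter> space (sigma \<Omega> {f n -` {c} \<inter> \<Omega> | n c. True})
      \<in> sets (sigma \<Omega> {f n -` {c} \<inter> \<Omega> | n c. True})"
    by (simp only: space_measure_of[OF sub] sets_measure_of[OF sub])
qed

section \<open>A strong law for block functions of independent sequences\<close>

lemma AE_summable_of_integrals:
  fixes X :: "nat \<Rightarrow> 'a \<Rightarrow> real"
  assumes [measurable]: "\<And>l. X l \<in> borel_measurable M" and nn: "\<And>l x. 0 \<le> X l x"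
    and le: "\<And>l. (\<integral>\<^sup>+x. X l x \<partial>M) \<le> ennreal (c l)" and c: "\<And>l. 0 \<le> c l" "summable c"
  shows "AE x in M. summable (\<lambda>l. X l x)"
proof -
  have "(\<integral>\<^sup>+x. (\<Sum>l. ennreal (X l x)) \<partial>M) = (\<Sum>l. \<integral>\<^sup>+x. X l x \<partial>M)"
    by (rule nn_integral_suminf) simp
  also have "\<dots> \<le> (\<Sum>l. ennreal (c l))"
    by (intro suminf_le le summableI)
  also have "\<dots> = ennreal (\<Sum>l. c l)"
    using c by (intro suminf_ennreal2) auto
  also have "\<dots> < \<infinity>" by simp
  finally have "AE x in M. (\<Sum>l. ennreal (X l x)) \<noteq> \<infinity>"
    by (intro nn_integral_PInf_AE) auto
  then show ?thesis
    by eventually_elim (auto intro: summable_suminf_not_top simp: nn)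
qed

text \<open>Consecutive squares are so close that the sequence changes between them by an amount of smaller
  order than the squares themselves.\<close>

lemma average_tendsto_0_from_squares:
  fixes a :: "nat \<Rightarrow> real"
  assumes inc: "\<And>N. \<bar>a (Suc N) - a N\<bar> \<le> 1"
    and sq: "(\<lambda>l. a ((Suc l)\<^sup>2) / real ((Suc l)\<^sup>2)) \<longlonglongrightarrow> 0"
  shows "(\<lambda>N. a N / real N) \<longlonglongrightarrow> 0"
proof -
  have dist: "\<bar>a (N + d) - a N\<bar> \<le> real d" for N d
  proof (induction d)
    case (Suc d)
    then show ?case using inc[of "N + d"] by simp
  qed simp
  have lim: "filterlim floor_sqrt sequentially sequentially"
    unfolding filterlim_at_top eventually_sequentially
  proof (intro allI exI impI)
    fix Z N :: nat assume "Z\<^sup>2 \<le> N"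
    then have "floor_sqrt (Z\<^sup>2) \<le> floor_sqrt N" by (rule monoD[OF mono_floor_sqrt])
    then show "Z \<le> floor_sqrt N" by simp
  qed
  have sq': "(\<lambda>l. a (l\<^sup>2) / real (l\<^sup>2)) \<longlonglongrightarrow> 0"
    using sq by (rule LIMSEQ_imp_Suc)
  have "(\<lambda>N. \<bar>a ((floor_sqrt N)\<^sup>2) / real ((floor_sqrt N)\<^sup>2)\<bar> + 2 * (1 / real (floor_sqrt N))) \<longlonglongrightarrow> \<bar>0\<bar> + 2 * 0"
    by (intro tendsto_add tendsto_rabs tendsto_mult tendsto_const filterlim_compose[OF sq' lim]
        filterlim_compose[OF lim_1_over_n lim])
  then have *: "(\<lambda>N. \<bar>a ((floor_sqrt N)\<^sup>2) / real ((floor_sqrt N)\<^sup>2)\<bar> + 2 * (1 / real (floor_sqrt N))) \<longlonglongrightarrow> 0"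
    by simp
  show ?thesis
  proof (rule Lim_null_comparison[OF _ *])
    show "eventually (\<lambda>N. norm (a N / real N) \<le>
      \<bar>a ((floor_sqrt N)\<^sup>2) / real ((floor_sqrt N)\<^sup>2)\<bar> + 2 * (1 / real (floor_sqrt N))) sequentially"
      using eventually_ge_at_top[of 1]
    proof eventually_elim
      case (elim N)
      define l where "l = floor_sqrt N"
      have l: "l\<^sup>2 \<le> N" "N < (Suc l)\<^sup>2" "l > 0"
        using elim Suc_floor_sqrt_power2_gt[of N] by (auto simp: l_def)
      have "\<bar>a N\<bar> \<le> \<bar>a (l\<^sup>2)\<bar> + real (N - l\<^sup>2)"
        using dist[of "l\<^sup>2" "N - l\<^sup>2"] l by auto
      also have "real (N - l\<^sup>2) \<le> 2 * real l"
        using l by (simp add: power2_eq_square of_nat_diff flip: of_nat_mult of_nat_add)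
      finally have "\<bar>a N\<bar> / real N \<le> (\<bar>a (l\<^sup>2)\<bar> + 2 * real l) / real (l\<^sup>2)"
        using l by (intro frac_le) (auto simp flip: of_nat_power)
      also have "\<dots> = \<bar>a (l\<^sup>2) / real (l\<^sup>2)\<bar> + 2 * (1 / real l)"
        using l by (simp add: add_divide_distrib power2_eq_square)
      finally show ?case by (simp add: l_def abs_divide)
    qed
  qed
qed

context sequence_space
begin

lemma distr_shift: "distr S S (\<lambda>y i. y (i + j)) = S"
  using distr_PiM_reindex[of UNIV "\<lambda>_. M" "\<lambda>i. i + j" "UNIV :: nat set"] M.prob_space_axioms
  by (simp add: inj_on_def restrict_def)

lemma measurable_shift [measurable]: "(\<lambda>y i. y (i + j)) \<in> S \<rightarrow>\<^sub>M S"
  by (rule measurable_PiM_single') (auto simp: space_PiM)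

lemma integral_shift:
  fixes h :: "_ \<Rightarrow> real"
  assumes [measurable]: "h \<in> borel_measurable S"
  shows "(\<integral>y. h (\<lambda>i. y (i + j)) \<partial>S) = (\<integral>y. h y \<partial>S)"
  by (subst (2) distr_shift[of j, symmetric]) (simp add: integral_distr)

text \<open>Cutting the sequence after the first \<open>d\<close> terms yields an independent copy of the whole sequence, so
  the two factors integrate separately.\<close>

lemma uncorrelated_blocks:
  fixes g h :: "_ \<Rightarrow> real"
  assumes [measurable]: "g \<in> borel_measurable S" "h \<in> borel_measurable S"
    and b: "\<And>y. y \<in> space S \<Longrightarrow> \<bar>g y\<bar> \<le> 1" "\<And>y. y \<in> space S \<Longrightarrow> \<bar>h y\<bar> \<le> 1"
    and loc: "\<And>y y'. y \<in> space S \<Longrightarrow> y' \<in> space S \<Longrightarrow> (\<And>i. i < d \<Longrightarrow> y i = y' i) \<Longrightarrow> g y = g y'"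
  shows "(\<integral>y. g y * h (\<lambda>i. y (i + d)) \<partial>S) = (\<integral>y. g y \<partial>S) * (\<integral>y. h y \<partial>S)"
proof -
  interpret SS: pair_prob_space S S ..
  have "(\<integral>y. g y * h (\<lambda>i. y (i + d)) \<partial>S) =
    (\<integral>y. g y * h (\<lambda>i. y (i + d)) \<partial>distr (S \<Otimes>\<^sub>M S) S (\<lambda>(\<omega>, \<omega>'). comb_seq d \<omega> \<omega>'))"
    by (simp only: PiM_comb_seq)
  also have "\<dots> = (\<integral>z. g (comb_seq d (fst z) (snd z)) * h (\<lambda>i. comb_seq d (fst z) (snd z) (i + d)) \<partial>(S \<Otimes>\<^sub>M S))"
    by (subst integral_distr) (simp_all add: case_prod_unfold)
  also have "\<dots> = (\<integral>z. g (fst z) * h (snd z) \<partial>(S \<Otimes>\<^sub>M S))"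
  proof (rule Bochner_Integration.integral_cong[OF refl])
    fix z assume z: "z \<in> space (S \<Otimes>\<^sub>M S)"
    have "comb_seq d (fst z) (snd z) \<in> space S"
      using z by (auto simp: space_pair_measure space_PiM PiE_iff split: split_comb_seq)
    then have "g (comb_seq d (fst z) (snd z)) = g (fst z)"
      using z by (intro loc) (auto simp: space_pair_measure comb_seq_less)
    then show "g (comb_seq d (fst z) (snd z)) * h (\<lambda>i. comb_seq d (fst z) (snd z) (i + d)) = g (fst z) * h (snd z)"
      by (simp add: comb_seq_add)
  qed
  also have "\<dots> = (\<integral>x. (\<integral>y. g x * h y \<partial>S) \<partial>S)"
  proof (subst SS.integral_fst'[symmetric])
    show "integrable (S \<Otimes>\<^sub>M S) (\<lambda>z. g (fst z) * h (snd z))"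
      by (rule SS.integrable_const_bound[of _ 1])
        (auto intro!: AE_I2 mult_le_one b simp: abs_mult space_pair_measure)
  qed simp
  finally show ?thesis by simp
qed

text \<open>All but at most \<open>2 * n * N\<close> of the covariances in the second moment of the sum of \<open>N\<close> terms vanish.
  The variances of the averages over \<open>l\<^sup>2\<close> terms are therefore summable in \<open>l\<close>.\<close>

lemma slln_block_factor:
  fixes f :: "(nat \<Rightarrow> 'a) \<Rightarrow> real"
  assumes f [measurable]: "f \<in> borel_measurable S"
    and bnd: "\<And>y. y \<in> space S \<Longrightarrow> 0 \<le> f y \<and> f y \<le> 1"
    and loc: "\<And>y y'. y \<in> space S \<Longrightarrow> y' \<in> space S \<Longrightarrow> (\<And>i. i < n \<Longrightarrow> y i = y' i) \<Longrightarrow> f y = f y'"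
  shows "AE y in S. (\<lambda>N. (\<Sum>j=1..N. f (\<lambda>i. y (i + j))) / real N) \<longlonglongrightarrow> (\<integral>y. f y \<partial>S)"
proof -
  define \<mu> where "\<mu> = (\<integral>y. f y \<partial>S)"
  define g where "g y = f y - \<mu>" for y
  have g [measurable]: "g \<in> borel_measurable S" unfolding g_def by measurable
  have int_f: "integrable S f"
    by (rule P.integrable_const_bound[of _ 1]) (use bnd in \<open>auto intro!: AE_I2\<close>)
  have "0 \<le> \<mu>" "\<mu> \<le> 1"
    unfolding \<mu>_def using bnd by (auto intro!: integral_nonneg_AE P.integral_le_const int_f AE_I2)
  then have gb: "\<bar>g y\<bar> \<le> 1" if "y \<in> space S" for y
    using bnd[OF that] by (auto simp: g_def)
  have gloc: "g y = g y'" if "y \<in> space S" "y' \<in> space S" "\<And>i. i < n \<Longrightarrow> y i = y' i" for y y'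
    using loc[OF that] by (simp add: g_def)
  have Eg: "(\<integral>y. g y \<partial>S) = 0"
    using int_f by (simp add: g_def P.prob_space \<mu>_def)
  have sp: "(\<lambda>i. y (i + j)) \<in> space S" if "y \<in> space S" for y j
    using that by (auto simp: space_PiM PiE_iff)
  define T where "T N y = (\<Sum>j=1..N. g (\<lambda>i. y (i + j)))" for N y
  have T [measurable]: "T N \<in> borel_measurable S" for N unfolding T_def by measurable
  \<comment> \<open>Shifting the pair to the origin leaves two blocks that do not overlap.\<close>
  have cov0: "(\<integral>y. g (\<lambda>l. y (l + i)) * g (\<lambda>l. y (l + j)) \<partial>S) = 0" if "i + n \<le> j" for i j
  proof -
    have "(\<integral>y. g (\<lambda>l. y (l + i)) * g (\<lambda>l. y (l + j)) \<partial>S) =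
      (\<integral>y. (\<lambda>y. g y * g (\<lambda>l. y (l + (j - i)))) (\<lambda>l. y (l + i)) \<partial>S)"
      using that by simp
    also have "\<dots> = (\<integral>y. g y * g (\<lambda>l. y (l + (j - i))) \<partial>S)"
      by (rule integral_shift) measurable
    also have "\<dots> = 0"
      using that by (subst uncorrelated_blocks) (auto simp: gb Eg intro!: gloc)
    finally show ?thesis .
  qed
  have le1: "\<bar>g (\<lambda>l. y (l + i)) * g (\<lambda>l. y (l + j))\<bar> \<le> 1" if "y \<in> space S" for y i j
    using gb[OF sp[OF that]] by (simp add: abs_mult mult_le_one)
  have int: "integrable S (\<lambda>y. g (\<lambda>l. y (l + i)) * g (\<lambda>l. y (l + j)))" for i j
    by (rule P.integrable_const_bound[of _ 1]) (use le1 in \<open>auto intro!: AE_I2\<close>)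
  have cov1: "(\<integral>y. g (\<lambda>l. y (l + i)) * g (\<lambda>l. y (l + j)) \<partial>S) \<le> (if j \<in> {i-n..<i+n} then 1 else 0)" for i j
  proof -
    consider "j \<in> {i-n..<i+n}" | "i + n \<le> j" | "j + n \<le> i" by fastforce
    then show ?thesis
    proof cases
      case 1
      then show ?thesis
        using le1 by (auto intro!: P.integral_le_const int AE_I2 dest: abs_le_D1)
    next
      case 2
      then show ?thesis using cov0[of i j] by simp
    next
      case 3
      then show ?thesis using cov0[of j i] by (simp add: mult.commute)
    qed
  qed
  have T2: "(\<integral>y. (T N y)\<^sup>2 \<partial>S) \<le> real (2 * n) * real N" for N
  proof -
    have "(\<integral>y. (T N y)\<^sup>2 \<partial>S) = (\<Sum>i=1..N. \<Sum>j=1..N. \<integral>y. g (\<lambda>l. y (l + i)) * g (\<lambda>l. y (l + j)) \<partial>S)"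
      unfolding T_def power2_eq_square sum_product
      by (subst Bochner_Integration.integral_sum integrable_sum, auto intro!: int)+
    also have "\<dots> \<le> (\<Sum>i=1..N. \<Sum>j=1..N. if j \<in> {i-n..<i+n} then 1 else 0)"
      by (intro sum_mono cov1)
    also have "\<dots> \<le> (\<Sum>i=1..N. real (2 * n))"
    proof (rule sum_mono)
      fix i
      have "(\<Sum>j=1..N. if j \<in> {i-n..<i+n} then 1 else (0::real)) = real (card ({1..N} \<inter> {i-n..<i+n}))"
        by (simp only: sum.inter_restrict[symmetric] finite_atLeastAtMost real_of_card)
      also have "\<dots> \<le> real (card {i-n..<i+n})"
        by (intro of_nat_mono card_mono) auto
      also have "\<dots> \<le> real (2 * n)" by simp
      finally show "(\<Sum>j=1..N. if j \<in> {i-n..<i+n} then 1 else 0) \<le> real (2 * n)" .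
    qed
    finally show ?thesis by (simp add: mult.commute)
  qed
  have int_T2: "integrable S (\<lambda>y. (T N y)\<^sup>2)" for N
    unfolding T_def power2_eq_square sum_product by (auto intro!: int)
  have "AE y in S. summable (\<lambda>l. (T ((Suc l)\<^sup>2) y / real ((Suc l)\<^sup>2))\<^sup>2)"
  proof (rule AE_summable_of_integrals)
    fix l
    define N where "N = (Suc l)\<^sup>2"
    have "N > 0" by (simp add: N_def)
    have "(\<integral>\<^sup>+y. (T N y / real N)\<^sup>2 \<partial>S) = ennreal (\<integral>y. (T N y / real N)\<^sup>2 \<partial>S)"
      using int_T2 by (intro nn_integral_eq_integral) (auto simp: power_divide)
    also have "(\<integral>y. (T N y / real N)\<^sup>2 \<partial>S) = (\<integral>y. (T N y)\<^sup>2 \<partial>S) / (real N)\<^sup>2"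
      by (simp add: power_divide)
    also have "\<dots> \<le> real (2 * n) * real N / (real N)\<^sup>2"
      by (intro divide_right_mono T2) auto
    also have "\<dots> = real (2 * n) * inverse ((real (Suc l))\<^sup>2)"
    proof -
      have "real N / (real N)\<^sup>2 = inverse (real N)"
        using \<open>N > 0\<close> by (simp add: power2_eq_square divide_inverse)
      then have "real (2 * n) * real N / (real N)\<^sup>2 = real (2 * n) * inverse (real N)"
        by (simp only: times_divide_eq_right[symmetric])
      then show ?thesis by (simp only: N_def of_nat_power)
    qed
    finally show "(\<integral>\<^sup>+y. (T ((Suc l)\<^sup>2) y / real ((Suc l)\<^sup>2))\<^sup>2 \<partial>S) \<le> ennreal (real (2 * n) * inverse ((real (Suc l))\<^sup>2))"
      unfolding N_def by (auto intro: ennreal_leI)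
  next
    show "summable (\<lambda>l. real (2 * n) * inverse ((real (Suc l))\<^sup>2))"
      using inverse_power_summable[of 2, where 'a = real]
      by (intro summable_mult summable_Suc_iff[of "\<lambda>l. inverse ((real l)\<^sup>2)", THEN iffD2]) simp
  qed auto
  then show ?thesis
    using AE_space
  proof eventually_elim
    case (elim y)
    have "(\<lambda>l. sqrt ((T ((Suc l)\<^sup>2) y / real ((Suc l)\<^sup>2))\<^sup>2)) \<longlonglongrightarrow> sqrt 0"
      by (intro tendsto_real_sqrt summable_LIMSEQ_zero elim)
    then have "(\<lambda>l. T ((Suc l)\<^sup>2) y / real ((Suc l)\<^sup>2)) \<longlonglongrightarrow> 0"
      by (simp only: real_sqrt_abs real_sqrt_zero tendsto_rabs_zero_iff)
    then have lim: "(\<lambda>N. T N y / real N) \<longlonglongrightarrow> 0"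
    proof (rule average_tendsto_0_from_squares[rotated])
      fix N
      show "\<bar>T (Suc N) y - T N y\<bar> \<le> 1"
        using gb[OF sp[OF elim(2)], of "Suc N"] by (simp add: T_def)
    qed
    have "(\<lambda>N. T N y / real N + \<mu>) \<longlonglongrightarrow> 0 + \<mu>"
      by (intro tendsto_add lim tendsto_const)
    also have "?this \<longleftrightarrow> (\<lambda>N. (\<Sum>j=1..N. f (\<lambda>i. y (i + j))) / real N) \<longlonglongrightarrow> 0 + \<mu>"
    proof (rule filterlim_cong[OF refl refl])
      show "eventually (\<lambda>N. T N y / real N + \<mu> = (\<Sum>j=1..N. f (\<lambda>i. y (i + j))) / real N) sequentially"
        using eventually_gt_at_top[of 0]
        by eventually_elim (simp add: T_def g_def sum_subtractf field_simps)
    qed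
    finally show ?case by (simp add: \<mu>_def)
  qed
qed

end

section \<open>Coding a measure on infinite words by an interval\<close>

text \<open>The weights of the words of each length are laid out along \<open>[0, w [])\<close> in lexicographic order: this
  is the total weight of the words to the left of \<open>\<sigma>\<close>.\<close>

definition left_end :: "(nat list \<Rightarrow> real) \<Rightarrow> nat list \<Rightarrow> real" where
  "left_end w \<sigma> = (\<Sum>i<length \<sigma>. \<Sum>j=1..<\<sigma> ! i. w (take i \<sigma> @ [j]))"

text \<open>Descends from the root and selects at every vertex the child whose interval contains \<open>u\<close>.\<close>

primrec quantile_prefix :: "(nat list \<Rightarrow> real) \<Rightarrow> real \<Rightarrow> nat \<Rightarrow> nat list" where
  "quantile_prefix w u 0 = []"
| "quantile_prefix w u (Suc n) = (let \<sigma> = quantile_prefix w u n in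
     \<sigma> @ [LEAST j. u < left_end w \<sigma> + (\<Sum>i=1..j. w (\<sigma> @ [i]))])"

text \<open>Parameters outside \<open>[0, w [])\<close> are sent to an arbitrary word, to have values in the space of infinite
  words.\<close>

definition quantile_word :: "(nat list \<Rightarrow> real) \<Rightarrow> real \<Rightarrow> nat \<Rightarrow> nat" where
  "quantile_word w u n = (if 0 \<le> u \<and> u < w [] then last (quantile_prefix w u (Suc n)) else 1)"

definition consistent_weights :: "nat \<Rightarrow> nat \<Rightarrow> (nat list \<Rightarrow> real) \<Rightarrow> bool" where
  "consistent_weights k m w \<longleftrightarrow> (\<forall>\<sigma> \<in> fin_words k m. 0 \<le> w \<sigma> \<and> w \<sigma> = (\<Sum>j\<in>alphabet k m. w (\<sigma> @ [j])))"

lemma consistent_weights_nonneg: "consistent_weights k m w \<Longrightarrow> \<sigma> \<in> fin_words k m \<Longrightarrow> 0 \<le> w \<sigma>"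
  unfolding consistent_weights_def by blast

lemma consistent_weights_sum:
  "consistent_weights k m w \<Longrightarrow> \<sigma> \<in> fin_words k m \<Longrightarrow> w \<sigma> = (\<Sum>j\<in>alphabet k m. w (\<sigma> @ [j]))"
  unfolding consistent_weights_def by blast

lemma length_quantile_prefix [simp]: "length (quantile_prefix w u n) = n"
  by (induction n) (auto simp: Let_def)

lemma left_end_Nil [simp]: "left_end w [] = 0"
  by (simp add: left_end_def)

lemma left_end_snoc: "left_end w (\<sigma> @ [j]) = left_end w \<sigma> + (\<Sum>i=1..<j. w (\<sigma> @ [i]))"
  by (simp add: left_end_def nth_append)

text \<open>The intervals of the children of a word partition the interval of the word.  Hence the image of
  Lebesgue measure on \<open>[0, w [])\<close> gives mass \<open>w \<sigma>\<close> to the cylinder of \<open>\<sigma>\<close>: this constructs a measure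
  from its masses on cylinders.\<close>

lemma quantile_prefix_iff:
  assumes w: "consistent_weights k m w" and u: "0 \<le> u" "u < w []"
  shows "quantile_prefix w u n \<in> fin_words k m \<and>
    (\<forall>\<sigma> \<in> level k m n. quantile_prefix w u n = \<sigma> \<longleftrightarrow> left_end w \<sigma> \<le> u \<and> u < left_end w \<sigma> + w \<sigma>)"
proof (induction n)
  case 0
  then show ?case using u by (auto simp: level_0)
next
  case (Suc n)
  define \<sigma> where "\<sigma> = quantile_prefix w u n"
  define s where "s j = left_end w \<sigma> + (\<Sum>i=1..j. w (\<sigma> @ [i]))" for j
  define l where "l = (LEAST j. u < s j)"
  have \<sigma>: "\<sigma> \<in> fin_words k m" "\<sigma> \<in> level k m n"
    using Suc by (auto simp: \<sigma>_def level_def)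
  have wnn: "0 \<le> w (\<tau> @ [j])" if "j \<in> alphabet k m" "\<tau> \<in> fin_words k m" for j \<tau>
    using that by (intro consistent_weights_nonneg[OF w]) auto
  have \<sigma>u: "left_end w \<sigma> \<le> u" "u < left_end w \<sigma> + w \<sigma>"
    using Suc \<sigma>(2) unfolding \<sigma>_def[symmetric] by auto
  have "u < s (k ^ m)"
    using \<sigma>u(2) consistent_weights_sum[OF w \<sigma>(1)] by (simp add: s_def alphabet_def)
  then have l: "u < s l" "l \<le> k ^ m"
    unfolding l_def by (auto intro: LeastI Least_le)
  have "l \<noteq> 0"
    using l(1) \<sigma>u(1) by (cases l) (auto simp: s_def)
  then have lA: "l \<in> alphabet k m"
    using l by (auto simp: alphabet_def)
  have pre: "quantile_prefix w u (Suc n) = \<sigma> @ [l]"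
    by (simp add: Let_def \<sigma>_def s_def l_def)
  have smono: "s i \<le> s j" if "i \<le> j" "j \<le> k ^ m" for i j
    unfolding s_def using that \<sigma>(1)
    by (intro add_left_mono sum_mono2) (auto intro!: wnn simp: alphabet_def)
  have lj: "l = j \<longleftrightarrow> s (j - 1) \<le> u \<and> u < s j" if "j \<in> alphabet k m" for j
  proof
    assume "l = j"
    then show "s (j - 1) \<le> u \<and> u < s j"
      using l(1) \<open>l \<noteq> 0\<close> not_less_Least[of "j - 1" "\<lambda>j. u < s j"] by (auto simp: l_def)
  next
    assume j: "s (j - 1) \<le> u \<and> u < s j"
    then have "l \<le> j" unfolding l_def by (auto intro: Least_le)
    moreover have "\<not> l \<le> j - 1"
    proof
      assume "l \<le> j - 1"
      moreover have "j - 1 \<le> k ^ m" using that by (auto simp: alphabet_def)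
      ultimately show False using smono[of l "j - 1"] j l(1) by linarith
    qed
    ultimately show "l = j" by auto
  qed
  have sj: "left_end w (\<sigma> @ [j]) = s (j - 1)" "left_end w (\<sigma> @ [j]) + w (\<sigma> @ [j]) = s j"
    if "j \<in> alphabet k m" for j
  proof -
    from that obtain i where j: "j = Suc i" by (cases j) (auto simp: alphabet_def)
    \<comment> \<open>Letters start at \<open>1\<close>: the interval of the letter \<open>j\<close> ends at the partial sum \<open>s j\<close>.\<close>
    have "{1..<Suc i} = {1..i}" by auto
    then show "left_end w (\<sigma> @ [j]) = s (j - 1)" "left_end w (\<sigma> @ [j]) + w (\<sigma> @ [j]) = s j"
      by (simp_all add: s_def left_end_snoc j)
  qed
  have "quantile_prefix w u (Suc n) = \<tau> \<longleftrightarrow> left_end w \<tau> \<le> u \<and> u < left_end w \<tau> + w \<tau>"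
    if "\<tau> \<in> level k m (Suc n)" for \<tau>
  proof -
    from that obtain \<tau>' j where \<tau>: "\<tau> = \<tau>' @ [j]" "\<tau>' \<in> level k m n" "j \<in> alphabet k m"
      by (auto simp: level_Suc)
    show ?thesis
    proof (cases "\<tau>' = \<sigma>")
      case True
      then show ?thesis using lj[OF \<tau>(3)] sj[OF \<tau>(3)] by (simp only: pre \<tau>(1)) auto
    next
      case False
      \<comment> \<open>the interval of a word is contained in that of its parent\<close>
      have fw: "\<tau>' \<in> fin_words k m" using \<tau> by (auto simp: level_def)
      have "0 \<le> (\<Sum>i=1..<j. w (\<tau>' @ [i]))"
        by (intro sum_nonneg wnn fw) (use \<tau>(3) in \<open>auto simp: alphabet_def\<close>)
      moreover have "(\<Sum>i=1..<j. w (\<tau>' @ [i])) + w (\<tau>' @ [j]) = (\<Sum>i=1..j. w (\<tau>' @ [i]))"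
        using \<tau>(3) by (simp add: alphabet_def sum.last_plus add.commute)
      moreover have "(\<Sum>i=1..j. w (\<tau>' @ [i])) \<le> (\<Sum>i\<in>alphabet k m. w (\<tau>' @ [i]))"
        by (intro sum_mono2 wnn fw) (use \<tau>(3) in \<open>auto simp: alphabet_def\<close>)
      moreover have "w \<tau>' = (\<Sum>i\<in>alphabet k m. w (\<tau>' @ [i]))"
        by (rule consistent_weights_sum[OF w fw])
      moreover have "\<not> (left_end w \<tau>' \<le> u \<and> u < left_end w \<tau>' + w \<tau>')"
        using Suc \<tau>(2) False by (auto simp: \<sigma>_def)
      ultimately have "\<not> (left_end w \<tau> \<le> u \<and> u < left_end w \<tau> + w \<tau>)"
        unfolding \<tau>(1) left_end_snoc by linarith
      then show ?thesis using False by (auto simp only: pre \<tau>(1) append1_eq_conv)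
    qed
  qed
  then show ?case using pre \<sigma>(1) lA by auto
qed

lemma prefix_quantile_word:
  assumes "0 \<le> u" "u < w []"
  shows "map (quantile_word w u) [0..<n] = quantile_prefix w u n"
proof (induction n)
  case (Suc n)
  have "quantile_word w u n = last (quantile_prefix w u (Suc n))"
    using assms by (simp add: quantile_word_def)
  then show ?case using Suc by (simp add: Let_def)
qed simp

lemma quantile_word_in_space:
  assumes w: "consistent_weights k m w" and k: "k \<ge> 1"
  shows "quantile_word w u \<in> space (inf_words k m)"
proof -
  have "quantile_word w u n \<in> alphabet k m" for n
  proof (cases "0 \<le> u \<and> u < w []")
    case True
    then have "quantile_prefix w u (Suc n) \<in> fin_words k m"
      using quantile_prefix_iff[OF w] by blast
    moreover have "quantile_prefix w u (Suc n) \<noteq> []"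
      using length_quantile_prefix[of w u "Suc n"] by (metis length_0_conv nat.distinct(1))
    ultimately show ?thesis
      using True by (auto simp: quantile_word_def in_lists_conv_set simp del: quantile_prefix.simps)
  next
    case False
    then show ?thesis using k by (auto simp: quantile_word_def alphabet_def)
  qed
  then show ?thesis by (auto simp: inf_words_def space_PiM)
qed

lemma quantile_word_cylinder:
  assumes w: "consistent_weights k m w" and k: "k \<ge> 1" and u: "0 \<le> u" "u < w []"
    and \<sigma>: "\<sigma> \<in> fin_words k m"
  shows "quantile_word w u \<in> cylinder k m \<sigma> \<longleftrightarrow> left_end w \<sigma> \<le> u \<and> u < left_end w \<sigma> + w \<sigma>"
  using quantile_prefix_iff[OF w u, of "length \<sigma>"] \<sigma> quantile_word_in_space[OF w k, of u]
    prefix_quantile_word[of u w "length \<sigma>"] u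
  by (simp add: cylinder_def level_def)

lemma cylinder_interval_sub:
  assumes w: "consistent_weights k m w" and \<sigma>: "\<sigma> \<in> fin_words k m"
  shows "0 \<le> left_end w \<sigma>" "left_end w \<sigma> + w \<sigma> \<le> w []"
proof -
  have "0 \<le> left_end w \<sigma> \<and> left_end w \<sigma> + w \<sigma> \<le> w []" using \<sigma>
  proof (induction \<sigma> rule: rev_induct)
    case (snoc j \<sigma>)
    have wnn: "0 \<le> w (\<sigma> @ [j])" if "j \<in> alphabet k m" for j
      using that snoc by (intro consistent_weights_nonneg[OF w]) auto
    have "0 \<le> (\<Sum>i=1..<j. w (\<sigma> @ [i]))"
      by (intro sum_nonneg wnn) (use snoc in \<open>auto simp: alphabet_def\<close>)
    moreover have "(\<Sum>i=1..<j. w (\<sigma> @ [i])) + w (\<sigma> @ [j]) = (\<Sum>i=1..j. w (\<sigma> @ [i]))"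
      using snoc by (simp add: alphabet_def sum.last_plus add.commute)
    moreover have "(\<Sum>i=1..j. w (\<sigma> @ [i])) \<le> (\<Sum>i\<in>alphabet k m. w (\<sigma> @ [i]))"
      by (intro sum_mono2 wnn) (use snoc in \<open>auto simp: alphabet_def\<close>)
    moreover have "w \<sigma> = (\<Sum>i\<in>alphabet k m. w (\<sigma> @ [i]))"
      using snoc by (intro consistent_weights_sum[OF w]) auto
    moreover have "0 \<le> left_end w \<sigma>" "left_end w \<sigma> + w \<sigma> \<le> w []"
      using snoc by simp_all
    ultimately show ?case
      unfolding left_end_snoc by (intro conjI) linarith+
  qed simp
  then show "0 \<le> left_end w \<sigma>" "left_end w \<sigma> + w \<sigma> \<le> w []"
    by (rule conjunct1, rule conjunct2)
qed

lemma cylinder_sets: "cylinder k m \<sigma> \<in> sets (inf_words k m)"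
proof -
  have "cylinder k m \<sigma> = {\<eta> \<in> space (inf_words k m). \<forall>i\<in>{..<length \<sigma>}. \<eta> i = \<sigma> ! i}"
  proof -
    have "map \<eta> [0..<length \<sigma>] = \<sigma> \<longleftrightarrow> (\<forall>i\<in>{..<length \<sigma>}. \<eta> i = \<sigma> ! i)" for \<eta>
      by (subst list_eq_iff_nth_eq) auto
    then show ?thesis by (simp only: cylinder_def)
  qed
  also have "\<dots> \<in> sets (inf_words k m)"
  proof (intro sets.sets_Collect_finite_All)
    fix i
    have [measurable]: "(\<lambda>\<eta>. \<eta> i) \<in> inf_words k m \<rightarrow>\<^sub>M count_space (alphabet k m)"
      unfolding inf_words_def by (rule measurable_component_singleton) simp
    show "{\<eta> \<in> space (inf_words k m). \<eta> i = \<sigma> ! i} \<in> sets (inf_words k m)"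
      by measurable
  qed simp
  finally show ?thesis .
qed

lemma measurable_inf_words:
  assumes sp: "\<And>x. x \<in> space M \<Longrightarrow> f x \<in> space (inf_words k m)"
    and cyl: "\<And>\<sigma>. \<sigma> \<in> fin_words k m \<Longrightarrow> {x \<in> space M. f x \<in> cylinder k m \<sigma>} \<in> sets M"
  shows "f \<in> M \<rightarrow>\<^sub>M inf_words k m"
  unfolding inf_words_def
proof (rule measurable_PiM_single')
  show "(\<lambda>x i. f x i) \<in> space M \<rightarrow> (\<Pi>\<^sub>E i\<in>UNIV. space (count_space (alphabet k m)))"
    using sp by (auto simp: inf_words_def space_PiM)
  fix n :: nat
  have A: "f x i \<in> alphabet k m" if "x \<in> space M" for x i
    using sp[OF that] by (auto simp: inf_words_def space_PiM)
  show "(\<lambda>x. f x n) \<in> M \<rightarrow>\<^sub>M count_space (alphabet k m)"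
  proof (subst measurable_count_space_eq2)
    show "finite (alphabet k m)" by (simp add: alphabet_def)
    show "(\<lambda>x. f x n) \<in> space M \<rightarrow> alphabet k m \<and> (\<forall>a\<in>alphabet k m. (\<lambda>x. f x n) -` {a} \<inter> space M \<in> sets M)"
    proof (intro conjI ballI)
      show "(\<lambda>x. f x n) \<in> space M \<rightarrow> alphabet k m" using A by auto
      fix a assume "a \<in> alphabet k m"
      have "(\<lambda>x. f x n) -` {a} \<inter> space M =
        (\<Union>\<sigma> \<in> {\<sigma> \<in> level k m (Suc n). \<sigma> ! n = a}. {x \<in> space M. f x \<in> cylinder k m \<sigma>})"
      proof (intro set_eqI iffI)
        fix x assume x: "x \<in> (\<lambda>x. f x n) -` {a} \<inter> space M"
        then have "map (f x) [0..<Suc n] \<in> {\<sigma> \<in> level k m (Suc n). \<sigma> ! n = a}"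
          using A by (auto simp: level_def in_lists_conv_set nth_append simp del: upt_Suc)
        moreover have "f x \<in> cylinder k m (map (f x) [0..<Suc n])"
          using x sp by (simp add: cylinder_def del: upt_Suc)
        ultimately show "x \<in> (\<Union>\<sigma> \<in> {\<sigma> \<in> level k m (Suc n). \<sigma> ! n = a}. {x \<in> space M. f x \<in> cylinder k m \<sigma>})"
          using x by blast
      next
        fix x assume "x \<in> (\<Union>\<sigma> \<in> {\<sigma> \<in> level k m (Suc n). \<sigma> ! n = a}. {x \<in> space M. f x \<in> cylinder k m \<sigma>})"
        then obtain \<sigma> where "\<sigma> \<in> level k m (Suc n)" "\<sigma> ! n = a" "x \<in> space M" "f x \<in> cylinder k m \<sigma>"
          by blast
        then have \<sigma>: "length \<sigma> = Suc n" "\<sigma> ! n = a" "x \<in> space M" "map (f x) [0..<length \<sigma>] = \<sigma>"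
          by (auto simp: level_def cylinder_def simp del: upt_Suc)
        have "map (f x) [0..<Suc n] ! n = \<sigma> ! n" using \<sigma>(1,4) by metis
        then show "x \<in> (\<lambda>x. f x n) -` {a} \<inter> space M"
          using \<sigma> by (simp add: nth_append)
      qed
      also have "\<dots> \<in> sets M"
        by (intro sets.finite_UN finite_subset[OF _ finite_level[of k m "Suc n"]] cyl) (auto simp: level_def)
      finally show "(\<lambda>x. f x n) -` {a} \<inter> space M \<in> sets M" .
    qed
  qed
qed

text \<open>Joint measurability in the weights and in the parameter lets Fubini's theorem replace the theory of
  kernels when the weights are random.\<close>

lemma measurable_quantile_word:
  fixes w :: "'a \<Rightarrow> nat list \<Rightarrow> real"
  assumes w: "\<And>x. x \<in> space M \<Longrightarrow> consistent_weights k m (w x)" and k: "k \<ge> 1"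
    and meas: "\<And>\<sigma>. \<sigma> \<in> fin_words k m \<Longrightarrow> (\<lambda>x. w x \<sigma>) \<in> borel_measurable M"
  shows "(\<lambda>(x, u). quantile_word (w x) u) \<in> M \<Otimes>\<^sub>M borel \<rightarrow>\<^sub>M inf_words k m"
proof (rule measurable_inf_words)
  fix z :: "'a \<times> real" assume "z \<in> space (M \<Otimes>\<^sub>M borel)"
  then show "(case z of (x, u) \<Rightarrow> quantile_word (w x) u) \<in> space (inf_words k m)"
    using quantile_word_in_space[OF w k] by (auto simp: space_pair_measure)
next
  fix \<sigma> assume \<sigma>: "\<sigma> \<in> fin_words k m"
  have [measurable]: "(\<lambda>x. w x []) \<in> borel_measurable M" "(\<lambda>x. w x \<sigma>) \<in> borel_measurable M"
    using meas \<sigma> by auto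
  have [measurable]: "(\<lambda>x. left_end (w x) \<sigma>) \<in> borel_measurable M"
    unfolding left_end_def
  proof (intro borel_measurable_sum meas)
    fix i j assume ij: "i \<in> {..<length \<sigma>}" "j \<in> {1..<\<sigma> ! i}"
    then have "\<sigma> ! i \<in> alphabet k m" "set (take i \<sigma>) \<subseteq> alphabet k m"
      using \<sigma> by (auto simp: in_lists_conv_set dest: in_set_takeD)
    then show "take i \<sigma> @ [j] \<in> fin_words k m" using ij by (auto simp: alphabet_def in_lists_conv_set)
  qed
  define D where "D \<longleftrightarrow> (\<lambda>_. 1) \<in> cylinder k m \<sigma>"
  have eq: "(case z of (x, u) \<Rightarrow> quantile_word (w x) u) \<in> cylinder k m \<sigma> \<longleftrightarrow>
      (if 0 \<le> snd z \<and> snd z < w (fst z) [] then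
        left_end (w (fst z)) \<sigma> \<le> snd z \<and> snd z < left_end (w (fst z)) \<sigma> + w (fst z) \<sigma> else D)"
    if z: "z \<in> space (M \<Otimes>\<^sub>M borel)" for z
  proof (cases "0 \<le> snd z \<and> snd z < w (fst z) []")
    case True
    then show ?thesis
      using quantile_word_cylinder[OF w k _ _ \<sigma>, of "fst z" "snd z"] z
      by (auto simp: space_pair_measure)
  next
    case False
    then have "quantile_word (w (fst z)) (snd z) = (\<lambda>_. 1)"
      by (auto simp: quantile_word_def)
    then show ?thesis unfolding if_not_P[OF False] D_def case_prod_unfold by (rule arg_cong)
  qed
  have "{z \<in> space (M \<Otimes>\<^sub>M borel). if 0 \<le> snd z \<and> snd z < w (fst z) [] then
        left_end (w (fst z)) \<sigma> \<le> snd z \<and> snd z < left_end (w (fst z)) \<sigma> + w (fst z) \<sigma> else D}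
     \<in> sets (M \<Otimes>\<^sub>M borel)"
    by measurable
  also have "?this \<longleftrightarrow> {z \<in> space (M \<Otimes>\<^sub>M borel). (case z of (x, u) \<Rightarrow> quantile_word (w x) u) \<in> cylinder k m \<sigma>}
     \<in> sets (M \<Otimes>\<^sub>M borel)"
    by (intro arg_cong2[where f = "(\<in>)"] refl Collect_cong conj_cong) (simp add: eq)
  finally show "{z \<in> space (M \<Otimes>\<^sub>M borel). (case z of (x, u) \<Rightarrow> quantile_word (w x) u) \<in> cylinder k m \<sigma>}
     \<in> sets (M \<Otimes>\<^sub>M borel)" .
qed

section \<open>Variance of independent Boolean states\<close>

context
  fixes A :: "'u set" and q :: "'u \<Rightarrow> bool pmf"
  assumes A: "finite A"
begin

lemma finite_set_Pi_pmf_bool: "finite (set_pmf (Pi_pmf A False q))"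
proof -
  have "set_pmf (Pi_pmf A False q) \<subseteq> PiE_dflt A False (\<lambda>_. UNIV)"
    using set_Pi_pmf_subset[OF A, of False q] by (auto simp: PiE_dflt_def)
  then show "finite (set_pmf (Pi_pmf A False q))"
    by (rule finite_subset) (intro finite_PiE_dflt A, simp)
qed

lemma integrable_Pi_pmf_bool: "integrable (measure_pmf (Pi_pmf A False q)) (f :: _ \<Rightarrow> real)"
  by (rule integrable_measure_pmf_finite[OF finite_set_Pi_pmf_bool])

lemma expectation_of_bool: "measure_pmf.expectation (r :: bool pmf) of_bool = pmf r True"
  by (subst integral_measure_pmf_real[of UNIV]) (auto simp: UNIV_bool)

lemma Pi_pmf_bool_mean:
  assumes "u \<in> A"
  shows "measure_pmf.expectation (Pi_pmf A False q) (\<lambda>c. of_bool (c u)) = pmf (q u) True"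
proof -
  have "measure_pmf.expectation (Pi_pmf A False q) (\<lambda>c. of_bool (c u) :: real) =
    measure_pmf.expectation (map_pmf (\<lambda>c. c u) (Pi_pmf A False q)) of_bool"
    by (simp only: integral_map_pmf)
  also have "\<dots> = pmf (q u) True"
    by (subst Pi_pmf_component[OF A]) (use assms in \<open>simp add: expectation_of_bool\<close>)
  finally show ?thesis .
qed

lemma Pi_pmf_bool_pair:
  assumes uv: "u \<in> A" "v \<in> A" "u \<noteq> v"
  shows "measure_pmf.expectation (Pi_pmf A False q) (\<lambda>c. of_bool (c u) * of_bool (c v)) = pmf (q u) True * pmf (q v) True"
proof -
  define f where "f x y = (if x \<in> {u, v} then of_bool y else 1 :: real)" for x y
  have "measure_pmf.expectation (Pi_pmf A False q) (\<lambda>c. \<Prod>x\<in>A. f x (c x)) = (\<Prod>x\<in>A. measure_pmf.expectation (q x) (f x))"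
    by (rule expectation_prod_Pi_pmf) (auto simp: A f_def intro!: integrable_measure_pmf_finite)
  moreover have "(\<Prod>x\<in>A. f x (c x)) = of_bool (c u) * of_bool (c v)" for c
  proof -
    have "(\<Prod>x\<in>A. f x (c x)) = (\<Prod>x\<in>{u, v}. f x (c x))"
      using uv A by (intro prod.mono_neutral_right) (auto simp: f_def)
    then show ?thesis using uv by (simp add: f_def)
  qed
  moreover have "(\<Prod>x\<in>A. measure_pmf.expectation (q x) (f x)) = pmf (q u) True * pmf (q v) True"
  proof -
    have "f x = (\<lambda>_. 1)" if "x \<notin> {u, v}" for x
      using that by (auto simp: f_def)
    then have "(\<Prod>x\<in>A. measure_pmf.expectation (q x) (f x)) = (\<Prod>x\<in>{u, v}. measure_pmf.expectation (q x) (f x))"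
      using uv A by (intro prod.mono_neutral_right) auto
    moreover have "f u = of_bool" "f v = of_bool" by (auto simp: f_def fun_eq_iff)
    ultimately show ?thesis using uv by (simp add: expectation_of_bool)
  qed
  ultimately show ?thesis by simp
qed

lemma Pi_pmf_bool_variance:
  assumes S: "S \<subseteq> A"
  shows "measure_pmf.expectation (Pi_pmf A False q) (\<lambda>c. (\<Sum>u\<in>S. of_bool (c u) - pmf (q u) True)\<^sup>2)
    = (\<Sum>u\<in>S. pmf (q u) True * (1 - pmf (q u) True))"
proof -
  let ?E = "measure_pmf.expectation (Pi_pmf A False q)" and ?r = "\<lambda>u. pmf (q u) True"
  have fS: "finite S" using S A finite_subset by auto
  have pair: "?E (\<lambda>c. (of_bool (c u) - ?r u) * (of_bool (c v) - ?r v)) =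
      (if u = v then ?r u * (1 - ?r u) else 0)" if uv: "u \<in> S" "v \<in> S" for u v
  proof -
    have uvA: "u \<in> A" "v \<in> A" using uv S by auto
    have "?E (\<lambda>c. (of_bool (c u) - ?r u) * (of_bool (c v) - ?r v)) =
      ?E (\<lambda>c. of_bool (c u) * of_bool (c v) - ?r u * of_bool (c v) - ?r v * of_bool (c u) + ?r u * ?r v)"
      by (intro Bochner_Integration.integral_cong) (auto simp: algebra_simps)
    also have "\<dots> = ?E (\<lambda>c. of_bool (c u) * of_bool (c v)) - ?r u * ?r v"
      using Pi_pmf_bool_mean uvA
      by (simp add: integrable_Pi_pmf_bool)
    also have "\<dots> = (if u = v then ?r u * (1 - ?r u) else 0)"
    proof (cases "u = v")
      case True
      then have "(\<lambda>c. of_bool (c u) * of_bool (c v)) = (\<lambda>c. of_bool (c u) :: real)" by (auto simp: fun_eq_iff)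
      then show ?thesis using True Pi_pmf_bool_mean[OF uvA(1)] by (simp add: algebra_simps)
    next
      case False
      then show ?thesis using Pi_pmf_bool_pair[OF uvA] by simp
    qed
    finally show ?thesis .
  qed
  have "?E (\<lambda>c. (\<Sum>u\<in>S. of_bool (c u) - ?r u)\<^sup>2) =
    (\<Sum>u\<in>S. \<Sum>v\<in>S. ?E (\<lambda>c. (of_bool (c u) - ?r u) * (of_bool (c v) - ?r v)))"
    unfolding power2_eq_square sum_product by (simp add: integrable_Pi_pmf_bool)
  also have "\<dots> = (\<Sum>u\<in>S. \<Sum>v\<in>S. if u = v then ?r u * (1 - ?r u) else 0)"
    by (intro sum.cong refl pair) auto
  also have "\<dots> = (\<Sum>u\<in>S. ?r u * (1 - ?r u))"
    using fS by (simp add: sum.delta)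
  finally show ?thesis .
qed

end

section \<open>The percolation law generation by generation\<close>

definition words_upto :: "nat \<Rightarrow> nat \<Rightarrow> nat \<Rightarrow> nat list set" where
  "words_upto k m n = {\<sigma> \<in> fin_words k m. length \<sigma> \<le> n}"

text \<open>A configuration up to generation \<open>n\<close> is represented by a finite set of words, so that equality of
  configurations is equality of sets.\<close>

definition chosen :: "nat \<Rightarrow> nat \<Rightarrow> nat \<Rightarrow> (nat list \<Rightarrow> bool) \<Rightarrow> nat list set" where
  "chosen k m n \<omega> = {\<sigma> \<in> words_upto k m n. \<omega> \<sigma>}"

lemma words_upto_Suc: "words_upto k m (Suc n) = words_upto k m n \<union> level k m (Suc n)"
  by (auto simp: words_upto_def level_def)

lemma words_upto_0: "words_upto k m 0 = {[]}"
  by (auto simp: words_upto_def)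

lemma finite_words_upto [simp]: "finite (words_upto k m n)"
  by (induction n) (simp_all add: words_upto_Suc words_upto_0 finite_level)

lemma level_subset_words_upto: "l \<le> n \<Longrightarrow> level k m l \<subseteq> words_upto k m n"
  by (auto simp: words_upto_def level_def)

lemma chosen_mono: "n \<le> n' \<Longrightarrow> chosen k m n \<omega> = chosen k m n' \<omega> \<inter> words_upto k m n"
  by (auto simp: chosen_def words_upto_def)

definition generation :: "nat list set \<Rightarrow> nat list \<Rightarrow> nat \<Rightarrow> nat list set" where
  "generation C \<sigma> n = {\<tau> \<in> C. length \<tau> = n \<and> prefix \<sigma> \<tau>}"

lemma descendants_generation:
  "descendants k m \<omega> j \<sigma> = card (generation (chosen k m (length \<sigma> + j) \<omega>) \<sigma> (length \<sigma> + j))"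
  unfolding descendants_def generation_def chosen_def words_upto_def
  by (rule arg_cong[where f = card]) auto

locale percolation =
  fixes k m :: nat and p :: real and P :: "(nat list \<Rightarrow> bool) measure"
  assumes k: "k \<ge> 2" and p: "1 / real k ^ m < p" "p \<le> 1" and law: "percolation_law k m p P"
begin

definition growth :: real where "growth = real k ^ m * p"

lemma growth_gt_1: "1 < growth"
  using k p by (simp add: growth_def field_simps)

lemma p_pos: "0 < p"
  using p(1) k by (meson divide_pos_pos less_trans zero_less_one zero_less_power of_nat_0_less_iff order_less_le_trans zero_less_numeral)

lemma k_powr: "real k powr (- (real j * dim_exp k m p)) = 1 / growth ^ j"
proof -
  have "real k powr (dim_exp k m p) = growth"
    using k growth_gt_1 by (simp add: powr_def dim_exp_def growth_def)
  then have "(real k powr (dim_exp k m p)) powr (real j) = growth ^ j"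
    using growth_gt_1 by (simp add: powr_realpow)
  then have "real k powr (real j * dim_exp k m p) = growth ^ j"
    by (simp add: powr_powr mult.commute)
  then show ?thesis by (simp add: powr_minus divide_inverse)
qed

sublocale prob_space P
  using law by (simp add: percolation_law_def)

lemma sets_P [measurable_cong]: "sets P = sets (realisations k m)"
  using law by (simp add: percolation_law_def)

lemma measurable_state [measurable]:
  assumes "\<sigma> \<in> fin_words k m"
  shows "Measurable.pred P (\<lambda>\<omega>. \<omega> \<sigma>)"
proof -
  have "(\<lambda>\<omega>. \<omega> \<sigma>) \<in> realisations k m \<rightarrow>\<^sub>M count_space UNIV"
    unfolding realisations_def using assms by (intro measurable_component_singleton) auto
  then show ?thesis by (subst measurable_cong_sets[OF sets_P refl])
qed

lemma measurable_chosen [measurable]: "chosen k m n \<in> P \<rightarrow>\<^sub>M count_space UNIV"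
  unfolding chosen_def
  by (intro measurable_Collect_subset measurable_state finite_words_upto) (simp add: words_upto_def)

text \<open>The joint law of the states of the first generations as a probability mass function.  The binding of
  the next generation to the previous ones gives conditional expectations by mere computation.\<close>

primrec chosen_law :: "nat \<Rightarrow> nat list set pmf" where
  "chosen_law 0 = return_pmf {[]}"
| "chosen_law (Suc n) = bind_pmf (chosen_law n) (\<lambda>B. map_pmf (\<lambda>c. B \<union> {u \<in> level k m (Suc n). c u})
     (Pi_pmf (level k m (Suc n)) False (\<lambda>u. child_law p (butlast u \<in> B))))"

lemma set_chosen_law: "set_pmf (chosen_law n) \<subseteq> Pow (words_upto k m n)"
proof (induction n)
  case 0
  then show ?case by (simp add: words_upto_0)
next
  case (Suc n)
  then show ?case by (fastforce simp: words_upto_Suc)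
qed

lemma finite_set_chosen_law [simp]: "finite (set_pmf (chosen_law n))"
  using set_chosen_law by (rule finite_subset) simp

lemma pmf_chosen_law_Suc:
  assumes C: "C \<subseteq> words_upto k m (Suc n)"
  shows "pmf (chosen_law (Suc n)) C = pmf (chosen_law n) (C \<inter> words_upto k m n) *
    (\<Prod>\<sigma>\<in>level k m n. \<Prod>j\<in>alphabet k m. pmf (child_law p (\<sigma> \<in> C)) (\<sigma> @ [j] \<in> C))"
proof -
  let ?L = "level k m (Suc n)"
  have disj: "words_upto k m n \<inter> ?L = {}" by (auto simp: words_upto_def level_def)
  define c0 where "c0 u \<longleftrightarrow> u \<in> C \<and> u \<in> ?L" for u
  have inner: "pmf (map_pmf (\<lambda>c. B \<union> {u \<in> ?L. c u}) (Pi_pmf ?L False q)) C =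
      (if B = C \<inter> words_upto k m n then \<Prod>u\<in>?L. pmf (q u) (u \<in> C) else 0)"
    if B: "B \<subseteq> words_upto k m n" for B and q :: "nat list \<Rightarrow> bool pmf"
  proof -
    have "pmf (map_pmf (\<lambda>c. B \<union> {u \<in> ?L. c u}) (Pi_pmf ?L False q)) C =
      measure_pmf.prob (Pi_pmf ?L False q) {c. B \<union> {u \<in> ?L. c u} = C}"
      by (simp add: pmf_map vimage_def)
    also have "\<dots> = measure_pmf.prob (Pi_pmf ?L False q) (if B = C \<inter> words_upto k m n then {c0} else {})"
    proof (rule measure_pmf.finite_measure_eq_AE)
      have "AE c in Pi_pmf ?L False q. \<forall>u. u \<notin> ?L \<longrightarrow> c u = False"
        using set_Pi_pmf_subset[OF finite_level, of k m "Suc n" False q] by (auto simp: AE_measure_pmf_iff)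
      then show "AE c in Pi_pmf ?L False q. c \<in> {c. B \<union> {u \<in> ?L. c u} = C} \<longleftrightarrow>
          c \<in> (if B = C \<inter> words_upto k m n then {c0} else {})"
      proof eventually_elim
        case (elim c)
        have "B \<union> {u \<in> ?L. c u} = C \<longleftrightarrow> B = C \<inter> words_upto k m n \<and> {u \<in> ?L. c u} = C \<inter> ?L"
          using B C disj unfolding words_upto_Suc by blast
        also have "{u \<in> ?L. c u} = C \<inter> ?L \<longleftrightarrow> c = c0"
          using elim by (auto simp: c0_def fun_eq_iff)
        finally show ?case by auto
      qed
    qed auto
    also have "\<dots> = (if B = C \<inter> words_upto k m n then \<Prod>u\<in>?L. pmf (q u) (u \<in> C) else 0)"
    proof -
      have "measure_pmf.prob (Pi_pmf ?L False q) {c0} = (\<Prod>u\<in>?L. pmf (q u) (u \<in> C))"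
        unfolding measure_pmf_single by (subst pmf_Pi[OF finite_level]) (auto simp: c0_def intro!: prod.cong)
      then show ?thesis by auto
    qed
    finally show ?thesis .
  qed
  have "pmf (chosen_law (Suc n)) C = measure_pmf.expectation (chosen_law n)
      (\<lambda>B. pmf (map_pmf (\<lambda>c. B \<union> {u \<in> ?L. c u}) (Pi_pmf ?L False (\<lambda>u. child_law p (butlast u \<in> B)))) C)"
    by (simp add: pmf_bind)
  also have "\<dots> = measure_pmf.expectation (chosen_law n) (\<lambda>B. indicator {C \<inter> words_upto k m n} B *
      (\<Prod>u\<in>?L. pmf (child_law p (butlast u \<in> C \<inter> words_upto k m n)) (u \<in> C)))"
    by (intro integral_cong_AE)
      (auto simp: AE_measure_pmf_iff inner[OF PowD[OF subsetD[OF set_chosen_law]]])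
  also have "\<dots> = pmf (chosen_law n) (C \<inter> words_upto k m n) *
      (\<Prod>u\<in>?L. pmf (child_law p (butlast u \<in> C \<inter> words_upto k m n)) (u \<in> C))"
    by (simp add: measure_pmf_single)
  also have "(\<Prod>u\<in>?L. pmf (child_law p (butlast u \<in> C \<inter> words_upto k m n)) (u \<in> C)) =
      (\<Prod>(\<sigma>, j)\<in>level k m n \<times> alphabet k m. pmf (child_law p (\<sigma> \<in> C)) (\<sigma> @ [j] \<in> C))"
    unfolding level_Suc
  proof (subst prod.reindex)
    show "inj_on (\<lambda>(\<sigma>, j). \<sigma> @ [j]) (level k m n \<times> alphabet k m)" by (auto simp: inj_on_def)
  qed (use level_subset_words_upto[of n n k m] in \<open>auto intro!: prod.cong\<close>)
  finally show ?thesis by (simp add: prod.cartesian_product)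
qed

text \<open>The recursion for the atoms in the definition of the percolation law is the recursion for the mass
  function.\<close>

lemma prob_chosen:
  assumes C: "C \<subseteq> words_upto k m n"
  shows "prob {\<omega> \<in> space P. chosen k m n \<omega> = C} = pmf (chosen_law n) C"
  using C
proof (induction n arbitrary: C)
  case 0
  have "AE \<omega> in P. \<omega> []" using law by (simp add: percolation_law_def)
  moreover have "{\<omega> \<in> space P. chosen k m 0 \<omega> = C} \<in> events" by measurable
  ultimately have "prob {\<omega> \<in> space P. chosen k m 0 \<omega> = C} = prob (if C = {[]} then space P else {})"
    using 0 by (intro finite_measure_eq_AE) (auto simp: chosen_def words_upto_0)
  then show ?case using 0 by (auto simp: prob_space words_upto_0 pmf_return)
next
  case (Suc n)
  have ev: "{\<omega> \<in> space P. chosen k m n \<omega> = C \<inter> words_upto k m n} =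
    {\<omega> \<in> space P. \<forall>l \<le> n. \<forall>\<sigma> \<in> level k m l. \<omega> \<sigma> = (\<sigma> \<in> C)}" if "C \<subseteq> words_upto k m n'" "n \<le> n'" for n n' C
    using that by (auto simp: chosen_def words_upto_def level_def set_eq_iff)
  have "prob {\<omega> \<in> space P. chosen k m (Suc n) \<omega> = C} =
      prob {\<omega> \<in> space P. chosen k m (Suc n) \<omega> = C \<inter> words_upto k m (Suc n)}"
    using Suc.prems by (simp add: Int_absorb2)
  also have "\<dots> = prob {\<omega> \<in> space P. \<forall>l \<le> Suc n. \<forall>\<sigma> \<in> level k m l. \<omega> \<sigma> = (\<sigma> \<in> C)}"
    using ev[OF Suc.prems order_refl] by (rule arg_cong)
  also have "\<dots> = prob {\<omega> \<in> space P. \<forall>l \<le> n. \<forall>\<sigma> \<in> level k m l. \<omega> \<sigma> = (\<sigma> \<in> C)} *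
      (\<Prod>\<sigma>\<in>level k m n. \<Prod>j\<in>alphabet k m. pmf (child_law p (\<sigma> \<in> C)) (\<sigma> @ [j] \<in> C))"
    using law[unfolded percolation_law_def, THEN conjunct2, THEN conjunct2, THEN conjunct2,
        rule_format, of n "\<lambda>\<sigma>. \<sigma> \<in> C"] by simp
  also have "{\<omega> \<in> space P. \<forall>l \<le> n. \<forall>\<sigma> \<in> level k m l. \<omega> \<sigma> = (\<sigma> \<in> C)} = {\<omega> \<in> space P. chosen k m n \<omega> = C \<inter> words_upto k m n}"
    using ev[OF Suc.prems, of n] by simp
  also have "prob \<dots> = pmf (chosen_law n) (C \<inter> words_upto k m n)"
    by (rule Suc.IH) auto
  finally show ?case using pmf_chosen_law_Suc[OF Suc.prems] by simp
qed

lemma distr_chosen: "distr P (count_space UNIV) (chosen k m n) = measure_pmf (chosen_law n)"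
proof (rule measure_eqI_countable_AE)
  let ?W = "Pow (words_upto k m n)"
  show "AE x in distr P (count_space UNIV) (chosen k m n). x \<in> ?W"
    by (subst AE_distr_iff) (auto simp: chosen_def)
  show "AE x in measure_pmf (chosen_law n). x \<in> ?W"
    using set_chosen_law by (auto simp: AE_measure_pmf_iff)
  show "countable ?W" by (intro countable_finite) simp
  show "emeasure (distr P (count_space UNIV) (chosen k m n)) {C} = emeasure (measure_pmf (chosen_law n)) {C}"
    if "C \<in> ?W" for C
  proof -
    have "emeasure (distr P (count_space UNIV) (chosen k m n)) {C} = emeasure P {\<omega> \<in> space P. chosen k m n \<omega> = C}"
      by (subst emeasure_distr) (auto intro!: arg_cong[where f = "emeasure P"])
    also have "\<dots> = ennreal (pmf (chosen_law n) C)"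
      using that prob_chosen[of C n] by (simp add: emeasure_eq_measure)
    finally show ?thesis by (simp add: emeasure_pmf_single)
  qed
qed simp_all

lemma expectation_chosen:
  fixes f :: "nat list set \<Rightarrow> real"
  shows "expectation (\<lambda>\<omega>. f (chosen k m n \<omega>)) = measure_pmf.expectation (chosen_law n) f"
  by (subst distr_chosen[symmetric]) (simp add: integral_distr)

lemma integrable_chosen:
  fixes f :: "nat list set \<Rightarrow> real"
  shows "integrable P (\<lambda>\<omega>. f (chosen k m n \<omega>))"
proof -
  have "integrable (distr P (count_space UNIV) (chosen k m n)) f"
    unfolding distr_chosen by (intro integrable_measure_pmf_finite) simp
  then show ?thesis by (subst (asm) integrable_distr_eq) auto
qed

lemma children_in_generation:
  assumes B: "B \<subseteq> words_upto k m n" and \<sigma>: "length \<sigma> \<le> n"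
  shows "generation (B \<union> {u \<in> level k m (Suc n). c u}) \<sigma> (Suc n) = {u \<in> level k m (Suc n). prefix \<sigma> u \<and> c u}"
  using B by (auto simp: generation_def words_upto_def level_def)

lemma sum_children_generation:
  assumes B: "B \<subseteq> words_upto k m n" and \<sigma>: "length \<sigma> \<le> n"
  shows "(\<Sum>u\<in>{u \<in> level k m (Suc n). prefix \<sigma> u}. if butlast u \<in> B then r else 0) =
    real (k ^ m) * r * real (card (generation B \<sigma> n))"
proof -
  have "{u \<in> level k m (Suc n). prefix \<sigma> u \<and> butlast u \<in> B} = (\<lambda>(\<tau>, j). \<tau> @ [j]) ` (generation B \<sigma> n \<times> alphabet k m)"
  proof (intro set_eqI iffI)
    fix u assume "u \<in> {u \<in> level k m (Suc n). prefix \<sigma> u \<and> butlast u \<in> B}"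
    then obtain \<tau> j where "u = \<tau> @ [j]" "\<tau> \<in> level k m n" "j \<in> alphabet k m" "prefix \<sigma> u" "\<tau> \<in> B"
      by (auto simp: level_Suc)
    moreover from this have "prefix \<sigma> \<tau>"
      using \<sigma> by (auto simp: level_def)
    ultimately show "u \<in> (\<lambda>(\<tau>, j). \<tau> @ [j]) ` (generation B \<sigma> n \<times> alphabet k m)"
      by (auto simp: generation_def level_def)
  next
    fix u assume "u \<in> (\<lambda>(\<tau>, j). \<tau> @ [j]) ` (generation B \<sigma> n \<times> alphabet k m)"
    then obtain \<tau> j where u: "u = \<tau> @ [j]" "\<tau> \<in> B" "length \<tau> = n" "prefix \<sigma> \<tau>" "j \<in> alphabet k m"
      by (auto simp: generation_def)
    then show "u \<in> {u \<in> level k m (Suc n). prefix \<sigma> u \<and> butlast u \<in> B}"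
      using B by (auto simp: level_def words_upto_def)
  qed
  then have "card {u \<in> level k m (Suc n). prefix \<sigma> u \<and> butlast u \<in> B} = card (generation B \<sigma> n) * k ^ m"
    by (subst \<open>_ = _\<close>, subst card_image) (auto simp: inj_on_def card_cartesian_product alphabet_def)
  moreover have "(\<Sum>u\<in>{u \<in> level k m (Suc n). prefix \<sigma> u}. if butlast u \<in> B then r else 0) =
      (\<Sum>u\<in>{u \<in> level k m (Suc n). prefix \<sigma> u \<and> butlast u \<in> B}. r)"
    using finite_level by (subst sum.inter_filter[symmetric]) (auto intro!: sum.cong simp: conj_assoc)
  ultimately show ?thesis by simp
qed

lemma expectation_chosen_law_Suc:
  fixes f :: "nat list set \<Rightarrow> real"
  shows "measure_pmf.expectation (chosen_law (Suc n)) f =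
    measure_pmf.expectation (chosen_law n) (\<lambda>B. measure_pmf.expectation
      (Pi_pmf (level k m (Suc n)) False (\<lambda>u. child_law p (butlast u \<in> B)))
      (\<lambda>c. f (B \<union> {u \<in> level k m (Suc n). c u})))"
proof -
  show ?thesis
    by (simp only: chosen_law.simps, subst pmf_expectation_bind[of "set_pmf (chosen_law n)"],
      auto simp: finite_set_Pi_pmf_bool[OF finite_level] integral_measure_pmf[of "set_pmf (chosen_law n)"])
qed

lemma pmf_child_law_True: "pmf (child_law p b) True = (if b then p else 0)"
  using p p_pos by (simp add: child_law_def)

text \<open>Each chosen word has on average \<open>k ^ m * p\<close> chosen children.  The factor \<open>g\<close> is a weight determined by
  the earlier generations, so the identity expresses a conditional expectation.\<close>

lemma expectation_next_generation:
  assumes \<sigma>: "length \<sigma> \<le> n" and g: "\<And>C. g (C \<inter> words_upto k m n) = g C"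
  shows "expectation (\<lambda>\<omega>. g (chosen k m (Suc n) \<omega>) * real (card (generation (chosen k m (Suc n) \<omega>) \<sigma> (Suc n)))) =
    growth * expectation (\<lambda>\<omega>. g (chosen k m n \<omega>) * real (card (generation (chosen k m n \<omega>) \<sigma> n)))"
proof -
  let ?L = "level k m (Suc n)" and ?U = "{u \<in> level k m (Suc n). prefix \<sigma> u}"
  let ?Q = "\<lambda>B. Pi_pmf ?L False (\<lambda>u. child_law p (butlast u \<in> B))"
  have in1: "measure_pmf.expectation (?Q B) (\<lambda>c. g (B \<union> {u \<in> ?L. c u}) * real (card (generation (B \<union> {u \<in> ?L. c u}) \<sigma> (Suc n))))
      = growth * (g B * real (card (generation B \<sigma> n)))" if B: "B \<subseteq> words_upto k m n" for B
  proof -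
    have gB: "g (B \<union> {u \<in> ?L. c u}) = g B" for c
    proof -
      have "(B \<union> {u \<in> ?L. c u}) \<inter> words_upto k m n = B" using B by (auto simp: level_def words_upto_def)
      then show ?thesis using g by metis
    qed
    have "real (card (generation (B \<union> {u \<in> ?L. c u}) \<sigma> (Suc n))) = (\<Sum>u\<in>?U. of_bool (c u))" for c
      unfolding children_in_generation[OF B \<sigma>] using finite_level
      by (simp add: of_bool_def sum.inter_filter[symmetric] conj_assoc)
    then have "measure_pmf.expectation (?Q B) (\<lambda>c. g (B \<union> {u \<in> ?L. c u}) * real (card (generation (B \<union> {u \<in> ?L. c u}) \<sigma> (Suc n))))
      = g B * (\<Sum>u\<in>?U. measure_pmf.expectation (?Q B) (\<lambda>c. of_bool (c u)))"
      by (simp add: gB Bochner_Integration.integral_sum integrable_Pi_pmf_bool[OF finite_level])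
    also have "(\<Sum>u\<in>?U. measure_pmf.expectation (?Q B) (\<lambda>c. of_bool (c u))) = (\<Sum>u\<in>?U. if butlast u \<in> B then p else 0)"
      by (intro sum.cong refl) (simp add: Pi_pmf_bool_mean[OF finite_level] pmf_child_law_True)
    also have "\<dots> = growth * real (card (generation B \<sigma> n))"
      by (subst sum_children_generation[OF B \<sigma>]) (simp add: growth_def)
    finally show ?thesis by simp
  qed
  show ?thesis
    unfolding expectation_chosen[of "\<lambda>C. g C * real (card (generation C \<sigma> n))" for n] expectation_chosen_law_Suc
    by (subst Bochner_Integration.integral_mult_right_zero[symmetric])
      (intro integral_cong_AE, auto simp: AE_measure_pmf_iff intro!: in1 dest: subsetD[OF set_chosen_law])
qed

text \<open>Given generation \<open>n\<close>, the number of descendants in the next generation is a sum of independent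
  states, whose conditional variance is at most the conditional mean.\<close>

lemma second_moment_next_generation:
  assumes \<sigma>: "length \<sigma> \<le> n"
  shows "expectation (\<lambda>\<omega>. (real (card (generation (chosen k m (Suc n) \<omega>) \<sigma> (Suc n)))
      - growth * real (card (generation (chosen k m n \<omega>) \<sigma> n)))\<^sup>2) \<le>
    growth * expectation (\<lambda>\<omega>. real (card (generation (chosen k m n \<omega>) \<sigma> n)))"
proof -
  let ?L = "level k m (Suc n)" and ?U = "{u \<in> level k m (Suc n). prefix \<sigma> u}"
  let ?Q = "\<lambda>B. Pi_pmf ?L False (\<lambda>u. child_law p (butlast u \<in> B))"
  define f where "f C = (real (card (generation C \<sigma> (Suc n)))
      - growth * real (card (generation (C \<inter> words_upto k m n) \<sigma> n)))\<^sup>2" for C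
  have in1: "measure_pmf.expectation (?Q B) (\<lambda>c. f (B \<union> {u \<in> ?L. c u})) \<le> growth * real (card (generation B \<sigma> n))"
    if B: "B \<subseteq> words_upto k m n" for B
  proof -
    have fB: "f (B \<union> {u \<in> ?L. c u}) = (\<Sum>u\<in>?U. of_bool (c u) - pmf (child_law p (butlast u \<in> B)) True)\<^sup>2" for c
    proof -
      have "(B \<union> {u \<in> ?L. c u}) \<inter> words_upto k m n = B" using B by (auto simp: level_def words_upto_def)
      moreover have "real (card (generation (B \<union> {u \<in> ?L. c u}) \<sigma> (Suc n))) = (\<Sum>u\<in>?U. of_bool (c u))"
        unfolding children_in_generation[OF B \<sigma>] using finite_level
        by (simp add: of_bool_def sum.inter_filter[symmetric] conj_assoc)
      moreover have "growth * real (card (generation B \<sigma> n)) = (\<Sum>u\<in>?U. pmf (child_law p (butlast u \<in> B)) True)"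
        unfolding pmf_child_law_True by (subst sum_children_generation[OF B \<sigma>]) (simp add: growth_def)
      ultimately show ?thesis by (simp add: f_def sum_subtractf)
    qed
    have "measure_pmf.expectation (?Q B) (\<lambda>c. f (B \<union> {u \<in> ?L. c u})) =
      (\<Sum>u\<in>?U. pmf (child_law p (butlast u \<in> B)) True * (1 - pmf (child_law p (butlast u \<in> B)) True))"
      unfolding fB by (rule Pi_pmf_bool_variance[OF finite_level]) auto
    also have "\<dots> \<le> (\<Sum>u\<in>?U. if butlast u \<in> B then p else 0)"
      using p p_pos by (intro sum_mono) (auto simp: pmf_child_law_True mult_left_le)
    also have "\<dots> = growth * real (card (generation B \<sigma> n))"
      by (subst sum_children_generation[OF B \<sigma>]) (simp add: growth_def)
    finally show ?thesis .
  qed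
  have "expectation (\<lambda>\<omega>. (real (card (generation (chosen k m (Suc n) \<omega>) \<sigma> (Suc n)))
      - growth * real (card (generation (chosen k m n \<omega>) \<sigma> n)))\<^sup>2) = expectation (\<lambda>\<omega>. f (chosen k m (Suc n) \<omega>))"
    unfolding f_def by (simp add: chosen_mono[of n "Suc n", symmetric])
  also have "\<dots> \<le> measure_pmf.expectation (chosen_law n) (\<lambda>B. growth * real (card (generation B \<sigma> n)))"
    unfolding expectation_chosen expectation_chosen_law_Suc
    by (intro integral_mono_AE integrable_measure_pmf_finite)
      (auto simp: AE_measure_pmf_iff intro!: in1 dest: subsetD[OF set_chosen_law])
  finally show ?thesis
    unfolding expectation_chosen[of "\<lambda>B. real (card (generation B \<sigma> n))"] by simp
qed

section \<open>The martingale limits\<close>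

text \<open>The martingale of normalised descendant numbers of \<open>\<sigma>\<close>.\<close>

definition W :: "nat list \<Rightarrow> nat \<Rightarrow> (nat list \<Rightarrow> bool) \<Rightarrow> real" where
  "W \<sigma> j \<omega> = real (descendants k m \<omega> j \<sigma>) / growth ^ j"

lemma W_generation: "W \<sigma> j \<omega> = real (card (generation (chosen k m (length \<sigma> + j) \<omega>) \<sigma> (length \<sigma> + j))) / growth ^ j"
  by (simp add: W_def descendants_generation)

lemma martingale_limit_W: "martingale_limit k m p \<omega> \<sigma> = lim (\<lambda>j. W \<sigma> j \<omega>)"
  by (simp add: martingale_limit_def k_powr W_def)

lemma integrable_chosen_mult:
  fixes f g :: "nat list set \<Rightarrow> real"
  shows "integrable P (\<lambda>\<omega>. f (chosen k m n \<omega>) * g (chosen k m n' \<omega>))"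
proof -
  define N where "N = max n n'"
  have "integrable P (\<lambda>\<omega>. (\<lambda>C. f (C \<inter> words_upto k m n) * g (C \<inter> words_upto k m n')) (chosen k m N \<omega>))"
    by (rule integrable_chosen)
  moreover have "n \<le> N" "n' \<le> N" by (simp_all add: N_def)
  ultimately show ?thesis by (simp add: chosen_mono[of n N, symmetric] chosen_mono[of n' N, symmetric])
qed

lemma integrable_W: "integrable P (W \<sigma> j)"
  unfolding W_generation[abs_def] by (rule integrable_chosen)

lemma borel_measurable_W [measurable]: "W \<sigma> j \<in> borel_measurable P"
  using integrable_W by (rule borel_measurable_integrable)

lemma expectation_W:
  assumes g: "\<And>C. g (C \<inter> words_upto k m (length \<sigma>)) = g C"
  shows "expectation (\<lambda>\<omega>. g (chosen k m (length \<sigma>) \<omega>) * W \<sigma> j \<omega>) = expectation (\<lambda>\<omega>. g (chosen k m (length \<sigma>) \<omega>) * W \<sigma> 0 \<omega>)"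
proof (induction j)
  case (Suc j)
  let ?n = "length \<sigma> + j"
  have g': "g (C \<inter> words_upto k m ?n) = g C" for C
  proof -
    have "C \<inter> words_upto k m ?n \<inter> words_upto k m (length \<sigma>) = C \<inter> words_upto k m (length \<sigma>)"
      by (auto simp: words_upto_def)
    then show ?thesis using g by metis
  qed
  have gc: "g (chosen k m n \<omega>) = g (chosen k m (length \<sigma>) \<omega>)" if "length \<sigma> \<le> n" for n \<omega>
    using g chosen_mono[OF that, of k m \<omega>] by metis
  have "expectation (\<lambda>\<omega>. g (chosen k m (length \<sigma>) \<omega>) * W \<sigma> (Suc j) \<omega>) =
    expectation (\<lambda>\<omega>. g (chosen k m (Suc ?n) \<omega>) * real (card (generation (chosen k m (Suc ?n) \<omega>) \<sigma> (Suc ?n)))) / growth ^ Suc j"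
    using gc[of "Suc ?n"] by (simp add: W_generation)
  also have "\<dots> = growth * expectation (\<lambda>\<omega>. g (chosen k m ?n \<omega>) * real (card (generation (chosen k m ?n \<omega>) \<sigma> ?n))) / growth ^ Suc j"
    using expectation_next_generation[where g = g and n = ?n and \<sigma> = \<sigma>, OF _ g'] by simp
  also have "\<dots> = expectation (\<lambda>\<omega>. g (chosen k m (length \<sigma>) \<omega>) * W \<sigma> j \<omega>)"
    using growth_gt_1 gc[of ?n] by (simp add: W_generation)
  finally show ?case using Suc by simp
qed simp

lemma W_0: "\<sigma> \<in> fin_words k m \<Longrightarrow> W \<sigma> 0 \<omega> = of_bool (\<omega> \<sigma>)"
proof -
  assume \<sigma>: "\<sigma> \<in> fin_words k m"
  have "generation (chosen k m (length \<sigma>) \<omega>) \<sigma> (length \<sigma>) = (if \<omega> \<sigma> then {\<sigma>} else {})"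
    using \<sigma> by (auto simp: generation_def chosen_def words_upto_def prefix_def)
  then show "W \<sigma> 0 \<omega> = of_bool (\<omega> \<sigma>)" by (simp add: W_generation)
qed

text \<open>Passing to generation \<open>j + 1\<close> adds a variance of at most \<open>growth ^ (j + 1)\<close> to the descendant number,
  whereas the normalisation contributes \<open>growth ^ (- 2 * j - 2)\<close>.\<close>

lemma second_moment_W_increment:
  assumes \<sigma>: "\<sigma> \<in> fin_words k m"
  shows "expectation (\<lambda>\<omega>. (W \<sigma> (Suc j) \<omega> - W \<sigma> j \<omega>)\<^sup>2) \<le> (1 / growth) ^ Suc j"
proof -
  let ?n = "length \<sigma> + j"
  let ?Z = "\<lambda>n \<omega>. real (card (generation (chosen k m n \<omega>) \<sigma> n))"
  have g0: "growth \<noteq> 0" using growth_gt_1 by simp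
  have EZ: "expectation (?Z ?n) \<le> growth ^ j"
  proof -
    have "expectation (\<lambda>\<omega>. W \<sigma> j \<omega>) = expectation (\<lambda>\<omega>. W \<sigma> 0 \<omega>)"
      using expectation_W[of "\<lambda>_. 1" \<sigma> j] by simp
    also have "\<dots> \<le> 1"
      using \<sigma> by (intro integral_le_const integrable_W) (auto simp: W_0)
    finally show ?thesis using growth_gt_1 by (simp add: W_generation divide_le_eq)
  qed
  have "W \<sigma> (Suc j) \<omega> - W \<sigma> j \<omega> = (?Z (Suc ?n) \<omega> - growth * ?Z ?n \<omega>) / growth ^ Suc j" for \<omega>
    using g0 by (simp add: W_generation diff_divide_distrib)
  then have "expectation (\<lambda>\<omega>. (W \<sigma> (Suc j) \<omega> - W \<sigma> j \<omega>)\<^sup>2) =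
    expectation (\<lambda>\<omega>. (?Z (Suc ?n) \<omega> - growth * ?Z ?n \<omega>)\<^sup>2) / (growth ^ Suc j)\<^sup>2"
    by (simp only: power_divide integral_divide_zero)
  also have "\<dots> \<le> growth * expectation (?Z ?n) / (growth ^ Suc j)\<^sup>2"
    by (intro divide_right_mono second_moment_next_generation) auto
  also have "\<dots> \<le> growth * growth ^ j / (growth ^ Suc j)\<^sup>2"
    using growth_gt_1 by (intro divide_right_mono mult_left_mono EZ) auto
  also have "\<dots> = (1 / growth) ^ Suc j"
    using g0 by (simp add: power2_eq_square power_one_over)
  finally show ?thesis .
qed

lemma expectation_W_increment:
  assumes \<sigma>: "\<sigma> \<in> fin_words k m"
  shows "expectation (\<lambda>\<omega>. \<bar>W \<sigma> (Suc j) \<omega> - W \<sigma> j \<omega>\<bar>) \<le> sqrt (1 / growth) ^ Suc j"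
proof -
  define r where "r = sqrt (1 / growth) ^ Suc j"
  have r: "r > 0" "r * r = (1 / growth) ^ Suc j"
    using growth_gt_1 by (auto simp: r_def power_mult_distrib[symmetric] simp del: power_Suc)
  let ?d = "\<lambda>\<omega>. W \<sigma> (Suc j) \<omega> - W \<sigma> j \<omega>"
  have int2: "integrable P (\<lambda>\<omega>. (?d \<omega>)\<^sup>2)"
  proof -
    let ?n = "length \<sigma> + j"
    have "integrable P (\<lambda>\<omega>. (\<lambda>C. (real (card (generation C \<sigma> (Suc ?n))) / growth ^ Suc j -
        real (card (generation (C \<inter> words_upto k m ?n) \<sigma> ?n)) / growth ^ j)\<^sup>2) (chosen k m (Suc ?n) \<omega>))"
      by (rule integrable_chosen)
    then show ?thesis by (simp add: chosen_mono[of ?n "Suc ?n", symmetric] W_generation)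
  qed
  \<comment> \<open>The geometric mean \<open>r\<close> is the bound that the Cauchy-Schwarz inequality would give.\<close>
  have amgm: "\<bar>d\<bar> \<le> (d\<^sup>2 / r + r) / 2" for d :: real
  proof -
    have "0 \<le> (\<bar>d\<bar> - r)\<^sup>2" by simp
    then have "2 * (\<bar>d\<bar> * r) \<le> d\<^sup>2 + r * r" by (simp add: power2_diff power2_eq_square[of r])
    then have "2 * \<bar>d\<bar> \<le> (d\<^sup>2 + r * r) / r" using r by (simp add: le_divide_eq)
    then show ?thesis using r(1) by (simp add: add_divide_distrib)
  qed
  have "expectation (\<lambda>\<omega>. \<bar>?d \<omega>\<bar>) \<le> expectation (\<lambda>\<omega>. ((?d \<omega>)\<^sup>2 / r + r) / 2)"
    by (intro integral_mono amgm integrable_divide_zero Bochner_Integration.integrable_add int2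
        integrable_const integrable_abs Bochner_Integration.integrable_diff integrable_W)
  also have "\<dots> = (expectation (\<lambda>\<omega>. (?d \<omega>)\<^sup>2) / r + r) / 2"
    using int2 by (simp add: prob_space)
  also have "\<dots> \<le> ((r * r) / r + r) / 2"
    unfolding r(2) using r(1) by (intro divide_right_mono add_right_mono second_moment_W_increment \<sigma>) auto
  also have "\<dots> = r" using r(1) by simp
  finally show ?thesis by (simp add: r_def)
qed

lemma summable_rate: "summable (\<lambda>j. sqrt (1 / growth) ^ Suc j)"
  using growth_gt_1 by (subst summable_Suc_iff) (intro summable_geometric, simp add: real_sqrt_divide)

lemma AE_summable_W_increments:
  assumes \<sigma>: "\<sigma> \<in> fin_words k m"
  shows "AE \<omega> in P. summable (\<lambda>j. \<bar>W \<sigma> (Suc j) \<omega> - W \<sigma> j \<omega>\<bar>)"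
proof (rule AE_summable_of_integrals[OF _ _ _ _ summable_rate])
  fix j
  have "(\<integral>\<^sup>+\<omega>. \<bar>W \<sigma> (Suc j) \<omega> - W \<sigma> j \<omega>\<bar> \<partial>P) = ennreal (expectation (\<lambda>\<omega>. \<bar>W \<sigma> (Suc j) \<omega> - W \<sigma> j \<omega>\<bar>))"
    by (intro nn_integral_eq_integral) (auto intro!: integrable_W)
  then show "(\<integral>\<^sup>+\<omega>. \<bar>W \<sigma> (Suc j) \<omega> - W \<sigma> j \<omega>\<bar> \<partial>P) \<le> ennreal (sqrt (1 / growth) ^ Suc j)"
    using expectation_W_increment[OF \<sigma>] by (auto intro: ennreal_leI)
qed (use growth_gt_1 in auto)

lemma summable_increments_limit:
  fixes a :: "nat \<Rightarrow> real"
  assumes "summable (\<lambda>j. a (Suc j) - a j)"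
  shows "a \<longlonglongrightarrow> a 0 + (\<Sum>j. a (Suc j) - a j)"
proof -
  have "(\<lambda>n. a 0 + (\<Sum>j<n. a (Suc j) - a j)) \<longlonglongrightarrow> a 0 + (\<Sum>j. a (Suc j) - a j)"
    by (intro tendsto_add tendsto_const summable_LIMSEQ assms)
  then show ?thesis by (simp add: sum_lessThan_telescope)
qed

lemma AE_convergent_W: "AE \<omega> in P. \<forall>\<sigma>\<in>fin_words k m. convergent (\<lambda>j. W \<sigma> j \<omega>)"
proof (subst AE_ball_countable)
  show "countable (fin_words k m)"
    by (intro countable_lists countable_finite) (simp add: alphabet_def)
  show "\<forall>\<sigma>\<in>fin_words k m. AE \<omega> in P. convergent (\<lambda>j. W \<sigma> j \<omega>)"
  proof
    fix \<sigma> assume "\<sigma> \<in> fin_words k m"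
    from AE_summable_W_increments[OF this] show "AE \<omega> in P. convergent (\<lambda>j. W \<sigma> j \<omega>)"
      by eventually_elim (auto simp: convergent_def dest!: summable_rabs_cancel intro: summable_increments_limit)
  qed
qed

lemma borel_measurable_martingale_limit [measurable]:
  "(\<lambda>\<omega>. martingale_limit k m p \<omega> \<sigma>) \<in> borel_measurable P"
  unfolding martingale_limit_W by measurable

text \<open>The increments of the martingale are absolutely summable in mean and have expectation zero on every
  event of generation \<open>n\<close>, so the limit inherits the expectation of the initial term.\<close>

lemma expectation_martingale_limit:
  assumes \<sigma>: "\<sigma> \<in> fin_words k m" and n: "length \<sigma> = n" and C: "C \<subseteq> words_upto k m n"
  shows "integrable P (\<lambda>\<omega>. indicator {\<omega>. chosen k m n \<omega> = C} \<omega> * martingale_limit k m p \<omega> \<sigma>)"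
    "expectation (\<lambda>\<omega>. indicator {\<omega>. chosen k m n \<omega> = C} \<omega> * martingale_limit k m p \<omega> \<sigma>) =
      of_bool (\<sigma> \<in> C) * pmf (chosen_law n) C"
proof -
  define g :: "nat list set \<Rightarrow> real" where "g D = of_bool (D \<inter> words_upto k m n = C)" for D
  have gind: "indicator {\<omega>. chosen k m n \<omega> = C} \<omega> = g (chosen k m n \<omega>)" for \<omega>
    by (auto simp: g_def chosen_mono[of n n k m, symmetric] indicator_def)
  have gg: "g (D \<inter> words_upto k m n) = g D" for D by (simp add: g_def)
  let ?d = "\<lambda>j \<omega>. g (chosen k m n \<omega>) * (W \<sigma> (Suc j) \<omega> - W \<sigma> j \<omega>)"
  have intW: "integrable P (\<lambda>\<omega>. g (chosen k m n \<omega>) * W \<sigma> j \<omega>)" for j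
    unfolding W_generation by (rule integrable_chosen_mult)
  have int: "integrable P (?d j)" for j
    unfolding right_diff_distrib by (intro Bochner_Integration.integrable_diff intW)
  have E0: "expectation (?d j) = 0" for j
  proof -
    have "expectation (\<lambda>\<omega>. g (chosen k m n \<omega>) * W \<sigma> i \<omega>) = expectation (\<lambda>\<omega>. g (chosen k m n \<omega>) * W \<sigma> 0 \<omega>)" for i
      using expectation_W[of g \<sigma> i] gg n by simp
    from this[of j] this[of "Suc j"] show ?thesis
      unfolding right_diff_distrib by (subst Bochner_Integration.integral_diff[OF intW intW]) simp
  qed
  have s1: "AE \<omega> in P. summable (\<lambda>j. norm (?d j \<omega>))"
    using AE_summable_W_increments[OF \<sigma>]
    by eventually_elim (auto simp: abs_mult intro: summable_mult)
  have s2: "summable (\<lambda>j. expectation (\<lambda>\<omega>. norm (?d j \<omega>)))"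
  proof (rule summable_comparison_test[OF _ summable_rate], intro exI allI impI)
    fix j
    have "norm (expectation (\<lambda>\<omega>. norm (?d j \<omega>))) = expectation (\<lambda>\<omega>. norm (?d j \<omega>))"
      by (simp add: integral_nonneg_AE)
    also have "\<dots> \<le> expectation (\<lambda>\<omega>. \<bar>W \<sigma> (Suc j) \<omega> - W \<sigma> j \<omega>\<bar>)"
      by (intro integral_mono integrable_norm int) (auto simp: g_def intro!: integrable_W)
    also have "\<dots> \<le> sqrt (1 / growth) ^ Suc j" by (rule expectation_W_increment[OF \<sigma>])
    finally show "norm (expectation (\<lambda>\<omega>. norm (?d j \<omega>))) \<le> sqrt (1 / growth) ^ Suc j" .
  qed
  have intS: "integrable P (\<lambda>\<omega>. \<Sum>j. ?d j \<omega>)"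
    by (rule integrable_suminf[OF int s1 s2])
  have ES: "expectation (\<lambda>\<omega>. \<Sum>j. ?d j \<omega>) = 0"
    using integral_suminf[OF int s1 s2] by (simp only: E0 suminf_zero)
  have eq: "AE \<omega> in P. g (chosen k m n \<omega>) * martingale_limit k m p \<omega> \<sigma> =
      g (chosen k m n \<omega>) * W \<sigma> 0 \<omega> + (\<Sum>j. ?d j \<omega>)"
    using AE_summable_W_increments[OF \<sigma>]
  proof eventually_elim
    case (elim \<omega>)
    then have s: "summable (\<lambda>j. W \<sigma> (Suc j) \<omega> - W \<sigma> j \<omega>)" by (rule summable_rabs_cancel)
    show ?case
      unfolding martingale_limit_W limI[OF summable_increments_limit[OF s]]
      by (simp only: distrib_left suminf_mult[OF s])
  qed
  have meas: "(\<lambda>\<omega>. g (chosen k m n \<omega>)) \<in> borel_measurable P"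
    by (rule measurable_compose[OF measurable_chosen]) simp
  show "integrable P (\<lambda>\<omega>. indicator {\<omega>. chosen k m n \<omega> = C} \<omega> * martingale_limit k m p \<omega> \<sigma>)"
    unfolding gind
    by (rule integrable_cong_AE_imp[OF Bochner_Integration.integrable_add[OF intW[of 0] intS]])
      (use eq meas in auto)
  have "expectation (\<lambda>\<omega>. g (chosen k m n \<omega>) * martingale_limit k m p \<omega> \<sigma>) =
    expectation (\<lambda>\<omega>. g (chosen k m n \<omega>) * W \<sigma> 0 \<omega> + (\<Sum>j. ?d j \<omega>))"
    using eq meas borel_measurable_integrable[OF intS] by (intro integral_cong_AE) auto
  also have "\<dots> = expectation (\<lambda>\<omega>. g (chosen k m n \<omega>) * W \<sigma> 0 \<omega>)"
    by (subst Bochner_Integration.integral_add[OF intW intS]) (simp only: ES add_0_right)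
  also have "\<dots> = expectation (\<lambda>\<omega>. of_bool (\<sigma> \<in> C) * indicator {\<omega> \<in> space P. chosen k m n \<omega> = C} \<omega>)"
  proof (rule Bochner_Integration.integral_cong[OF refl])
    fix \<omega> assume "\<omega> \<in> space P"
    then have "g (chosen k m n \<omega>) = indicator {\<omega> \<in> space P. chosen k m n \<omega> = C} \<omega>"
      unfolding gind[symmetric] by (simp add: indicator_def)
    moreover have "\<omega> \<sigma> \<longleftrightarrow> \<sigma> \<in> chosen k m n \<omega>"
      using \<sigma> n by (simp add: chosen_def words_upto_def)
    ultimately show "g (chosen k m n \<omega>) * W \<sigma> 0 \<omega> = of_bool (\<sigma> \<in> C) * indicator {\<omega> \<in> space P. chosen k m n \<omega> = C} \<omega>"
      using \<sigma> by (simp add: W_0 indicator_def)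
  qed
  also have "\<dots> = of_bool (\<sigma> \<in> C) * pmf (chosen_law n) C"
    using prob_chosen[OF C] by (simp add: Int_absorb2 subset_eq)
  finally show "expectation (\<lambda>\<omega>. indicator {\<omega>. chosen k m n \<omega> = C} \<omega> * martingale_limit k m p \<omega> \<sigma>) =
      of_bool (\<sigma> \<in> C) * pmf (chosen_law n) C"
    unfolding gind .
qed

text \<open>A descendant of \<open>\<sigma>\<close> passes through exactly one child of \<open>\<sigma>\<close>.\<close>

lemma W_Suc:
  assumes \<sigma>: "\<sigma> \<in> fin_words k m"
  shows "W \<sigma> (Suc j) \<omega> = (\<Sum>l\<in>alphabet k m. W (\<sigma> @ [l]) j \<omega>) / growth"
proof -
  let ?D = "\<lambda>\<sigma> j. {\<tau> \<in> fin_words k m. length \<tau> = length \<sigma> + j \<and> prefix \<sigma> \<tau> \<and> \<omega> \<tau>}"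
  have "?D \<sigma> (Suc j) = (\<Union>l\<in>alphabet k m. ?D (\<sigma> @ [l]) j)"
  proof (intro set_eqI iffI)
    fix \<tau> assume t: "\<tau> \<in> ?D \<sigma> (Suc j)"
    then obtain \<rho> where \<rho>: "\<tau> = \<sigma> @ \<rho>" by (auto simp: prefix_def)
    with t obtain l \<rho>' where "\<rho> = l # \<rho>'" by (cases \<rho>) auto
    with t \<rho> show "\<tau> \<in> (\<Union>l\<in>alphabet k m. ?D (\<sigma> @ [l]) j)" by auto
  qed (auto dest: append_prefixD)
  then have "card (?D \<sigma> (Suc j)) = (\<Sum>l\<in>alphabet k m. card (?D (\<sigma> @ [l]) j))"
  proof (subst \<open>?D \<sigma> (Suc j) = _\<close>, intro card_UN_disjoint ballI impI)
    show "finite (alphabet k m)" by (simp add: alphabet_def)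
    show "finite (?D (\<sigma> @ [l]) j)" for l
      by (rule finite_subset[OF _ finite_level[of k m "length (\<sigma> @ [l]) + j"]]) (auto simp: level_def)
    show "?D (\<sigma> @ [l]) j \<inter> ?D (\<sigma> @ [l']) j = {}" if "l \<noteq> l'" for l l'
      using that by (auto simp: prefix_def)
  qed
  then have "descendants k m \<omega> (Suc j) \<sigma> = (\<Sum>l\<in>alphabet k m. descendants k m \<omega> j (\<sigma> @ [l]))"
    by (simp add: descendants_def)
  then show ?thesis
    by (simp add: W_def sum_divide_distrib mult.commute)
qed

definition limits_exist :: "(nat list \<Rightarrow> bool) \<Rightarrow> bool" where
  "limits_exist \<omega> \<longleftrightarrow> (\<forall>\<sigma>\<in>fin_words k m. convergent (\<lambda>j. W \<sigma> j \<omega>))"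

text \<open>Off the event of convergence all weights are zero, so that the weights are consistent for every
  realisation.\<close>

definition weight :: "(nat list \<Rightarrow> bool) \<Rightarrow> nat list \<Rightarrow> real" where
  "weight \<omega> \<sigma> = (if limits_exist \<omega> then martingale_limit k m p \<omega> \<sigma> / growth ^ length \<sigma> else 0)"

lemma measurable_limits_exist [measurable]: "Measurable.pred P limits_exist"
proof -
  have "Measurable.pred P (\<lambda>\<omega>. \<forall>\<sigma>\<in>fin_words k m. convergent (\<lambda>j. W \<sigma> j \<omega>))"
  proof (rule pred_intros_countable_bounded(3))
    fix \<sigma> assume "\<sigma> \<in> fin_words k m"
    show "Measurable.pred P (\<lambda>\<omega>. convergent (\<lambda>j. W \<sigma> j \<omega>))"
      unfolding Cauchy_convergent_iff[symmetric] pred_def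
      by (rule sets_Collect_Cauchy) (rule borel_measurable_W)
  qed
  then show ?thesis by (simp add: limits_exist_def[abs_def])
qed

lemma borel_measurable_weight [measurable]: "(\<lambda>\<omega>. weight \<omega> \<sigma>) \<in> borel_measurable P"
  unfolding weight_def by measurable

lemma consistent_weight: "consistent_weights k m (weight \<omega>)"
proof (cases "limits_exist \<omega>")
  case True
  show ?thesis
    unfolding consistent_weights_def
  proof
    fix \<sigma> assume \<sigma>: "\<sigma> \<in> fin_words k m"
    have lim: "(\<lambda>j. W \<tau> j \<omega>) \<longlonglongrightarrow> martingale_limit k m p \<omega> \<tau>" if "\<tau> \<in> fin_words k m" for \<tau>
      using True that by (simp add: limits_exist_def martingale_limit_W convergent_LIMSEQ_iff)
    have "martingale_limit k m p \<omega> \<sigma> \<ge> 0"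
      using growth_gt_1 by (intro LIMSEQ_le_const[OF lim[OF \<sigma>]]) (auto simp: W_def)
    moreover have "martingale_limit k m p \<omega> \<sigma> = (\<Sum>l\<in>alphabet k m. martingale_limit k m p \<omega> (\<sigma> @ [l])) / growth"
    proof (rule LIMSEQ_unique)
      show "(\<lambda>j. W \<sigma> (Suc j) \<omega>) \<longlonglongrightarrow> martingale_limit k m p \<omega> \<sigma>"
        using lim[OF \<sigma>] by (rule LIMSEQ_Suc)
      show "(\<lambda>j. W \<sigma> (Suc j) \<omega>) \<longlonglongrightarrow> (\<Sum>l\<in>alphabet k m. martingale_limit k m p \<omega> (\<sigma> @ [l])) / growth"
        unfolding W_Suc[OF \<sigma>] using \<sigma> growth_gt_1 by (intro tendsto_divide tendsto_sum lim tendsto_const) auto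
    qed
    moreover have "0 \<le> weight \<omega> \<sigma>"
      using calculation(1) growth_gt_1 by (simp add: weight_def)
    ultimately show "0 \<le> weight \<omega> \<sigma> \<and> weight \<omega> \<sigma> = (\<Sum>j\<in>alphabet k m. weight \<omega> (\<sigma> @ [j]))"
      using True growth_gt_1 by (simp add: weight_def sum_divide_distrib[symmetric])
  qed
qed (simp add: consistent_weights_def weight_def)

lemma AE_limits_exist: "AE \<omega> in P. limits_exist \<omega>"
  using AE_convergent_W by (simp add: limits_exist_def)

lemma nn_integral_weight:
  assumes \<sigma>: "\<sigma> \<in> fin_words k m" and n: "length \<sigma> = n" and C: "C \<subseteq> words_upto k m n"
  shows "(\<integral>\<^sup>+\<omega>. indicator {\<omega>. chosen k m n \<omega> = C} \<omega> * weight \<omega> \<sigma> \<partial>P) =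
    ennreal (of_bool (\<sigma> \<in> C) * pmf (chosen_law n) C / growth ^ n)"
proof -
  let ?f = "\<lambda>\<omega>. indicator {\<omega>. chosen k m n \<omega> = C} \<omega> * martingale_limit k m p \<omega> \<sigma>"
  have nn: "0 \<le> weight \<omega> \<sigma>" for \<omega>
    using consistent_weights_nonneg[OF consistent_weight \<sigma>] .
  have "AE \<omega> in P. indicator {\<omega>. chosen k m n \<omega> = C} \<omega> * weight \<omega> \<sigma> = ?f \<omega> / growth ^ n"
    using AE_limits_exist by eventually_elim (simp add: weight_def n)
  moreover have "AE \<omega> in P. 0 \<le> ?f \<omega> / growth ^ n"
    using calculation by eventually_elim (metis nn indicator_pos_le mult_nonneg_nonneg)
  ultimately have "(\<integral>\<^sup>+\<omega>. ennreal (indicator {\<omega>. chosen k m n \<omega> = C} \<omega> * weight \<omega> \<sigma>) \<partial>P) = (\<integral>\<^sup>+\<omega>. ennreal (?f \<omega> / growth ^ n) \<partial>P)"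
    by (intro nn_integral_cong_AE) auto
  also have "\<dots> = ennreal (expectation (\<lambda>\<omega>. ?f \<omega> / growth ^ n))"
    using \<open>AE \<omega> in P. 0 \<le> ?f \<omega> / growth ^ n\<close> expectation_martingale_limit(1)[OF \<sigma> n C]
    by (intro nn_integral_eq_integral) auto
  also have "expectation (\<lambda>\<omega>. ?f \<omega> / growth ^ n) = of_bool (\<sigma> \<in> C) * pmf (chosen_law n) C / growth ^ n"
    using expectation_martingale_limit(2)[OF \<sigma> n C] by simp
  finally show ?thesis
    by (simp add: ennreal_mult nn ennreal_indicator)
qed

end

section \<open>The size-biased measure on finite generations\<close>

lemma inf_words_atom:
  "(\<lambda>\<eta>. map \<eta> [0..<n]) -` {c} \<inter> space (inf_words k m) = (if length c = n then cylinder k m c else {})"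
  by (auto simp: cylinder_def)

lemma letter_in_alphabet: "\<eta> \<in> space (inf_words k m) \<Longrightarrow> \<eta> i \<in> alphabet k m"
  by (auto simp: inf_words_def space_PiM PiE_iff)

lemma prefix_in_level: "\<eta> \<in> space (inf_words k m) \<Longrightarrow> map \<eta> [0..<n] \<in> level k m n"
  by (auto simp: level_def in_lists_conv_set letter_in_alphabet)

lemma finite_prefixes: "finite ((\<lambda>\<eta>. map \<eta> [0..<n]) ` space (inf_words k m))"
proof (rule finite_subset[OF _ finite_level])
  show "(\<lambda>\<eta>. map \<eta> [0..<n]) ` space (inf_words k m) \<subseteq> level k m n"
    using prefix_in_level by auto
qed

lemma cylinder_Nil: "cylinder k m [] = space (inf_words k m)"
  by (simp add: cylinder_def)

lemma cylinder_empty: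
  assumes "\<sigma> \<notin> fin_words k m" shows "cylinder k m \<sigma> = {}"
proof (rule equals0I)
  fix \<eta> assume "\<eta> \<in> cylinder k m \<sigma>"
  then have "map \<eta> [0..<length \<sigma>] = \<sigma>" "\<eta> \<in> space (inf_words k m)" by (auto simp: cylinder_def)
  then have "set \<sigma> \<subseteq> alphabet k m"
    by (auto simp: inf_words_def space_PiM) (metis (no_types, lifting) PiE_mem UNIV_I imageE list.set_map)
  then show False using assms by auto
qed

text \<open>This uniqueness identifies the branch measure, which is defined by description.\<close>

lemma measure_eqI_cylinder:
  assumes M: "sets M = sets (inf_words k m)" and N: "sets N = sets (inf_words k m)" and fin: "finite_measure N"
    and eq: "\<And>\<sigma>. \<sigma> \<in> fin_words k m \<Longrightarrow> emeasure M (cylinder k m \<sigma>) = emeasure N (cylinder k m \<sigma>)"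
  shows "M = N"
proof -
  have sp: "space N = space (inf_words k m)" by (rule sets_eq_imp_space_eq[OF N])
  have eq': "emeasure M (cylinder k m \<sigma>) = emeasure N (cylinder k m \<sigma>)" for \<sigma>
    using eq[of \<sigma>] cylinder_empty[of \<sigma> k m] by (cases "\<sigma> \<in> fin_words k m") auto
  let ?f = "\<lambda>n \<eta>. map \<eta> [0..<n]"
  show ?thesis
  proof (rule measure_eqI_filtration[where f = ?f])
    show "sets M = sets N" by (simp add: M N)
    show "{?f n -` {c} \<inter> space N |n c. True} \<subseteq> sets N"
      by (auto simp: sp N inf_words_atom cylinder_sets simp del: vimage_eq)
    show "(\<lambda>x. x) \<in> sigma (space N) {?f n -` {c} \<inter> space N |n c. True} \<rightarrow>\<^sub>M N"
      unfolding sp measurable_cong_sets[OF refl N] inf_words_def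
    proof (rule measurable_PiM_single')
      fix i :: nat
      have *: "(\<lambda>\<eta>. \<eta> i) \<in> sigma (space (inf_words k m)) {?f n -` {c} \<inter> space (inf_words k m) |n c. True} \<rightarrow>\<^sub>M count_space (alphabet k m)"
        by (rule measurable_of_atoms[where f = ?f and n = "Suc i"])
          (auto simp: letter_in_alphabet simp del: upt_Suc intro!: finite_prefixes dest: map_eq_conv[THEN iffD1])
      then show "(\<lambda>\<eta>. \<eta> i) \<in> sigma (space (Pi\<^sub>M UNIV (\<lambda>_. count_space (alphabet k m)))) {?f n -` {c} \<inter> space (Pi\<^sub>M UNIV (\<lambda>_. count_space (alphabet k m))) |n c. True} \<rightarrow>\<^sub>M count_space (alphabet k m)"
        by (simp only: inf_words_def)
    qed (auto simp: space_PiM space_measure_of_conv)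
    show "emeasure M (space N) = emeasure N (space N)"
      using eq'[of "[]"] by (simp add: sp cylinder_Nil)
    show "emeasure M (?f n -` {c} \<inter> space N) = emeasure N (?f n -` {c} \<inter> space N)" for n c
      using eq'[of c] by (simp add: sp inf_words_atom)
  qed (auto simp: fin)
qed

text \<open>The dimension is a parameter linked to the type of vectors by an equation, so that the results on
  words carry over without mentioning the type.\<close>

locale mandelbrot = percolation k m p P
  for k m :: nat and p :: real and P :: "(nat list \<Rightarrow> bool) measure" +
  fixes J :: "nat list \<Rightarrow> (real ^ 'm) set"
  assumes dim: "m = CARD('m)" and cubes: "cube_system k J"
begin

abbreviation Q :: "((nat \<Rightarrow> nat) \<times> (nat list \<Rightarrow> bool)) measure" where
  "Q \<equiv> size_biased_measure k p J P"

definition diam_factor :: real where "diam_factor = diameter (J []) powr dim_exp k m p"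

lemma diameter_pos: "0 < diameter (J [])"
proof -
  have J0: "J [] = {x. \<forall>i. 0 \<le> x $ i \<and> x $ i \<le> 1}"
    using cubes by (simp add: cube_system_def)
  have "bounded (J [])"
  proof (rule bounded_subset[OF bounded_cbox[of "0 :: real ^ 'm" "\<chi> i. 1"]])
    show "J [] \<subseteq> cbox 0 (\<chi> i. 1)" by (auto simp: J0 mem_box_cart)
  qed
  then have "dist (0 :: real ^ 'm) (\<chi> i. 1) \<le> diameter (J [])"
    by (intro diameter_bounded_bound) (auto simp: J0)
  moreover have "(0 :: real ^ 'm) \<noteq> (\<chi> i. 1)" by (auto simp: vec_eq_iff)
  ultimately show ?thesis
    by (metis dist_pos_lt order_less_le_trans)
qed

lemma diam_factor_pos: "0 < diam_factor"
  using diameter_pos by (simp add: diam_factor_def)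

lemma diam_factor_inverse: "diameter (J []) powr (- dim_exp k m p) * diam_factor = 1"
  using diameter_pos by (simp add: diam_factor_def powr_minus)

definition quantile_law :: "(nat list \<Rightarrow> bool) \<Rightarrow> (nat \<Rightarrow> nat) measure" where
  "quantile_law \<omega> = distr (restrict_space lborel {0..<weight \<omega> []}) (inf_words k m) (quantile_word (weight \<omega>))"

lemma measurable_quantile_pair:
  "(\<lambda>z. quantile_word (weight (fst z)) (snd z)) \<in> P \<Otimes>\<^sub>M borel \<rightarrow>\<^sub>M inf_words k m"
  using measurable_quantile_word[of P k m weight] consistent_weight k by (simp add: case_prod_unfold)

lemma measurable_quantile_pair' [measurable]:
  "(\<lambda>z. quantile_word (weight (fst z)) (snd z)) \<in> P \<Otimes>\<^sub>M lborel \<rightarrow>\<^sub>M inf_words k m"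
  using measurable_quantile_pair by (simp add: measurable_cong_sets[OF sets_pair_measure_cong[OF refl sets_lborel] refl])

lemma measurable_quantile: "\<omega> \<in> space P \<Longrightarrow> quantile_word (weight \<omega>) \<in> borel \<rightarrow>\<^sub>M inf_words k m"
  using measurable_compose[OF measurable_Pair1' measurable_quantile_pair] by simp

lemma emeasure_quantile_law:
  assumes \<omega>: "\<omega> \<in> space P" and A: "A \<in> sets (inf_words k m)"
  shows "emeasure (quantile_law \<omega>) A = emeasure lborel {u. 0 \<le> u \<and> u < weight \<omega> [] \<and> quantile_word (weight \<omega>) u \<in> A}"
proof -
  have meas: "quantile_word (weight \<omega>) \<in> restrict_space lborel {0..<weight \<omega> []} \<rightarrow>\<^sub>M inf_words k m"
    using measurable_quantile[OF \<omega>] by (intro measurable_restrict_space1) simp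
  show ?thesis
    unfolding quantile_law_def emeasure_distr[OF meas A]
    by (subst emeasure_restrict_space) (auto simp: space_restrict_space intro!: arg_cong[where f = "emeasure lborel"])
qed

lemma emeasure_quantile_law_cylinder:
  assumes \<omega>: "\<omega> \<in> space P" and \<sigma>: "\<sigma> \<in> fin_words k m"
  shows "emeasure (quantile_law \<omega>) (cylinder k m \<sigma>) = ennreal (weight \<omega> \<sigma>)"
proof -
  let ?w = "weight \<omega>"
  note w = consistent_weight[of \<omega>]
  have k1: "k \<ge> 1" using k by simp
  have "{u. 0 \<le> u \<and> u < ?w [] \<and> quantile_word ?w u \<in> cylinder k m \<sigma>} = {left_end ?w \<sigma>..<left_end ?w \<sigma> + ?w \<sigma>}"
    using quantile_word_cylinder[OF w k1 _ _ \<sigma>] cylinder_interval_sub[OF w \<sigma>] by fastforce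
  then show ?thesis
    using consistent_weights_nonneg[OF w \<sigma>]
    by (simp add: emeasure_quantile_law[OF \<omega> cylinder_sets])
qed

text \<open>For a realisation whose martingales all converge, the branch measure exists and is a multiple of the
  image of Lebesgue measure under the quantile coding.\<close>

lemma branch_measure_eq:
  assumes \<omega>: "\<omega> \<in> space P" and g: "limits_exist \<omega>"
  shows "branch_measure k p J \<omega> = scale_measure (ennreal diam_factor) (quantile_law \<omega>)" (is "_ = ?N")
proof -
  have sN: "sets ?N = sets (inf_words k m)" by (simp add: quantile_law_def)
  have val: "emeasure ?N (cylinder k m \<sigma>) = ennreal (diameter (J []) powr dim_exp k m p *
          real k powr (- (real (length \<sigma>) * dim_exp k m p)) * martingale_limit k m p \<omega> \<sigma>)"
    if "\<sigma> \<in> fin_words k m" for \<sigma>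
    using emeasure_quantile_law_cylinder[OF \<omega> that] g diam_factor_pos consistent_weights_nonneg[OF consistent_weight that]
    by (simp add: k_powr weight_def diam_factor_def[symmetric] ennreal_mult'[symmetric])
  have fin: "finite_measure ?N"
  proof (rule finite_measureI)
    have "space ?N = cylinder k m []" using sets_eq_imp_space_eq[OF sN] by (simp add: cylinder_Nil)
    then show "emeasure ?N (space ?N) \<noteq> \<infinity>" using val[of "[]"] by simp
  qed
  show ?thesis
    unfolding branch_measure_def dim[symmetric]
  proof (rule the_equality)
    fix M assume M: "sets M = sets (inf_words k m) \<and> (\<forall>\<sigma>\<in>fin_words k m. emeasure M (cylinder k m \<sigma>) =
      ennreal (diameter (J []) powr dim_exp k m p * real k powr - (real (length \<sigma>) * dim_exp k m p) *
        martingale_limit k m p \<omega> \<sigma>))"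
    show "M = ?N"
    proof (rule measure_eqI_cylinder[OF conjunct1[OF M] sN fin])
      fix \<sigma> assume \<sigma>: "\<sigma> \<in> fin_words k m"
      show "emeasure M (cylinder k m \<sigma>) = emeasure ?N (cylinder k m \<sigma>)"
        unfolding val[OF \<sigma>] by (rule bspec[OF conjunct2[OF M] \<sigma>])
    qed
  qed (use sN val in blast)
qed

text \<open>Attaching to a realisation \<open>\<omega>\<close> a parameter with Lebesgue measure on \<open>[0, weight \<omega> [])\<close> and coding it as
  a branch yields a measure whose sections over \<open>\<omega>\<close> are almost surely the branch measures up to a
  constant factor.\<close>

definition quantile_model :: "((nat \<Rightarrow> nat) \<times> (nat list \<Rightarrow> bool)) measure" where
  "quantile_model = distr (restrict_space (P \<Otimes>\<^sub>M lborel) {z. 0 \<le> snd z \<and> snd z < weight (fst z) []})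
     (inf_words k m \<Otimes>\<^sub>M P) (\<lambda>z. (quantile_word (weight (fst z)) (snd z), fst z))"

lemma emeasure_quantile_model:
  assumes B: "B \<in> sets (inf_words k m \<Otimes>\<^sub>M P)"
  shows "emeasure quantile_model B = (\<integral>\<^sup>+\<omega>. emeasure (quantile_law \<omega>) {\<eta>. (\<eta>, \<omega>) \<in> B} \<partial>P)"
proof -
  let ?S = "{z. 0 \<le> snd z \<and> snd z < weight (fst z) []}" and ?h = "\<lambda>z. (quantile_word (weight (fst z)) (snd z), fst z)"
  have h [measurable]: "?h \<in> P \<Otimes>\<^sub>M lborel \<rightarrow>\<^sub>M inf_words k m \<Otimes>\<^sub>M P" by measurable
  have "{z \<in> space (P \<Otimes>\<^sub>M lborel). 0 \<le> snd z \<and> snd z < weight (fst z) []} \<in> sets (P \<Otimes>\<^sub>M lborel)"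
    by measurable
  then have S: "?S \<inter> space (P \<Otimes>\<^sub>M lborel) \<in> sets (P \<Otimes>\<^sub>M lborel)"
    by (simp add: Int_def conj_commute)
  have X: "?h -` B \<inter> (?S \<inter> space (P \<Otimes>\<^sub>M lborel)) \<in> sets (P \<Otimes>\<^sub>M lborel)"
    using sets.Int[OF S measurable_sets[OF h B]] by (simp add: Int_ac)
  have "emeasure quantile_model B = emeasure (P \<Otimes>\<^sub>M lborel) (?h -` B \<inter> (?S \<inter> space (P \<Otimes>\<^sub>M lborel)))"
    unfolding quantile_model_def
    by (subst emeasure_distr[OF measurable_restrict_space1[OF h] B], subst emeasure_restrict_space)
      (use S in \<open>auto simp: space_restrict_space Int_ac\<close>)
  also have "\<dots> = (\<integral>\<^sup>+\<omega>. emeasure lborel (Pair \<omega> -` (?h -` B \<inter> (?S \<inter> space (P \<Otimes>\<^sub>M lborel)))) \<partial>P)"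
    by (rule lborel.emeasure_pair_measure_alt[OF X])
  also have "\<dots> = (\<integral>\<^sup>+\<omega>. emeasure (quantile_law \<omega>) {\<eta>. (\<eta>, \<omega>) \<in> B} \<partial>P)"
  proof (rule nn_integral_cong)
    fix \<omega> assume \<omega>: "\<omega> \<in> space P"
    have "{\<eta>. (\<eta>, \<omega>) \<in> B} \<in> sets (inf_words k m)"
      using sets_Pair2[OF B, of \<omega>] by (simp add: vimage_def)
    from emeasure_quantile_law[OF \<omega> this]
    show "emeasure lborel (Pair \<omega> -` (?h -` B \<inter> (?S \<inter> space (P \<Otimes>\<^sub>M lborel)))) = emeasure (quantile_law \<omega>) {\<eta>. (\<eta>, \<omega>) \<in> B}"
      using \<omega> by (auto simp: space_pair_measure intro!: arg_cong[where f = "emeasure lborel"])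
  qed
  finally show ?thesis .
qed

lemma size_biased_measure_eq: "Q = quantile_model"
proof -
  let ?M = "inf_words k m \<Otimes>\<^sub>M P"
  have s: "sets quantile_model = sets ?M" "space quantile_model = space ?M"
    by (simp_all add: quantile_model_def)
  have "Q = measure_of (space ?M) (sets ?M) (emeasure quantile_model)"
    unfolding size_biased_measure_def dim[symmetric]
  proof (rule measure_of_eq)
    show "sets ?M \<subseteq> Pow (space ?M)" by (rule sets.space_closed)
    fix B assume "B \<in> sigma_sets (space ?M) (sets ?M)"
    then have B: "B \<in> sets ?M" by (simp add: sets.sigma_sets_eq)
    have "(\<integral>\<^sup>+\<omega>. emeasure (branch_measure k p J \<omega>) {\<eta>. (\<eta>, \<omega>) \<in> B} \<partial>P) =
      (\<integral>\<^sup>+\<omega>. ennreal diam_factor * emeasure (quantile_law \<omega>) {\<eta>. (\<eta>, \<omega>) \<in> B} \<partial>P)"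
      using AE_limits_exist AE_space by (intro nn_integral_cong_AE, eventually_elim) (simp add: branch_measure_eq)
    also have "\<dots> = ennreal diam_factor * (\<integral>\<^sup>+\<omega>. emeasure (quantile_law \<omega>) {\<eta>. (\<eta>, \<omega>) \<in> B} \<partial>P)"
    proof (rule nn_integral_cmult)
      let ?S = "{z. 0 \<le> snd z \<and> snd z < weight (fst z) []}" and ?h = "\<lambda>z. (quantile_word (weight (fst z)) (snd z), fst z)"
      have X: "{z \<in> space (P \<Otimes>\<^sub>M lborel). (0 \<le> snd z \<and> snd z < weight (fst z) []) \<and> ?h z \<in> B} \<in> sets (P \<Otimes>\<^sub>M lborel)"
        using B by measurable
      have "(\<lambda>\<omega>. emeasure lborel (Pair \<omega> -` {z \<in> space (P \<Otimes>\<^sub>M lborel). (0 \<le> snd z \<and> snd z < weight (fst z) []) \<and> ?h z \<in> B})) \<in> borel_measurable P"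
        by (rule lborel.measurable_emeasure_Pair[OF X])
      also have "?this \<longleftrightarrow> (\<lambda>\<omega>. emeasure (quantile_law \<omega>) {\<eta>. (\<eta>, \<omega>) \<in> B}) \<in> borel_measurable P"
      proof (rule measurable_cong)
        fix \<omega> assume \<omega>: "\<omega> \<in> space P"
        have "{\<eta>. (\<eta>, \<omega>) \<in> B} \<in> sets (inf_words k m)"
          using sets_Pair2[OF B, of \<omega>] by (simp add: vimage_def)
        from emeasure_quantile_law[OF \<omega> this]
        show "emeasure lborel (Pair \<omega> -` {z \<in> space (P \<Otimes>\<^sub>M lborel). (0 \<le> snd z \<and> snd z < weight (fst z) []) \<and> ?h z \<in> B}) = emeasure (quantile_law \<omega>) {\<eta>. (\<eta>, \<omega>) \<in> B}"
          using \<omega> by (auto simp: space_pair_measure intro!: arg_cong[where f = "emeasure lborel"])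
      qed
      finally show "(\<lambda>\<omega>. emeasure (quantile_law \<omega>) {\<eta>. (\<eta>, \<omega>) \<in> B}) \<in> borel_measurable P" .
    qed
    finally show "ennreal (diameter (J []) powr (- dim_exp k m p)) *
        (\<integral>\<^sup>+\<omega>. emeasure (branch_measure k p J \<omega>) {\<eta>. (\<eta>, \<omega>) \<in> B} \<partial>P) = emeasure quantile_model B"
      using diam_factor_inverse diam_factor_pos
      by (simp add: emeasure_quantile_model[OF B] mult.assoc[symmetric] ennreal_mult'[symmetric])
  qed
  also have "\<dots> = quantile_model"
    unfolding s[symmetric] by (rule measure_of_of_measure)
  finally show ?thesis .
qed

lemma sets_Q: "sets Q = sets (inf_words k m \<Otimes>\<^sub>M P)"
  by (simp add: size_biased_measure_eq quantile_model_def)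

text \<open>What is known of a pair up to generation \<open>n\<close>; the values of \<open>history n\<close> are the atoms of the
  filtration used to compare measures.\<close>

definition history :: "nat \<Rightarrow> (nat \<Rightarrow> nat) \<times> (nat list \<Rightarrow> bool) \<Rightarrow> nat list \<times> nat list set" where
  "history n z = (map (fst z) [0..<n], chosen k m n (snd z))"

lemma history_atom_sets: "history n -` {c} \<inter> space (inf_words k m \<Otimes>\<^sub>M P) \<in> sets (inf_words k m \<Otimes>\<^sub>M P)"
proof -
  have "history n -` {c} \<inter> space (inf_words k m \<Otimes>\<^sub>M P) =
    ((\<lambda>\<eta>. map \<eta> [0..<n]) -` {fst c} \<inter> space (inf_words k m)) \<times> (chosen k m n -` {snd c} \<inter> space P)"
    by (auto simp: history_def space_pair_measure)
  also have "\<dots> \<in> sets (inf_words k m \<Otimes>\<^sub>M P)"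
    unfolding inf_words_atom using cylinder_sets[of k m "fst c"] by (intro pair_measureI) auto
  finally show ?thesis .
qed

text \<open>The weight of \<open>\<sigma>\<close> has conditional expectation \<open>growth ^ (- n)\<close> given generation \<open>n\<close> when \<open>\<sigma>\<close> is chosen,
  and zero when it is not.\<close>

lemma emeasure_Q_atom:
  assumes \<sigma>: "\<sigma> \<in> level k m n" and C: "C \<subseteq> words_upto k m n"
  shows "emeasure Q (history n -` {(\<sigma>, C)} \<inter> space (inf_words k m \<Otimes>\<^sub>M P)) =
    ennreal (of_bool (\<sigma> \<in> C) * pmf (chosen_law n) C / growth ^ n)"
proof -
  let ?B = "history n -` {(\<sigma>, C)} \<inter> space (inf_words k m \<Otimes>\<^sub>M P)"
  have \<sigma>': "\<sigma> \<in> fin_words k m" "length \<sigma> = n" using \<sigma> by (auto simp: level_def)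
  have "emeasure Q ?B = (\<integral>\<^sup>+\<omega>. emeasure (quantile_law \<omega>) {\<eta>. (\<eta>, \<omega>) \<in> ?B} \<partial>P)"
    unfolding size_biased_measure_eq by (rule emeasure_quantile_model[OF history_atom_sets])
  also have "\<dots> = (\<integral>\<^sup>+\<omega>. indicator {\<omega>. chosen k m n \<omega> = C} \<omega> * weight \<omega> \<sigma> \<partial>P)"
  proof (rule nn_integral_cong)
    fix \<omega> assume \<omega>: "\<omega> \<in> space P"
    have "{\<eta>. (\<eta>, \<omega>) \<in> ?B} = (if chosen k m n \<omega> = C then cylinder k m \<sigma> else {})"
      using \<omega> \<sigma>' by (auto simp: history_def space_pair_measure cylinder_def)
    then show "emeasure (quantile_law \<omega>) {\<eta>. (\<eta>, \<omega>) \<in> ?B} = indicator {\<omega>. chosen k m n \<omega> = C} \<omega> * weight \<omega> \<sigma>"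
      using emeasure_quantile_law_cylinder[OF \<omega> \<sigma>'(1)] by auto
  qed
  also have "\<dots> = ennreal (of_bool (\<sigma> \<in> C) * pmf (chosen_law n) C / growth ^ n)"
    by (rule nn_integral_weight[OF \<sigma>' C])
  finally show ?thesis .
qed

lemma measure_eq_Q:
  assumes sN: "sets N = sets (inf_words k m \<Otimes>\<^sub>M P)" and N: "prob_space N"
    and eq: "\<And>n \<sigma> C. \<sigma> \<in> level k m n \<Longrightarrow> C \<subseteq> words_upto k m n \<Longrightarrow>
      emeasure N (history n -` {(\<sigma>, C)} \<inter> space (inf_words k m \<Otimes>\<^sub>M P)) =
      ennreal (of_bool (\<sigma> \<in> C) * pmf (chosen_law n) C / growth ^ n)"
  shows "Q = N"
proof -
  interpret N: prob_space N by fact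
  have sp: "space N = space (inf_words k m \<Otimes>\<^sub>M P)" by (rule sets_eq_imp_space_eq[OF sN])
  have empty: "history n -` {c} \<inter> space (inf_words k m \<Otimes>\<^sub>M P) = {}"
    if "\<not> (fst c \<in> level k m n \<and> snd c \<subseteq> words_upto k m n)" for n c
    using that prefix_in_level[of _ k m n] by (force simp: history_def space_pair_measure chosen_def)
  show ?thesis
  proof (rule measure_eqI_filtration[where f = history])
    show "sets Q = sets N" by (simp add: sets_Q sN)
    show "finite_measure N" by (rule N.finite_measure_axioms)
    show "{history n -` {c} \<inter> space N |n c. True} \<subseteq> sets N"
      using history_atom_sets by (auto simp: sp sN simp del: vimage_eq)
    show "(\<lambda>x. x) \<in> sigma (space N) {history n -` {c} \<inter> space N |n c. True} \<rightarrow>\<^sub>M N"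
      unfolding sp measurable_cong_sets[OF refl sN]
    proof -
      let ?F = "sigma (space (inf_words k m \<Otimes>\<^sub>M P)) {history n -` {c} \<inter> space (inf_words k m \<Otimes>\<^sub>M P) |n c. True}"
      have spF: "space ?F = space (inf_words k m \<Otimes>\<^sub>M P)" by (rule space_measure_of) auto
      have fin: "finite (history n ` space (inf_words k m \<Otimes>\<^sub>M P))" for n
      proof (rule finite_subset)
        show "history n ` space (inf_words k m \<Otimes>\<^sub>M P) \<subseteq> level k m n \<times> Pow (words_upto k m n)"
          using prefix_in_level[of _ k m n] by (force simp: history_def space_pair_measure chosen_def)
      qed (simp add: finite_level)
      have 1: "fst \<in> ?F \<rightarrow>\<^sub>M inf_words k m"
        unfolding inf_words_def
      proof (rule measurable_PiM_single', goal_cases)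
        case (1 i)
        have "(\<lambda>z. fst z i) \<in> ?F \<rightarrow>\<^sub>M count_space (alphabet k m)"
          by (rule measurable_of_atoms[where f = history and n = "Suc i", OF fin])
            (auto simp: history_def space_pair_measure letter_in_alphabet)
        then show ?case by (simp only: inf_words_def)
      next
        case 2
        show ?case using spF by (auto simp: space_pair_measure inf_words_def space_PiM)
      qed
      have "snd \<in> ?F \<rightarrow>\<^sub>M realisations k m"
        unfolding realisations_def
      proof (rule measurable_PiM_single')
        fix \<sigma> assume \<sigma>: "\<sigma> \<in> fin_words k m"
        show "(\<lambda>z. snd z \<sigma>) \<in> ?F \<rightarrow>\<^sub>M count_space UNIV"
        proof (rule measurable_of_atoms[where f = history and n = "length \<sigma>", OF fin])
          fix x y :: "(nat \<Rightarrow> nat) \<times> (nat list \<Rightarrow> bool)"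
          assume "history (length \<sigma>) x = history (length \<sigma>) y"
          then have "\<sigma> \<in> chosen k m (length \<sigma>) (snd x) \<longleftrightarrow> \<sigma> \<in> chosen k m (length \<sigma>) (snd y)"
            by (simp add: history_def)
          then show "snd x \<sigma> = snd y \<sigma>" using \<sigma> by (simp add: chosen_def words_upto_def)
        qed auto
      next
        show "(\<lambda>z i. snd z i) \<in> space ?F \<rightarrow> (\<Pi>\<^sub>E i\<in>fin_words k m. space (count_space UNIV))"
          unfolding spF using sets_eq_imp_space_eq[OF sets_P]
          by (auto simp: space_pair_measure realisations_def space_PiM simp del: in_lists_conv_set)
      qed
      then have 2: "snd \<in> ?F \<rightarrow>\<^sub>M P" by (simp add: measurable_cong_sets[OF refl sets_P])
      show "(\<lambda>x. x) \<in> ?F \<rightarrow>\<^sub>M inf_words k m \<Otimes>\<^sub>M P"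
        using measurable_Pair[OF 1 2] by simp
    qed
    show "history n x = history n y" if "history (Suc n) x = history (Suc n) y" for n x y
      using that by (auto simp: history_def chosen_mono[of n "Suc n"])
    show eqc: "emeasure Q (history n -` {c} \<inter> space N) = emeasure N (history n -` {c} \<inter> space N)" for n c
    proof (cases "fst c \<in> level k m n \<and> snd c \<subseteq> words_upto k m n")
      case True
      then show ?thesis using eq[of "fst c" n "snd c"] emeasure_Q_atom[of "fst c" n "snd c"] by (simp add: sp)
    next
      case False
      then show ?thesis by (simp only: sp empty[OF False] emeasure_empty)
    qed
    show "emeasure Q (space N) = emeasure N (space N)"
    proof -
      have s: "space N = (history 0 -` {([], {})} \<inter> space N) \<union> (history 0 -` {([], {[]})} \<inter> space N)"
        by (auto simp: history_def chosen_def words_upto_0)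
      have d: "(history 0 -` {([], {})} \<inter> space N) \<inter> (history 0 -` {([], {[]})} \<inter> space N) = {}" by auto
      have m: "history 0 -` {c} \<inter> space N \<in> sets Q" "history 0 -` {c} \<inter> space N \<in> sets N" for c
        using history_atom_sets by (simp_all add: sp sN sets_Q)
      show ?thesis
        by (subst (1 2) s, subst (1 2) plus_emeasure[symmetric]) (use d m eqc in auto)
    qed
  qed
qed

end

section \<open>The spine model\<close>

text \<open>A site consists of the digit of the branch at its height and of the Boolean marks of the words that
  start at that height.\<close>

type_synonym 'd env = "nat \<Rightarrow> 'd \<times> ('d list \<Rightarrow> bool)"

definition spine :: "'d env \<Rightarrow> nat \<Rightarrow> 'd list" where
  "spine y n = map (\<lambda>i. fst (y i)) [0..<n]"

text \<open>Follows the word along the branch: words on the branch are always kept, any other word is decided by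
  the mark that the site where it leaves the branch assigns to the remaining word.\<close>

primrec kept :: "'d list \<Rightarrow> 'd env \<Rightarrow> bool" where
  "kept [] y = True"
| "kept (d # w) y = (if d = fst (y 0) then kept w (\<lambda>i. y (Suc i)) else snd (y 0) (d # w))"

definition alive :: "'d list \<Rightarrow> 'd env \<Rightarrow> bool" where
  "alive w y \<longleftrightarrow> (\<forall>i\<le>length w. kept (take i w) y)"

lemma length_spine [simp]: "length (spine y n) = n"
  by (simp add: spine_def)

lemma spine_Suc: "spine y (Suc n) = spine y n @ [fst (y n)]"
  by (simp add: spine_def)

lemma spine_Suc': "spine y (Suc n) = fst (y 0) # spine (\<lambda>i. y (Suc i)) n"
  by (simp add: spine_def upt_conv_Cons map_Suc_upt[symmetric] del: upt_Suc)

lemma take_spine: "i \<le> n \<Longrightarrow> take i (spine y n) = spine y i"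
  by (simp add: spine_def take_map)

lemma alive_Nil [simp]: "alive [] y"
  by (simp add: alive_def)

lemma alive_snoc: "alive (w @ [d]) y \<longleftrightarrow> alive w y \<and> kept (w @ [d]) y"
  by (auto simp: alive_def le_Suc_eq)

lemma kept_spine_append: "kept (spine y n @ w) y = kept w (\<lambda>i. y (i + n))"
proof (induction n arbitrary: y)
  case (Suc n)
  then show ?case using Suc[of "\<lambda>i. y (Suc i)"] by (simp add: spine_Suc')
qed (simp add: spine_def)

lemma kept_spine: "kept (spine y n) y"
  using kept_spine_append[of y n "[]"] by simp

lemma alive_spine: "alive (spine y n) y"
  by (simp add: alive_def take_spine kept_spine)

text \<open>This is the self-similarity of the model: the subtree of a branch vertex is governed by the shifted
  sequence of sites.\<close>

lemma alive_spine_append: "alive (spine y n @ w) y = alive w (\<lambda>i. y (i + n))"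
proof (induction w rule: rev_induct)
  case (snoc d w)
  have "alive (spine y n @ w @ [d]) y \<longleftrightarrow> alive (spine y n @ w) y \<and> kept (spine y n @ (w @ [d])) y"
    using alive_snoc[of "spine y n @ w" d y] by simp
  then show ?case by (simp only: snoc alive_snoc kept_spine_append)
qed (simp add: alive_spine)

lemma kept_local:
  assumes "\<And>i. i < n \<Longrightarrow> y i = y' i" "\<not> prefix (spine y n) w"
  shows "kept w y = kept w y'"
  using assms
proof (induction w arbitrary: n y y')
  case (Cons d w)
  from Cons.prems(2) obtain n' where n: "n = Suc n'" by (cases n) (auto simp: spine_def)
  have y0: "y 0 = y' 0" using Cons.prems(1) n by simp
  show ?case
  proof (cases "d = fst (y 0)")
    case True
    then have "\<not> prefix (spine (\<lambda>i. y (Suc i)) n') w"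
      using Cons.prems(2) by (simp add: n spine_Suc')
    then have "kept w (\<lambda>i. y (Suc i)) = kept w (\<lambda>i. y' (Suc i))"
      using Cons.prems(1) n by (intro Cons.IH) auto
    then show ?thesis using True y0 by simp
  qed (use y0 in simp)
qed simp

text \<open>A word that does not extend the branch of height \<open>n\<close> ends on it or leaves it at one of the first \<open>n\<close>
  sites.\<close>

lemma alive_local:
  assumes "\<And>i. i < n \<Longrightarrow> y i = y' i" "\<not> prefix (spine y n) w"
  shows "alive w y = alive w y'"
proof -
  have "\<not> prefix (spine y n) (take i w)" for i
    using assms(2) take_is_prefix prefix_order.trans by blast
  then have "kept (take i w) y = kept (take i w) y'" for i
    by (intro kept_local[of n] assms(1))
  then show ?thesis by (simp add: alive_def)
qed

definition site :: "'d set \<Rightarrow> real \<Rightarrow> ('d \<times> ('d list \<Rightarrow> bool)) measure" where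
  "site D p = uniform_count_measure D \<Otimes>\<^sub>M PiM UNIV (\<lambda>_. measure_pmf (bernoulli_pmf p))"

definition model :: "'d set \<Rightarrow> real \<Rightarrow> 'd env measure" where
  "model D p = PiM UNIV (\<lambda>_. site D p)"

locale spine_model =
  fixes D :: "'d set" and p :: real
  assumes D: "finite D" "D \<noteq> {}"
begin

sublocale digit_measure: prob_space "uniform_count_measure D"
  using D by (rule prob_space_uniform_count_measure)

sublocale bits: product_prob_space "\<lambda>_. measure_pmf (bernoulli_pmf p)" "UNIV :: 'd list set"
  by unfold_locales

lemma prob_space_site: "prob_space (site D p)"
  unfolding site_def
  by (intro prob_space_pair digit_measure.prob_space_axioms bits.P.prob_space_axioms)

sublocale site: prob_space "site D p" by (rule prob_space_site)

sublocale seq: sequence_space "site D p"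
  by unfold_locales

lemma prob_space_model: "prob_space (model D p)"
  unfolding model_def by (rule seq.P.prob_space_axioms)

lemma space_model: "y \<in> space (model D p) \<longleftrightarrow> (\<forall>i. fst (y i) \<in> D)"
  by (auto simp: model_def site_def space_PiM space_pair_measure space_uniform_count_measure PiE_iff mem_Times_iff)

lemma measurable_digit [measurable]: "(\<lambda>y. fst (y i)) \<in> model D p \<rightarrow>\<^sub>M count_space UNIV"
proof -
  have "(\<lambda>y. fst (y i)) \<in> model D p \<rightarrow>\<^sub>M uniform_count_measure D"
    unfolding model_def site_def by measurable
  then have "(\<lambda>y. fst (y i)) \<in> model D p \<rightarrow>\<^sub>M count_space D"
    by (subst measurable_cong_sets[OF refl, of _ "uniform_count_measure D"]) (simp_all add: sets_uniform_count_measure)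
  then show ?thesis by (rule measurable_compose) simp
qed

lemma measurable_site_bit [measurable]: "Measurable.pred (model D p) (\<lambda>y. snd (y i) w)"
proof -
  have "(\<lambda>y. snd (y i)) \<in> model D p \<rightarrow>\<^sub>M PiM UNIV (\<lambda>_::'d list. measure_pmf (bernoulli_pmf p))"
    unfolding model_def site_def by measurable
  moreover have "(\<lambda>b. b w) \<in> PiM UNIV (\<lambda>_::'d list. measure_pmf (bernoulli_pmf p)) \<rightarrow>\<^sub>M measure_pmf (bernoulli_pmf p)"
    by (rule measurable_component_singleton) simp
  ultimately have "(\<lambda>y. snd (y i) w) \<in> model D p \<rightarrow>\<^sub>M measure_pmf (bernoulli_pmf p)"
    by (rule measurable_compose)
  then show ?thesis by simp
qed

lemma measurable_model_shift [measurable]: "(\<lambda>y i. y (i + n)) \<in> model D p \<rightarrow>\<^sub>M model D p"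
  unfolding model_def by (rule seq.measurable_shift)

lemma measurable_kept [measurable]: "Measurable.pred (model D p) (kept w)"
proof (induction w)
  case (Cons d w)
  have [measurable]: "Measurable.pred (model D p) (\<lambda>y. kept w (\<lambda>i. y (Suc i)))"
    using measurable_compose[OF measurable_model_shift[of 1] Cons] by simp
  have "Measurable.pred (model D p) (\<lambda>y. if d = fst (y 0) then kept w (\<lambda>i. y (Suc i)) else snd (y 0) (d # w))"
    by measurable
  then show ?case by simp
qed simp

lemma measurable_alive [measurable]: "Measurable.pred (model D p) (alive w)"
  unfolding alive_def[abs_def] by measurable

lemma measurable_spine_eq [measurable]: "Measurable.pred (model D p) (\<lambda>y. spine y n = s)"
proof -
  have "spine y n = s \<longleftrightarrow> length s = n \<and> (\<forall>i\<in>{..<n}. fst (y i) = s ! i)" for y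
    unfolding spine_def by (subst list_eq_iff_nth_eq) auto
  moreover have "Measurable.pred (model D p) (\<lambda>y. length s = n \<and> (\<forall>i\<in>{..<n}. fst (y i) = s ! i))"
    by measurable
  ultimately show ?thesis by simp
qed

lemma emeasure_site:
  assumes d: "d \<in> D" and U: "finite U"
  shows "{x \<in> space (site D p). fst x = d \<and> (\<forall>w\<in>U. snd x w = c w)} \<in> sets (site D p)"
    "emeasure (site D p) {x \<in> space (site D p). fst x = d \<and> (\<forall>w\<in>U. snd x w = c w)} =
      ennreal (1 / card D) * (\<Prod>w\<in>U. ennreal (pmf (bernoulli_pmf p) (c w)))"
proof -
  let ?B = "PiM UNIV (\<lambda>_::'d list. measure_pmf (bernoulli_pmf p))"
  let ?E = "{b \<in> space ?B. \<forall>w\<in>U. b w \<in> {c w}}"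
  have eq: "{x \<in> space (site D p). fst x = d \<and> (\<forall>w\<in>U. snd x w = c w)} = {d} \<times> ?E"
  proof (rule set_eqI)
    fix x :: "'d \<times> ('d list \<Rightarrow> bool)"
    have "space ?B = UNIV" by (simp add: space_PiM)
    then show "x \<in> {x \<in> space (site D p). fst x = d \<and> (\<forall>w\<in>U. snd x w = c w)} \<longleftrightarrow> x \<in> {d} \<times> ?E"
      using d by (cases x) (auto simp add: site_def space_pair_measure space_uniform_count_measure)
  qed
  have E: "?E \<in> sets ?B"
    using U by (intro sets.sets_Collect_finite_All) (auto intro!: sets_Collect_single')
  have d': "{d} \<in> sets (uniform_count_measure D)" using d by (simp add: sets_uniform_count_measure)
  show "{x \<in> space (site D p). fst x = d \<and> (\<forall>w\<in>U. snd x w = c w)} \<in> sets (site D p)"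
  proof -
    have "{d} \<times> ?E \<in> sets (site D p)" unfolding site_def using d' E by (rule pair_measureI)
    then show ?thesis by (simp only: eq)
  qed
  have "emeasure (site D p) ({d} \<times> ?E) = emeasure (uniform_count_measure D) {d} * emeasure ?B ?E"
    unfolding site_def by (rule bits.P.emeasure_pair_measure_Times[OF d' E])
  also have "emeasure (uniform_count_measure D) {d} = ennreal (1 / card D)"
    using D d by (simp add: emeasure_uniform_count_measure)
  also have "emeasure ?B ?E = (\<Prod>w\<in>U. ennreal (pmf (bernoulli_pmf p) (c w)))"
    by (subst bits.emeasure_PiM_Collect[OF _ U]) (auto simp: emeasure_pmf_single)
  finally show "emeasure (site D p) {x \<in> space (site D p). fst x = d \<and> (\<forall>w\<in>U. snd x w = c w)} =
      ennreal (1 / card D) * (\<Prod>w\<in>U. ennreal (pmf (bernoulli_pmf p) (c w)))"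
    by (simp only: eq)
qed

text \<open>Off the branch the states \<open>kept w\<close> are independent: splitting off the first site separates the words
  that leave the branch there from those that follow it one step further.\<close>

lemma emeasure_model_bits:
  assumes "s \<in> lists D" and "finite U" and "\<forall>w\<in>U. length w \<le> length s \<and> \<not> prefix w s"
  shows "emeasure (model D p) {y \<in> space (model D p). spine y (length s) = s \<and> (\<forall>w\<in>U. kept w y = c w)} =
    ennreal (1 / card D) ^ length s * (\<Prod>w\<in>U. ennreal (pmf (bernoulli_pmf p) (c w)))"
  using assms
proof (induction s arbitrary: U c rule: list.induct)
  case Nil
  then have "U = {}" by auto
  then show ?case using prob_space.emeasure_space_1[OF prob_space_model] by (simp add: spine_def)
next
  case (Cons d s)
  define U0 where "U0 = {w. d # w \<in> U}"
  define U1 where "U1 = {w \<in> U. hd w \<noteq> d}"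
  have Ne: "w \<noteq> []" if "w \<in> U" for w using Cons.prems(3) that by auto
  have U: "U = (#) d ` U0 \<union> U1"
  proof (intro set_eqI iffI)
    fix w assume "w \<in> U"
    with Ne[OF this] show "w \<in> (#) d ` U0 \<union> U1" by (cases w) (auto simp: U0_def U1_def)
  qed (auto simp: U0_def U1_def)
  have disj: "(#) d ` U0 \<inter> U1 = {}" by (auto simp: U1_def)
  have fin: "finite U0" "finite U1"
    using Cons.prems(2) by (auto simp: U0_def U1_def intro!: finite_vimageI[of U "(#) d", unfolded vimage_def])
  have d: "d \<in> D" "s \<in> lists D" using Cons.prems(1) by auto
  let ?S = "model D p"
  let ?X = "{x \<in> space (site D p). fst x = d \<and> (\<forall>w\<in>U1. snd x w = c w)}"
  let ?Y = "{y \<in> space ?S. spine y (length s) = s \<and> (\<forall>w\<in>U0. kept w y = c (d # w))}"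
  let ?E = "{y \<in> space ?S. spine y (length (d # s)) = d # s \<and> (\<forall>w\<in>U. kept w y = c w)}"
  have Y: "?Y \<in> sets ?S" using fin by measurable
  have E: "?E \<in> sets ?S" using Cons.prems(2) by measurable
  have cn: "(\<lambda>(x, y). case_nat x y) \<in> site D p \<Otimes>\<^sub>M ?S \<rightarrow>\<^sub>M ?S"
    unfolding model_def by measurable
  have pre: "(\<lambda>(x, y). case_nat x y) -` ?E \<inter> space (site D p \<Otimes>\<^sub>M ?S) = ?X \<times> ?Y"
  proof (intro set_eqI)
    fix z :: "('d \<times> ('d list \<Rightarrow> bool)) \<times> 'd env"
    obtain x y where z: "z = (x, y)" by (cases z)
    have b1: "kept w (case_nat x y) = snd x w" if "w \<in> U1" "fst x = d" for w
    proof -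
      have "w \<in> U" using that by (simp add: U1_def)
      from Ne[OF this] that show ?thesis by (cases w) (auto simp: U1_def)
    qed
    have "(\<forall>w\<in>U. kept w (case_nat x y) = c w) \<longleftrightarrow> (\<forall>w\<in>U1. snd x w = c w) \<and> (\<forall>w\<in>U0. kept w y = c (d # w))" if "fst x = d"
      unfolding U ball_Un using b1[OF _ that] that by auto
    moreover have "(z \<in> space (site D p \<Otimes>\<^sub>M ?S)) = (x \<in> space (site D p) \<and> y \<in> space ?S)"
      by (simp add: z space_pair_measure)
    moreover have "x \<in> space (site D p) \<Longrightarrow> y \<in> space ?S \<Longrightarrow> case_nat x y \<in> space ?S"
      using measurable_space[OF cn, of "(x, y)"] by (simp add: space_pair_measure)
    ultimately show "z \<in> (\<lambda>(x, y). case_nat x y) -` ?E \<inter> space (site D p \<Otimes>\<^sub>M ?S) \<longleftrightarrow> z \<in> ?X \<times> ?Y"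
      by (auto simp: z spine_Suc')
  qed
  have "emeasure ?S ?E = emeasure (distr (site D p \<Otimes>\<^sub>M ?S) ?S (\<lambda>(x, y). case_nat x y)) ?E"
    using seq.PiM_iter by (simp add: model_def)
  also have "\<dots> = emeasure (site D p \<Otimes>\<^sub>M ?S) (?X \<times> ?Y)"
    by (subst emeasure_distr[OF cn E]) (simp only: pre)
  also have "\<dots> = emeasure (site D p) ?X * emeasure ?S ?Y"
  proof -
    interpret S: prob_space ?S by (rule prob_space_model)
    show ?thesis by (rule S.emeasure_pair_measure_Times[OF emeasure_site(1)[OF d(1) fin(2)] Y])
  qed
  also have "emeasure ?S ?Y = ennreal (1 / card D) ^ length s * (\<Prod>w\<in>U0. ennreal (pmf (bernoulli_pmf p) (c (d # w))))"
  proof (rule Cons.IH[OF d(2) fin(1)])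
    show "\<forall>w\<in>U0. length w \<le> length s \<and> \<not> prefix w s"
      using Cons.prems(3) by (auto simp: U0_def)
  qed
  also have "emeasure (site D p) ?X = ennreal (1 / card D) * (\<Prod>w\<in>U1. ennreal (pmf (bernoulli_pmf p) (c w)))"
    by (rule emeasure_site(2)[OF d(1) fin(2)])
  also have "(\<Prod>w\<in>U0. ennreal (pmf (bernoulli_pmf p) (c (d # w)))) = (\<Prod>w\<in>(#) d ` U0. ennreal (pmf (bernoulli_pmf p) (c w)))"
    by (subst prod.reindex) (auto simp: inj_on_def)
  also have "ennreal (1 / card D) * (\<Prod>w\<in>U1. ennreal (pmf (bernoulli_pmf p) (c w))) *
      (ennreal (1 / card D) ^ length s * (\<Prod>w\<in>(#) d ` U0. ennreal (pmf (bernoulli_pmf p) (c w)))) =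
      ennreal (1 / card D) ^ length (d # s) * (\<Prod>w\<in>U. ennreal (pmf (bernoulli_pmf p) (c w)))"
    using fin disj by (subst U, subst prod.union_disjoint) (simp_all add: mult_ac)
  finally show ?case .
qed

definition dwords :: "nat \<Rightarrow> 'd list set" where
  "dwords N = {w \<in> lists D. length w \<le> N}"

lemma finite_dwords: "finite (dwords N)"
proof -
  have "dwords N = {w. set w \<subseteq> D \<and> length w \<le> N}" by (auto simp: dwords_def)
  then show ?thesis using D by (simp add: finite_lists_length_le)
qed

text \<open>For a hereditary configuration the event specifies the branch and the marks of the words with alive
  parent off the branch.  Completing the product by the words on the branch, which would have been kept
  with probability \<open>p\<close> each, turns it into the product for ordinary percolation.\<close>

lemma emeasure_model_atom:
  assumes s: "s \<in> lists D" "length s = N" and C: "C \<subseteq> dwords N" "[] \<in> C"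
    and her: "\<And>w d. w @ [d] \<in> C \<Longrightarrow> w \<in> C" and sC: "s \<in> C" and p: "0 < p" "p \<le> 1"
  shows "emeasure (model D p) {y \<in> space (model D p). spine y N = s \<and> {w \<in> dwords N. alive w y} = C} =
    ennreal ((\<Prod>w\<in>{w \<in> dwords N. w \<noteq> [] \<and> butlast w \<in> C}. pmf (bernoulli_pmf p) (w \<in> C)) / (card D * p) ^ N)"
proof -
  define U where "U = {w \<in> dwords N. w \<noteq> [] \<and> butlast w \<in> C \<and> \<not> prefix w s}"
  \<comment> \<open>The words off the branch carry the randomness, those on the branch are alive by construction.\<close>
  define V where "V = {w \<in> dwords N. w \<noteq> [] \<and> butlast w \<in> C \<and> prefix w s}"
  have fin: "finite U" "finite V" using finite_dwords by (auto simp: U_def V_def)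
  have preC: "w \<in> C" if "prefix w v" "v \<in> C" for w v
  proof -
    have "w @ u \<in> C \<Longrightarrow> w \<in> C" for u
      by (induction u rule: rev_induct) (auto dest: her simp flip: append_assoc)
    then show ?thesis using that by (auto simp: prefix_def)
  qed
  have V: "V = (\<lambda>i. take (Suc i) s) ` {..<N}"
  proof (intro set_eqI iffI)
    fix w assume "w \<in> V"
    then have w: "prefix w s" "w \<noteq> []" by (auto simp: V_def)
    then have "w = take (length w) s" by (auto simp: prefix_def)
    moreover have "length w \<le> N" using prefix_length_le[OF w(1)] s by simp
    moreover obtain i where "length w = Suc i" using w(2) by (cases w) auto
    ultimately have "w = take (Suc i) s" "i < N" by simp_all
    then show "w \<in> (\<lambda>i. take (Suc i) s) ` {..<N}" by blast
  next
    fix w assume "w \<in> (\<lambda>i. take (Suc i) s) ` {..<N}"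
    then obtain i where i: "w = take (Suc i) s" "i < N" by auto
    have "prefix (butlast w) s"
      using i s by (simp add: butlast_take take_is_prefix)
    then have "butlast w \<in> C" using preC sC by blast
    then show "w \<in> V"
      using i s by (auto simp: V_def dwords_def take_is_prefix dest: in_set_takeD)
  qed
  have cardV: "card V = N"
  proof -
    have "inj_on (\<lambda>i. take (Suc i) s) {..<N}"
    proof (rule inj_onI)
      fix i j assume ij: "i \<in> {..<N}" "j \<in> {..<N}" "take (Suc i) s = take (Suc j) s"
      have "length (take (Suc i) s) = length (take (Suc j) s)" by (simp only: ij(3))
      then show "i = j" using ij(1,2) s(2) by simp
    qed
    then show ?thesis unfolding V by (simp add: card_image)
  qed
  have eq': "{w \<in> dwords N. alive w y} = C \<longleftrightarrow> (\<forall>w\<in>U. kept w y = (w \<in> C))" if sp: "spine y N = s" for y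
  proof
    assume C': "{w \<in> dwords N. alive w y} = C"
    show "\<forall>w\<in>U. kept w y = (w \<in> C)"
    proof
      fix w assume w: "w \<in> U"
      then have "w \<noteq> []" by (simp add: U_def)
      then obtain v d where v: "w = v @ [d]" using rev_exhaust[of w] by blast
      have "alive v y" using w C' by (auto simp: U_def v)
      moreover have "w \<in> C \<longleftrightarrow> alive w y" using w C' by (auto simp: U_def)
      ultimately show "kept w y = (w \<in> C)" by (simp add: v alive_snoc)
    qed
  next
    assume bits: "\<forall>w\<in>U. kept w y = (w \<in> C)"
    have "w \<in> dwords N \<Longrightarrow> alive w y = (w \<in> C)" for w
    proof (induction w rule: rev_induct)
      case (snoc d w)
      have w: "w \<in> dwords N" using snoc.prems by (auto simp: dwords_def)
      show ?case
      proof (cases "w \<in> C")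
        case True
        show ?thesis
        proof (cases "prefix (w @ [d]) s")
          case True
          then have "w @ [d] = spine y (length (w @ [d]))"
            using prefix_length_le[OF True] s take_spine[of "length (w @ [d])" N y]
            by (auto simp: sp prefix_def)
          then have "alive (w @ [d]) y" using alive_spine by metis
          then show ?thesis using preC[OF True sC] by simp
        next
          case False
          then have "w @ [d] \<in> U" using snoc.prems \<open>w \<in> C\<close> by (simp add: U_def)
          then show ?thesis using bits snoc.IH[OF w] True by (simp add: alive_snoc)
        qed
      next
        case False
        then show ?thesis using snoc.IH[OF w] her[of w d] by (auto simp: alive_snoc)
      qed
    qed (simp add: C(2))
    then show "{w \<in> dwords N. alive w y} = C" using C(1) by blast
  qed
  have eq: "spine y N = s \<and> {w \<in> dwords N. alive w y} = C \<longleftrightarrow> spine y N = s \<and> (\<forall>w\<in>U. kept w y = (w \<in> C))" for y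
    using eq' by (rule conj_cong[OF refl])
  have cD: "0 < card D" using D by (simp add: card_gt_0_iff)
  have "emeasure (model D p) {y \<in> space (model D p). spine y N = s \<and> {w \<in> dwords N. alive w y} = C} =
    emeasure (model D p) {y \<in> space (model D p). spine y (length s) = s \<and> (\<forall>w\<in>U. kept w y = (w \<in> C))}"
    unfolding eq s(2) ..
  also have "\<dots> = ennreal (1 / card D) ^ length s * (\<Prod>w\<in>U. ennreal (pmf (bernoulli_pmf p) (w \<in> C)))"
    by (rule emeasure_model_bits[OF s(1) fin(1)]) (use s(2) in \<open>auto simp: U_def dwords_def\<close>)
  also have "\<dots> = ennreal ((1 / card D) ^ N * (\<Prod>w\<in>U. pmf (bernoulli_pmf p) (w \<in> C)))"
    by (simp add: s(2) prod_ennreal ennreal_power ennreal_mult prod_nonneg)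
  also have "(1 / card D) ^ N * (\<Prod>w\<in>U. pmf (bernoulli_pmf p) (w \<in> C)) =
      (\<Prod>w\<in>U \<union> V. pmf (bernoulli_pmf p) (w \<in> C)) / (card D * p) ^ N"
  proof -
    have "(\<Prod>w\<in>V. pmf (bernoulli_pmf p) (w \<in> C)) = (\<Prod>w\<in>V. p)"
      using p sC by (intro prod.cong refl) (auto simp: V_def dest: preC)
    also have "\<dots> = p ^ N" by (simp add: cardV)
    finally have "(\<Prod>w\<in>U \<union> V. pmf (bernoulli_pmf p) (w \<in> C)) = (\<Prod>w\<in>U. pmf (bernoulli_pmf p) (w \<in> C)) * p ^ N"
      using fin by (subst prod.union_disjoint) (auto simp: U_def V_def)
    then show ?thesis using p cD by (simp add: power_mult_distrib power_one_over field_simps)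
  qed
  also have "U \<union> V = {w \<in> dwords N. w \<noteq> [] \<and> butlast w \<in> C}" by (auto simp: U_def V_def)
  finally show ?thesis .
qed

end

section \<open>Cubes and digit addresses\<close>

text \<open>Testing the inclusion on the two extreme corners of the smaller cube reduces it to integer
  inequalities.\<close>

lemma closed_adic_cube_subset_iff:
  fixes a b :: "'m::finite \<Rightarrow> int"
  assumes k: "k > 0"
  shows "closed_adic_cube k (n + l) a \<subseteq> closed_adic_cube k n b \<longleftrightarrow>
    (\<forall>i. int k ^ l * b i \<le> a i \<and> a i + 1 \<le> int k ^ l * (b i + 1))"
proof -
  have kk: "0 < real k ^ n" "0 < real k ^ l" "0 < real k ^ (n + l)" using k by auto
  have le1: "real_of_int u / real k ^ n \<le> real_of_int v / real k ^ (n + l) \<longleftrightarrow> int k ^ l * u \<le> v" for u v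
  proof -
    have "real_of_int u / real k ^ n \<le> real_of_int v / real k ^ (n + l) \<longleftrightarrow> real k ^ l * real_of_int u \<le> real_of_int v"
      using kk by (simp add: field_simps power_add)
    also have "\<dots> \<longleftrightarrow> real_of_int (int k ^ l * u) \<le> real_of_int v" by simp
    finally show ?thesis by linarith
  qed
  have le2: "real_of_int v / real k ^ (n + l) \<le> real_of_int u / real k ^ n \<longleftrightarrow> v \<le> int k ^ l * u" for u v
  proof -
    have "real_of_int v / real k ^ (n + l) \<le> real_of_int u / real k ^ n \<longleftrightarrow> real_of_int v \<le> real k ^ l * real_of_int u"
      using kk by (simp add: field_simps power_add)
    also have "\<dots> \<longleftrightarrow> real_of_int v \<le> real_of_int (int k ^ l * u)" by simp
    finally show ?thesis by linarith
  qed
  show ?thesis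
  proof
    assume sub: "closed_adic_cube k (n + l) a \<subseteq> closed_adic_cube k n b"
    have "(\<chi> i. real_of_int (a i) / real k ^ (n + l)) \<in> closed_adic_cube k (n + l) a"
      "(\<chi> i. real_of_int (a i + 1) / real k ^ (n + l)) \<in> closed_adic_cube k (n + l) a"
      by (auto simp: closed_adic_cube_def divide_right_mono)
    then have "(\<chi> i. real_of_int (a i) / real k ^ (n + l)) \<in> closed_adic_cube k n b"
      "(\<chi> i. real_of_int (a i + 1) / real k ^ (n + l)) \<in> closed_adic_cube k n b"
      using sub by blast+
    then have "real_of_int (b i) / real k ^ n \<le> real_of_int (a i) / real k ^ (n + l)"
      "real_of_int (a i + 1) / real k ^ (n + l) \<le> real_of_int (b i + 1) / real k ^ n" for i
      by (auto simp: closed_adic_cube_def)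
    then show "\<forall>i. int k ^ l * b i \<le> a i \<and> a i + 1 \<le> int k ^ l * (b i + 1)"
      unfolding le1 le2 by blast
  next
    assume *: "\<forall>i. int k ^ l * b i \<le> a i \<and> a i + 1 \<le> int k ^ l * (b i + 1)"
    have "real_of_int (b i) / real k ^ n \<le> real_of_int (a i) / real k ^ (n + l)"
      "real_of_int (a i + 1) / real k ^ (n + l) \<le> real_of_int (b i + 1) / real k ^ n" for i
      unfolding le1 le2 using * by auto
    then show "closed_adic_cube k (n + l) a \<subseteq> closed_adic_cube k n b"
      unfolding closed_adic_cube_def by (auto intro: order_trans)
  qed
qed

lemma closed_adic_cube_inj:
  fixes a b :: "'m::finite \<Rightarrow> int"
  assumes k: "k > 0" and eq: "closed_adic_cube k n a = closed_adic_cube k n b"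
  shows "a = b"
proof
  fix i
  show "a i = b i"
    using closed_adic_cube_subset_iff[OF k, of n 0 a b] closed_adic_cube_subset_iff[OF k, of n 0 b a] eq
    by (auto intro: order_antisym)
qed

definition digits :: "nat \<Rightarrow> ('m::finite \<Rightarrow> int) set" where
  "digits k = {d. \<forall>i. 0 \<le> d i \<and> d i < int k}"

lemma card_digits: "finite (digits k :: ('m::finite \<Rightarrow> int) set)" "card (digits k :: ('m \<Rightarrow> int) set) = k ^ CARD('m)"
proof -
  have "digits k = (\<Pi>\<^sub>E i\<in>(UNIV :: 'm set). {0..<int k})"
    by (auto simp: digits_def PiE_def Pi_def)
  then show "finite (digits k :: ('m \<Rightarrow> int) set)" "card (digits k :: ('m \<Rightarrow> int) set) = k ^ CARD('m)"
    by (auto simp: finite_PiE card_PiE)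
qed

text \<open>The expansion in base \<open>k\<close>, in every coordinate, of the lower corner of the cube with address \<open>w\<close>,
  in multiples of its side length.\<close>

definition corner :: "nat \<Rightarrow> ('m::finite \<Rightarrow> int) list \<Rightarrow> 'm \<Rightarrow> int" where
  "corner k w = foldl (\<lambda>a d i. int k * a i + d i) (\<lambda>_. 0) w"

definition cube :: "nat \<Rightarrow> ('m::finite \<Rightarrow> int) list \<Rightarrow> (real ^ 'm) set" where
  "cube k w = closed_adic_cube k (length w) (corner k w)"

lemma corner_Nil [simp]: "corner k [] = (\<lambda>_. 0)"
  by (simp add: corner_def)

lemma corner_snoc [simp]: "corner k (w @ [d]) = (\<lambda>i. int k * corner k w i + d i)"
  by (simp add: corner_def)

lemma corner_append: "corner k (v @ w) i = int k ^ length w * corner k v i + corner k w i"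
proof (induction w rule: rev_induct)
  case (snoc d w)
  have "corner k (v @ w @ [d]) i = int k * corner k (v @ w) i + d i"
    using corner_snoc[of k "v @ w" d] by simp
  then show ?case using snoc by (simp add: algebra_simps)
qed simp

lemma corner_bounds:
  assumes "w \<in> lists (digits k)"
  shows "0 \<le> corner k w i \<and> corner k w i < int k ^ length w"
  using assms
proof (induction w rule: rev_induct)
  case (snoc d w)
  then have IH: "0 \<le> corner k w i" "corner k w i + 1 \<le> int k ^ length w" and d: "0 \<le> d i" "d i < int k"
    by (auto simp: digits_def)
  have "int k * corner k w i + d i < int k * (corner k w i + 1)" using d by (simp add: algebra_simps)
  also have "\<dots> \<le> int k * int k ^ length w" using IH by (intro mult_left_mono) auto
  finally show ?case using IH d by simp
qed simp

lemma corner_inj: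
  assumes "v \<in> lists (digits k)" "w \<in> lists (digits k)" "length v = length w" "corner k v = corner k w"
  shows "v = w"
  using assms
proof (induction v arbitrary: w rule: rev_induct)
  case (snoc d v)
  then obtain w' e where w: "w = w' @ [e]" by (metis length_0_conv rev_exhaust snoc_eq_iff_butlast)
  have de: "d \<in> digits k" "e \<in> digits k" using snoc.prems by (auto simp: w)
  have eq: "int k * corner k v i + d i = int k * corner k w' i + e i" for i
    using fun_cong[OF snoc.prems(4), of i] by (simp add: w)
  have "d i = e i \<and> corner k v i = corner k w' i" for i
  proof -
    have "d i = (int k * corner k v i + d i) mod int k" using de by (simp add: digits_def)
    moreover have "e i = (int k * corner k w' i + e i) mod int k" using de by (simp add: digits_def)
    ultimately have "d i = e i" using eq[of i] by simp
    moreover have "int k > 0" using de by (auto simp: digits_def)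
    ultimately show ?thesis using eq[of i] by simp
  qed
  then have "d = e" "corner k v = corner k w'" by auto
  then show ?case using snoc.IH[of w'] snoc.prems by (simp add: w)
qed simp

context mandelbrot
begin

lemma k_pos: "k > 0" using k by simp

lemma cube_system_child:
  assumes "\<sigma> \<in> fin_words k m"
  shows "bij_betw (\<lambda>j. J (\<sigma> @ [j])) (alphabet k m) {C. (\<exists>a. C = closed_adic_cube k (Suc (length \<sigma>)) a) \<and> C \<subseteq> J \<sigma>}"
  using cubes assms by (simp add: cube_system_def dim)

text \<open>The lower corner of \<open>J \<sigma>\<close> in multiples of its side length.\<close>

definition J_corner :: "nat list \<Rightarrow> 'm \<Rightarrow> int" where
  "J_corner \<sigma> = (THE a. J \<sigma> = closed_adic_cube k (length \<sigma>) a)"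

text \<open>The position of \<open>J \<sigma>\<close> inside the cube of the parent of \<open>\<sigma>\<close>.\<close>

definition digit :: "nat list \<Rightarrow> 'm \<Rightarrow> int" where
  "digit \<sigma> = (\<lambda>i. J_corner \<sigma> i mod int k)"

text \<open>The geometric address of \<open>\<sigma>\<close>.  Passing to addresses removes the dependence on the enumerations of the
  subcubes, which may be different at every vertex.\<close>

definition addr :: "nat list \<Rightarrow> ('m \<Rightarrow> int) list" where
  "addr \<sigma> = map (\<lambda>n. digit (take (Suc n) \<sigma>)) [0..<length \<sigma>]"

lemma J_eq_cube:
  assumes "\<sigma> \<in> fin_words k m"
  shows "J \<sigma> = closed_adic_cube k (length \<sigma>) (J_corner \<sigma>)"
proof -
  have "\<exists>a. J \<sigma> = closed_adic_cube k (length \<sigma>) a"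
    using assms
  proof (induction \<sigma> rule: rev_induct)
    case Nil
    have "J [] = closed_adic_cube k 0 (\<lambda>_. 0)"
      using cubes by (simp add: cube_system_def closed_adic_cube_def)
    then show ?case by auto
  next
    case (snoc j \<sigma>)
    then have "J (\<sigma> @ [j]) \<in> {C. (\<exists>a. C = closed_adic_cube k (Suc (length \<sigma>)) a) \<and> C \<subseteq> J \<sigma>}"
      using bij_betwE[OF cube_system_child[of \<sigma>]] by auto
    then show ?case by auto
  qed
  then obtain a where a: "J \<sigma> = closed_adic_cube k (length \<sigma>) a" ..
  have "J_corner \<sigma> = a"
    unfolding J_corner_def
  proof (rule the_equality)
    show "J \<sigma> = closed_adic_cube k (length \<sigma>) a" by (rule a)
    fix b assume "J \<sigma> = closed_adic_cube k (length \<sigma>) b"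
    then show "b = a" using a by (intro closed_adic_cube_inj[OF k_pos, of "length \<sigma>"]) simp
  qed
  then show ?thesis using a by simp
qed

lemma J_corner_Nil: "J_corner [] = (\<lambda>_. 0)"
proof (rule closed_adic_cube_inj[OF k_pos])
  show "closed_adic_cube k 0 (J_corner []) = closed_adic_cube k 0 (\<lambda>_. 0)"
    using J_eq_cube[of "[]"] cubes by (simp add: cube_system_def closed_adic_cube_def)
qed

lemma child_cube_iff:
  assumes \<sigma>: "\<sigma> \<in> fin_words k m"
  shows "closed_adic_cube k (Suc (length \<sigma>)) a \<subseteq> J \<sigma> \<longleftrightarrow> (\<lambda>i. a i - int k * J_corner \<sigma> i) \<in> digits k"
proof -
  have "int k ^ 1 * J_corner \<sigma> i \<le> a i \<and> a i + 1 \<le> int k ^ 1 * (J_corner \<sigma> i + 1) \<longleftrightarrow>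
    0 \<le> a i - int k * J_corner \<sigma> i \<and> a i - int k * J_corner \<sigma> i < int k" for i
    by (auto simp: distrib_left)
  then show ?thesis
    using closed_adic_cube_subset_iff[OF k_pos, of "length \<sigma>" 1 a "J_corner \<sigma>"]
    by (simp only: J_eq_cube[OF \<sigma>] digits_def mem_Collect_eq add_Suc_right One_nat_def add_0_right)
qed

lemma J_corner_snoc:
  assumes \<sigma>: "\<sigma> \<in> fin_words k m" and j: "j \<in> alphabet k m"
  shows "digit (\<sigma> @ [j]) \<in> digits k" "J_corner (\<sigma> @ [j]) = (\<lambda>i. int k * J_corner \<sigma> i + digit (\<sigma> @ [j]) i)"
proof -
  have "\<sigma> @ [j] \<in> fin_words k m" using \<sigma> j by auto
  from J_eq_cube[OF this] have "closed_adic_cube k (Suc (length \<sigma>)) (J_corner (\<sigma> @ [j])) = J (\<sigma> @ [j])" by simp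
  also have "\<dots> \<subseteq> J \<sigma>" using bij_betwE[OF cube_system_child[OF \<sigma>]] j by auto
  finally have d: "(\<lambda>i. J_corner (\<sigma> @ [j]) i - int k * J_corner \<sigma> i) \<in> digits k"
    unfolding child_cube_iff[OF \<sigma>] .
  have "J_corner (\<sigma> @ [j]) i mod int k = J_corner (\<sigma> @ [j]) i - int k * J_corner \<sigma> i" for i
  proof -
    have "J_corner (\<sigma> @ [j]) i mod int k = ((J_corner (\<sigma> @ [j]) i - int k * J_corner \<sigma> i) + int k * J_corner \<sigma> i) mod int k"
      by simp
    also have "\<dots> = (J_corner (\<sigma> @ [j]) i - int k * J_corner \<sigma> i) mod int k"
      by (rule mod_mult_self2)
    also have "\<dots> = J_corner (\<sigma> @ [j]) i - int k * J_corner \<sigma> i"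
      using d by (auto simp: digits_def)
    finally show ?thesis .
  qed
  then have dig: "digit (\<sigma> @ [j]) = (\<lambda>i. J_corner (\<sigma> @ [j]) i - int k * J_corner \<sigma> i)"
    by (simp add: digit_def fun_eq_iff)
  show "digit (\<sigma> @ [j]) \<in> digits k" unfolding dig by (rule d)
  show "J_corner (\<sigma> @ [j]) = (\<lambda>i. int k * J_corner \<sigma> i + digit (\<sigma> @ [j]) i)" by (simp add: dig)
qed

text \<open>Both the letters and the digit vectors enumerate the same set of subcubes.\<close>

lemma bij_digit:
  assumes \<sigma>: "\<sigma> \<in> fin_words k m"
  shows "bij_betw (\<lambda>j. digit (\<sigma> @ [j])) (alphabet k m) (digits k)"
proof -
  note bij = cube_system_child[OF \<sigma>]
  show ?thesis
    unfolding bij_betw_def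
  proof (intro conjI inj_onI equalityI subsetI)
    fix j j' assume j: "j \<in> alphabet k m" "j' \<in> alphabet k m" and eq: "digit (\<sigma> @ [j]) = digit (\<sigma> @ [j'])"
    have "\<sigma> @ [j] \<in> fin_words k m" "\<sigma> @ [j'] \<in> fin_words k m" using \<sigma> j by auto
    then have "J (\<sigma> @ [j]) = J (\<sigma> @ [j'])"
      using J_corner_snoc(2)[OF \<sigma> j(1)] J_corner_snoc(2)[OF \<sigma> j(2)] eq by (simp add: J_eq_cube)
    then show "j = j'" using bij_betw_imp_inj_on[OF bij] j by (auto dest: inj_onD)
  next
    fix d assume "d \<in> (\<lambda>j. digit (\<sigma> @ [j])) ` alphabet k m"
    then show "d \<in> digits k" using J_corner_snoc(1)[OF \<sigma>] by auto
  next
    fix d :: "'m \<Rightarrow> int" assume d: "d \<in> digits k"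
    define a where "a i = int k * J_corner \<sigma> i + d i" for i
    have "closed_adic_cube k (Suc (length \<sigma>)) a \<subseteq> J \<sigma>"
      unfolding child_cube_iff[OF \<sigma>] using d by (simp add: a_def)
    then have "closed_adic_cube k (Suc (length \<sigma>)) a \<in> (\<lambda>j. J (\<sigma> @ [j])) ` alphabet k m"
      using bij by (auto simp: bij_betw_def)
    then obtain j where j: "j \<in> alphabet k m" "closed_adic_cube k (Suc (length \<sigma>)) a = J (\<sigma> @ [j])" by auto
    have "\<sigma> @ [j] \<in> fin_words k m" using \<sigma> j by auto
    then have "a = J_corner (\<sigma> @ [j])"
      using j(2) J_eq_cube[of "\<sigma> @ [j]"] by (intro closed_adic_cube_inj[OF k_pos]) auto
    then have "digit (\<sigma> @ [j]) = d"
      using J_corner_snoc(2)[OF \<sigma> j(1)] by (simp add: a_def fun_eq_iff)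
    then show "d \<in> (\<lambda>j. digit (\<sigma> @ [j])) ` alphabet k m" using j(1) by blast
  qed
qed

lemma length_addr [simp]: "length (addr \<sigma>) = length \<sigma>"
  by (simp add: addr_def)

lemma addr_Nil [simp]: "addr [] = []"
  by (simp add: addr_def)

lemma addr_snoc: "addr (\<sigma> @ [j]) = addr \<sigma> @ [digit (\<sigma> @ [j])]"
  by (simp add: addr_def)

lemma addr_digits: "\<sigma> \<in> fin_words k m \<Longrightarrow> addr \<sigma> \<in> lists (digits k)"
  by (induction \<sigma> rule: rev_induct) (auto simp: addr_snoc J_corner_snoc)

lemma corner_addr: "\<sigma> \<in> fin_words k m \<Longrightarrow> corner k (addr \<sigma>) = J_corner \<sigma>"
  by (induction \<sigma> rule: rev_induct) (auto simp: addr_snoc J_corner_snoc(2) J_corner_Nil)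

lemma J_eq_cube_addr: "\<sigma> \<in> fin_words k m \<Longrightarrow> J \<sigma> = cube k (addr \<sigma>)"
  by (simp add: cube_def corner_addr J_eq_cube)

lemma bij_addr: "bij_betw addr (fin_words k m) (lists (digits k))"
  unfolding bij_betw_def
proof (intro conjI inj_onI equalityI subsetI)
  fix \<sigma> \<tau> assume "\<sigma> \<in> fin_words k m" "\<tau> \<in> fin_words k m" "addr \<sigma> = addr \<tau>"
  then show "\<sigma> = \<tau>"
  proof (induction \<sigma> arbitrary: \<tau> rule: rev_induct)
    case Nil
    then show ?case by (metis length_0_conv length_addr addr_Nil)
  next
    case (snoc j \<sigma>)
    have "length \<tau> = Suc (length \<sigma>)" using arg_cong[OF snoc.prems(3), of length] by simp
    then obtain \<tau>' j' where \<tau>: "\<tau> = \<tau>' @ [j']" by (metis length_Suc_conv_rev)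
    have *: "addr \<sigma> = addr \<tau>'" "digit (\<sigma> @ [j]) = digit (\<tau>' @ [j'])"
      using snoc.prems(3) by (auto simp: \<tau> addr_snoc)
    have w: "\<sigma> \<in> fin_words k m" "\<tau>' \<in> fin_words k m" "j \<in> alphabet k m" "j' \<in> alphabet k m"
      using snoc.prems by (auto simp: \<tau>)
    have "\<sigma> = \<tau>'" using snoc.IH[OF w(1,2) *(1)] .
    moreover from this have "j = j'"
      using *(2) bij_betw_imp_inj_on[OF bij_digit[OF w(1)]] w by (auto dest: inj_onD)
    ultimately show ?case by (simp add: \<tau>)
  qed
next
  fix w assume "w \<in> addr ` fin_words k m"
  then show "w \<in> lists (digits k)" using addr_digits by auto
next
  fix w assume "w \<in> lists (digits k :: ('m \<Rightarrow> int) set)"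
  then show "w \<in> addr ` fin_words k m"
  proof (induction w rule: rev_induct)
    case Nil
    then show ?case by (intro image_eqI[of _ _ "[]"]) auto
  next
    case (snoc d w)
    then obtain \<sigma> where \<sigma>: "\<sigma> \<in> fin_words k m" "w = addr \<sigma>" by auto
    have "d \<in> digits k" using snoc.prems by auto
    then obtain j where j: "j \<in> alphabet k m" "d = digit (\<sigma> @ [j])"
      using bij_betw_imp_surj_on[OF bij_digit[OF \<sigma>(1)]] by blast
    have "w @ [d] = addr (\<sigma> @ [j])" by (simp add: addr_snoc \<sigma> j)
    moreover have "\<sigma> @ [j] \<in> fin_words k m" using \<sigma> j by auto
    ultimately show ?case by blast
  qed
qed

lemma addr_butlast: "addr (butlast \<sigma>) = butlast (addr \<sigma>)"
  by (cases \<sigma> rule: rev_cases) (auto simp: addr_snoc)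

definition decode :: "('m \<Rightarrow> int) list \<Rightarrow> nat list" where
  "decode = the_inv_into (fin_words k m) addr"

lemma decode:
  assumes "w \<in> lists (digits k)"
  shows "decode w \<in> fin_words k m" "addr (decode w) = w" "length (decode w) = length w"
proof -
  show "decode w \<in> fin_words k m"
    unfolding decode_def using bij_betwE[OF bij_betw_the_inv_into[OF bij_addr]] assms by blast
  show a: "addr (decode w) = w"
    unfolding decode_def using f_the_inv_into_f_bij_betw[OF bij_addr] assms by blast
  show "length (decode w) = length w" using length_addr[of "decode w"] a by simp
qed

lemma decode_addr: "\<sigma> \<in> fin_words k m \<Longrightarrow> decode (addr \<sigma>) = \<sigma>"
  unfolding decode_def by (rule the_inv_into_f_f[OF bij_betw_imp_inj_on[OF bij_addr]])

abbreviation digit_set :: "('m \<Rightarrow> int) set" where "digit_set \<equiv> digits k"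

sublocale SM: spine_model digit_set p
proof
  show "finite digit_set" by (rule card_digits)
  have "(\<lambda>_. 0) \<in> digit_set" using k by (simp add: digits_def)
  then show "digit_set \<noteq> {}" by blast
qed

abbreviation R :: "('m \<Rightarrow> int) env measure" where "R \<equiv> model digit_set p"

section \<open>The size-biased measure is the law of the spine model\<close>

text \<open>The word of length \<open>n + 1\<close> whose address is the branch of the model ends with the letter number \<open>n\<close>.\<close>

definition branch :: "('m \<Rightarrow> int) env \<Rightarrow> nat \<Rightarrow> nat" where
  "branch y n = last (decode (spine y (Suc n)))"

definition states :: "('m \<Rightarrow> int) env \<Rightarrow> nat list \<Rightarrow> bool" where
  "states y = (\<lambda>\<sigma>\<in>fin_words k m. alive (addr \<sigma>) y)"

definition realise :: "('m \<Rightarrow> int) env \<Rightarrow> (nat \<Rightarrow> nat) \<times> (nat list \<Rightarrow> bool)" where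
  "realise y = (branch y, states y)"

lemma spine_digits: "y \<in> space R \<Longrightarrow> spine y n \<in> lists digit_set"
  by (auto simp: spine_def SM.space_model)

lemma prefix_branch:
  assumes y: "y \<in> space R"
  shows "map (branch y) [0..<n] = decode (spine y n)"
proof (induction n)
  case 0
  then show ?case using decode(3)[of "[]"] by (simp add: spine_def)
next
  case (Suc n)
  define \<sigma> where "\<sigma> = decode (spine y (Suc n))"
  have \<sigma>: "\<sigma> \<in> fin_words k m" "addr \<sigma> = spine y (Suc n)" "length \<sigma> = Suc n"
    using decode[OF spine_digits[OF y, of "Suc n"]] by (simp_all add: \<sigma>_def)
  then obtain \<tau> j where t: "\<sigma> = \<tau> @ [j]" by (metis length_Suc_conv_rev)
  have "addr \<tau> = spine y n" using \<sigma>(2) by (simp add: t addr_snoc spine_Suc)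
  moreover have "\<tau> \<in> fin_words k m" using \<sigma>(1) by (simp add: t)
  ultimately have "decode (spine y n) = \<tau>" using decode_addr by metis
  moreover have "branch y n = j" by (simp add: branch_def \<sigma>_def[symmetric] t)
  ultimately show ?case using Suc t by (simp add: \<sigma>_def[symmetric])
qed

lemma branch_in_space:
  assumes y: "y \<in> space R"
  shows "branch y \<in> space (inf_words k m)"
proof -
  have "branch y n \<in> alphabet k m" for n
  proof -
    have "map (branch y) [0..<Suc n] \<in> fin_words k m"
      using prefix_branch[OF y, of "Suc n"] decode(1)[OF spine_digits[OF y]] by simp
    then show ?thesis by simp
  qed
  then show ?thesis by (auto simp: inf_words_def space_PiM)
qed

lemma measurable_branch: "branch \<in> R \<rightarrow>\<^sub>M inf_words k m"
proof (rule measurable_inf_words[OF branch_in_space])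
  fix \<sigma> assume \<sigma>: "\<sigma> \<in> fin_words k m"
  have "branch y \<in> cylinder k m \<sigma> \<longleftrightarrow> spine y (length \<sigma>) = addr \<sigma>" if y: "y \<in> space R" for y
    using prefix_branch[OF y] branch_in_space[OF y] decode[OF spine_digits[OF y, of "length \<sigma>"]] decode_addr[OF \<sigma>]
    by (auto simp: cylinder_def)
  then have "{y \<in> space R. branch y \<in> cylinder k m \<sigma>} = {y \<in> space R. spine y (length \<sigma>) = addr \<sigma>}"
    by auto
  also have "\<dots> \<in> sets R" by measurable
  finally show "{y \<in> space R. branch y \<in> cylinder k m \<sigma>} \<in> sets R" .
qed

lemma measurable_states: "states \<in> R \<rightarrow>\<^sub>M P"
proof -
  have "states \<in> R \<rightarrow>\<^sub>M realisations k m"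
    unfolding states_def realisations_def by (rule measurable_restrict) measurable
  then show ?thesis by (subst measurable_cong_sets[OF refl sets_P])
qed

lemma measurable_realise [measurable]: "realise \<in> R \<rightarrow>\<^sub>M inf_words k m \<Otimes>\<^sub>M P"
  unfolding realise_def[abs_def] by (intro measurable_Pair measurable_branch measurable_states)

lemma prod_level_Suc: "(\<Prod>u\<in>level k m (Suc n). f u) = (\<Prod>\<sigma>\<in>level k m n. \<Prod>j\<in>alphabet k m. f (\<sigma> @ [j]))"
proof -
  have "(\<Prod>u\<in>level k m (Suc n). f u) = (\<Prod>(\<sigma>, j)\<in>level k m n \<times> alphabet k m. f (\<sigma> @ [j]))"
    unfolding level_Suc by (subst prod.reindex) (auto simp: inj_on_def case_prod_unfold)
  then show ?thesis by (simp add: prod.cartesian_product)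
qed

lemma pmf_chosen_law:
  assumes "C \<subseteq> words_upto k m n"
  shows "pmf (chosen_law n) C = of_bool ([] \<in> C) *
    (\<Prod>u\<in>words_upto k m n - {[]}. pmf (child_law p (butlast u \<in> C)) (u \<in> C))"
  using assms
proof (induction n arbitrary: C)
  case 0
  then have "C = {} \<or> C = {[]}" by (auto simp: words_upto_0)
  then show ?case by (auto simp: words_upto_0 pmf_return)
next
  case (Suc n)
  let ?f = "\<lambda>C u. pmf (child_law p (butlast u \<in> C)) (u \<in> C)"
  have sp: "words_upto k m (Suc n) - {[]} = (words_upto k m n - {[]}) \<union> level k m (Suc n)"
    by (auto simp: words_upto_Suc level_def)
  have disj: "(words_upto k m n - {[]}) \<inter> level k m (Suc n) = {}" by (auto simp: words_upto_def level_def)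
  have "(\<Prod>u\<in>words_upto k m n - {[]}. ?f (C \<inter> words_upto k m n) u) = (\<Prod>u\<in>words_upto k m n - {[]}. ?f C u)"
  proof (rule prod.cong[OF refl])
    fix u assume "u \<in> words_upto k m n - {[]}"
    moreover from this have "butlast u \<in> words_upto k m n" by (auto simp: words_upto_def dest: in_set_butlastD)
    ultimately show "?f (C \<inter> words_upto k m n) u = ?f C u" by simp
  qed
  moreover have "[] \<in> C \<inter> words_upto k m n \<longleftrightarrow> [] \<in> C" by (auto simp: words_upto_def)
  ultimately have "pmf (chosen_law (Suc n)) C = of_bool ([] \<in> C) * (\<Prod>u\<in>words_upto k m n - {[]}. ?f C u) *
      (\<Prod>u\<in>level k m (Suc n). ?f C u)"
    unfolding pmf_chosen_law_Suc[OF Suc.prems] prod_level_Suc by (subst Suc.IH) simp_all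
  also have "\<dots> = of_bool ([] \<in> C) * (\<Prod>u\<in>words_upto k m (Suc n) - {[]}. ?f C u)"
    unfolding sp using finite_level by (subst prod.union_disjoint[OF _ _ disj]) (simp_all add: mult.assoc)
  finally show ?case .
qed

lemma addr_words_upto: "addr ` words_upto k m n = SM.dwords n"
proof -
  have "addr ` words_upto k m n = {w \<in> addr ` fin_words k m. length w \<le> n}"
    by (auto simp: words_upto_def)
  then show ?thesis
    using bij_betw_imp_surj_on[OF bij_addr] by (simp add: SM.dwords_def)
qed

lemma history_realise:
  assumes y: "y \<in> space R" and \<sigma>: "\<sigma> \<in> level k m n" and C: "C \<subseteq> words_upto k m n"
  shows "history n (realise y) = (\<sigma>, C) \<longleftrightarrow> spine y n = addr \<sigma> \<and> {w \<in> SM.dwords n. alive w y} = addr ` C"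
proof -
  have \<sigma>': "\<sigma> \<in> fin_words k m" using \<sigma> by (simp add: level_def)
  have 1: "map (branch y) [0..<n] = \<sigma> \<longleftrightarrow> spine y n = addr \<sigma>"
    using prefix_branch[OF y] decode[OF spine_digits[OF y, of n]] decode_addr[OF \<sigma>'] by metis
  have W: "words_upto k m n \<subseteq> fin_words k m" by (auto simp: words_upto_def)
  have "chosen k m n (states y) = {\<tau> \<in> words_upto k m n. alive (addr \<tau>) y}"
    using W by (auto simp: chosen_def states_def)
  moreover have "{w \<in> SM.dwords n. alive w y} = addr ` {\<tau> \<in> words_upto k m n. alive (addr \<tau>) y}"
    unfolding addr_words_upto[symmetric] by auto
  moreover have "addr ` A = addr ` B \<longleftrightarrow> A = B" if "A \<subseteq> words_upto k m n" "B \<subseteq> words_upto k m n" for A B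
    using inj_on_image_eq_iff[OF bij_betw_imp_inj_on[OF bij_addr]] that W by (meson order_trans)
  ultimately have 2: "chosen k m n (states y) = C \<longleftrightarrow> {w \<in> SM.dwords n. alive w y} = addr ` C"
    using C by simp
  show ?thesis unfolding history_def realise_def by (simp add: 1 2)
qed

text \<open>A word whose parent is not chosen is not chosen with probability one, so it contributes the factor
  one.\<close>

lemma pmf_chosen_law_hereditary:
  assumes C: "C \<subseteq> words_upto k m n" "[] \<in> C" and her: "\<And>u j. u @ [j] \<in> C \<Longrightarrow> u \<in> C"
  shows "pmf (chosen_law n) C =
    (\<Prod>w\<in>{w \<in> SM.dwords n. w \<noteq> [] \<and> butlast w \<in> addr ` C}. pmf (bernoulli_pmf p) (w \<in> addr ` C))"
proof -
  have W: "words_upto k m n \<subseteq> fin_words k m" by (auto simp: words_upto_def)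
  have mem: "addr u \<in> addr ` C \<longleftrightarrow> u \<in> C" if "u \<in> fin_words k m" for u
    by (rule inj_on_image_mem_iff[OF bij_betw_imp_inj_on[OF bij_addr] that subset_trans[OF C(1) W]])
  have "pmf (chosen_law n) C = (\<Prod>u\<in>words_upto k m n - {[]}. pmf (child_law p (butlast u \<in> C)) (u \<in> C))"
    using C by (simp add: pmf_chosen_law)
  also have "\<dots> = (\<Prod>u\<in>{u \<in> words_upto k m n. u \<noteq> [] \<and> butlast u \<in> C}. pmf (bernoulli_pmf p) (u \<in> C))"
  proof (rule prod.mono_neutral_cong_right)
    show "\<forall>u\<in>words_upto k m n - {[]} - {u \<in> words_upto k m n. u \<noteq> [] \<and> butlast u \<in> C}.
        pmf (child_law p (butlast u \<in> C)) (u \<in> C) = 1"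
    proof
      fix u assume u: "u \<in> words_upto k m n - {[]} - {u \<in> words_upto k m n. u \<noteq> [] \<and> butlast u \<in> C}"
      then have "butlast u \<notin> C" "u \<noteq> []" by auto
      moreover from this have "u \<notin> C" using her[of "butlast u" "last u"] by auto
      ultimately show "pmf (child_law p (butlast u \<in> C)) (u \<in> C) = 1" by (simp add: child_law_def)
    qed
  qed (auto simp: child_law_def)
  also have "\<dots> = (\<Prod>w\<in>addr ` {u \<in> words_upto k m n. u \<noteq> [] \<and> butlast u \<in> C}. pmf (bernoulli_pmf p) (w \<in> addr ` C))"
  proof (subst prod.reindex)
    show "inj_on addr {u \<in> words_upto k m n. u \<noteq> [] \<and> butlast u \<in> C}"
      using W by (intro inj_on_subset[OF bij_betw_imp_inj_on[OF bij_addr]]) auto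
  qed (auto intro!: prod.cong simp: mem[OF subsetD[OF W]])
  also have "addr ` {u \<in> words_upto k m n. u \<noteq> [] \<and> butlast u \<in> C} = {w \<in> SM.dwords n. w \<noteq> [] \<and> butlast w \<in> addr ` C}"
  proof -
    have "addr u \<noteq> [] \<longleftrightarrow> u \<noteq> []" for u by (metis length_0_conv length_addr)
    moreover have "butlast (addr u) \<in> addr ` C \<longleftrightarrow> butlast u \<in> C" if "u \<in> words_upto k m n" for u
      using mem[of "butlast u"] that W by (auto simp: addr_butlast words_upto_def dest: in_set_butlastD)
    ultimately show ?thesis unfolding addr_words_upto[symmetric] by auto
  qed
  finally show ?thesis .
qed

text \<open>A configuration that lacks the empty word, that contains a word but not its parent, or that omits the
  branch has probability zero on both sides; all others are hereditary.\<close>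

lemma emeasure_realise_atom:
  assumes \<sigma>: "\<sigma> \<in> level k m n" and C: "C \<subseteq> words_upto k m n"
  shows "emeasure R {y \<in> space R. history n (realise y) = (\<sigma>, C)} = ennreal (of_bool (\<sigma> \<in> C) * pmf (chosen_law n) C / growth ^ n)"
proof -
  let ?E = "{y \<in> space R. spine y n = addr \<sigma> \<and> {w \<in> SM.dwords n. alive w y} = addr ` C}"
  have \<sigma>': "\<sigma> \<in> fin_words k m" "length \<sigma> = n" using \<sigma> by (auto simp: level_def)
  have W: "words_upto k m n \<subseteq> fin_words k m" by (auto simp: words_upto_def)
  have mem: "addr u \<in> addr ` C \<longleftrightarrow> u \<in> C" if "u \<in> fin_words k m" for u
    by (rule inj_on_image_mem_iff[OF bij_betw_imp_inj_on[OF bij_addr] that subset_trans[OF C W]])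
  have E: "{y \<in> space R. history n (realise y) = (\<sigma>, C)} = ?E"
    using history_realise[OF _ \<sigma> C] by auto
  have cD: "real (card digit_set) * p = growth"
    by (simp add: card_digits growth_def dim[symmetric])
  consider "[] \<in> C \<and> (\<forall>u j. u @ [j] \<in> C \<longrightarrow> u \<in> C) \<and> \<sigma> \<in> C" | "[] \<notin> C" | u j where "u @ [j] \<in> C" "u \<notin> C" | "\<sigma> \<notin> C"
    by blast
  then show ?thesis
  proof cases
    case 1
    have "emeasure R ?E = ennreal ((\<Prod>w\<in>{w \<in> SM.dwords n. w \<noteq> [] \<and> butlast w \<in> addr ` C}.
        pmf (bernoulli_pmf p) (w \<in> addr ` C)) / (real (card digit_set) * p) ^ n)"
    proof (rule SM.emeasure_model_atom)
      show "addr \<sigma> \<in> lists digit_set" by (rule addr_digits[OF \<sigma>'(1)])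
      show "addr ` C \<subseteq> SM.dwords n" unfolding addr_words_upto[symmetric] using C by blast
      show "[] \<in> addr ` C" using 1 by (intro image_eqI[of _ _ "[]"]) auto
      show "addr \<sigma> \<in> addr ` C" using 1 by blast
      show "length (addr \<sigma>) = n" using \<sigma>'(2) by simp
      show "0 < p" "p \<le> 1" by (rule p_pos, rule p(2))
      fix w d assume "w @ [d] \<in> addr ` C"
      then obtain u where u: "w @ [d] = addr u" "u \<in> C" by auto
      have "length u = length (w @ [d])" unfolding u(1) by simp
      then have "length u = Suc (length w)" by simp
      then obtain v j where v: "u = v @ [j]" by (metis length_Suc_conv_rev)
      have "w = addr v" using u(1) by (simp add: v addr_snoc)
      moreover have "v \<in> C" using 1 u(2) v by blast
      ultimately show "w \<in> addr ` C" by blast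
    qed
    moreover have "of_bool (\<sigma> \<in> C) * pmf (chosen_law n) C = (\<Prod>w\<in>{w \<in> SM.dwords n. w \<noteq> [] \<and> butlast w \<in> addr ` C}.
        pmf (bernoulli_pmf p) (w \<in> addr ` C))"
      using 1 by (subst pmf_chosen_law_hereditary[OF C]) (blast, blast, simp)
    ultimately show ?thesis
      unfolding E cD by simp
  next
    case 2
    have "[] \<in> SM.dwords n" by (simp add: SM.dwords_def)
    moreover have "[] \<notin> addr ` C" using mem[of "[]"] 2 by simp
    ultimately have e: "?E = {}" by auto
    show ?thesis unfolding E e using 2 by (simp add: pmf_chosen_law[OF C])
  next
    case 3
    have uj: "u @ [j] \<in> words_upto k m n" using 3 C by blast
    then have u: "u \<in> words_upto k m n" "u \<in> fin_words k m" "u @ [j] \<in> fin_words k m" by (auto simp: words_upto_def)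
    have e: "?E = {}"
    proof (rule equals0I)
      fix y assume "y \<in> ?E"
      then have eq: "{w \<in> SM.dwords n. alive w y} = addr ` C" by simp
      have "addr (u @ [j]) \<in> addr ` C" using 3 by blast
      then have "alive (addr (u @ [j])) y" unfolding eq[symmetric] by simp
      then have "alive (addr u) y" by (simp add: addr_snoc alive_snoc)
      moreover have "addr u \<in> SM.dwords n" using u(1) addr_words_upto by blast
      ultimately have "addr u \<in> addr ` C" unfolding eq[symmetric] by simp
      then show False using mem[OF u(2)] 3 by simp
    qed
    have z: "(\<Prod>u\<in>words_upto k m n - {[]}. pmf (child_law p (butlast u \<in> C)) (u \<in> C)) = 0"
      using uj 3 by (intro prod_zero bexI[of _ "u @ [j]"]) (auto simp: child_law_def)
    show ?thesis unfolding E e pmf_chosen_law[OF C] z by simp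
  next
    case 4
    have e: "?E = {}"
    proof (rule equals0I)
      fix y assume y: "y \<in> ?E"
      then have "alive (addr \<sigma>) y" using alive_spine[of y n] by simp
      moreover have "addr \<sigma> \<in> SM.dwords n" using addr_digits[OF \<sigma>'(1)] \<sigma>' by (simp add: SM.dwords_def)
      ultimately have "addr \<sigma> \<in> addr ` C" using y by auto
      then show False using mem[OF \<sigma>'(1)] 4 by simp
    qed
    show ?thesis unfolding E e using 4 by simp
  qed
qed

text \<open>The spine decomposition of the size-biased measure: both measures give the same mass to every atom of
  every generation.\<close>

lemma Q_eq_distr_model: "Q = distr R (inf_words k m \<Otimes>\<^sub>M P) realise"
proof (rule measure_eq_Q)
  show "prob_space (distr R (inf_words k m \<Otimes>\<^sub>M P) realise)"
    by (rule prob_space.prob_space_distr[OF SM.prob_space_model measurable_realise])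
  fix n \<sigma> C assume *: "\<sigma> \<in> level k m n" "C \<subseteq> words_upto k m n"
  have "realise -` (history n -` {(\<sigma>, C)} \<inter> space (inf_words k m \<Otimes>\<^sub>M P)) \<inter> space R = {y \<in> space R. history n (realise y) = (\<sigma>, C)}"
    using measurable_space[OF measurable_realise] by auto
  then show "emeasure (distr R (inf_words k m \<Otimes>\<^sub>M P) realise) (history n -` {(\<sigma>, C)} \<inter> space (inf_words k m \<Otimes>\<^sub>M P)) =
      ennreal (of_bool (\<sigma> \<in> C) * pmf (chosen_law n) C / growth ^ n)"
    using emeasure_realise_atom[OF *] by (simp add: emeasure_distr[OF measurable_realise history_atom_sets] del: vimage_Int)
qed simp

end

section \<open>Holes as a compactness property\<close>

text \<open>A closed ball that misses a decreasing intersection of compact sets misses one of the sets.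
  Conversely, the centres of slightly smaller balls accumulate at the centre of a suitable open ball.
  The right-hand side involves countably many conditions, each on a single set, which makes hole events
  measurable.\<close>

lemma hole_iff_finite_level:
  fixes L :: "nat \<Rightarrow> (real ^ 'm) set"
  assumes Z: "compact Z" and L: "\<And>i. compact (L i)" and dec: "\<And>i. L (Suc i) \<subseteq> L i"
  shows "(\<exists>z\<in>Z. max_ball z r \<inter> (\<Inter>i. L i) = {}) \<longleftrightarrow>
    (\<forall>s. \<exists>i. \<exists>z\<in>Z. {y. infnorm (y - z) \<le> r - 1 / real (Suc s)} \<inter> L i = {})" (is "?A \<longleftrightarrow> ?B")
proof
  assume ?A
  then obtain z where z: "z \<in> Z" "max_ball z r \<inter> (\<Inter>i. L i) = {}" by blast
  show ?B
  proof
    fix s :: nat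
    define C where "C = {y. infnorm (y - z) \<le> r - 1 / real (Suc s)}"
    have "closed C"
      unfolding C_def by (intro closed_Collect_le continuous_intros)
    have "\<exists>i. C \<inter> L i = {}"
    proof (rule ccontr)
      assume ne: "\<nexists>i. C \<inter> L i = {}"
      have "(\<Inter>i. C \<inter> L i) \<noteq> {}"
      proof (rule compact_nest)
        show "compact (C \<inter> L n)" for n using \<open>closed C\<close> L by (rule closed_Int_compact)
        show "C \<inter> L n \<noteq> {}" for n using ne by blast
        show "m \<le> n \<Longrightarrow> C \<inter> L n \<subseteq> C \<inter> L m" for m n
          using lift_Suc_antimono_le[of L m n, OF dec] by blast
      qed
      then obtain x where x: "x \<in> C" "\<And>i. x \<in> L i" by blast
      have "x \<in> max_ball z r"
        using x(1) divide_pos_pos[of 1 "real (Suc s)"] unfolding max_ball_def C_def mem_Collect_eq by linarith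
      then show False using z x(2) by blast
    qed
    then show "\<exists>i. \<exists>z\<in>Z. {y. infnorm (y - z) \<le> r - 1 / real (Suc s)} \<inter> L i = {}"
      using z(1) unfolding C_def by blast
  qed
next
  assume B: ?B
  then have "\<forall>s. \<exists>z\<in>Z. \<exists>i. {y. infnorm (y - z) \<le> r - 1 / real (Suc s)} \<inter> L i = {}" by blast
  then obtain w i where w: "\<And>s. w s \<in> Z" "\<And>s. {y. infnorm (y - w s) \<le> r - 1 / real (Suc s)} \<inter> L (i s) = {}"
    by metis
  obtain z h where z: "z \<in> Z" and h: "strict_mono h" and lim: "(w \<circ> h) \<longlonglongrightarrow> z"
    using Z w(1) unfolding compact_def by blast
  have "max_ball z r \<inter> (\<Inter>i. L i) = {}"
  proof (rule ccontr)
    assume "max_ball z r \<inter> (\<Inter>i. L i) \<noteq> {}"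
    then obtain x where x: "infnorm (x - z) < r" "\<And>i. x \<in> L i" by (auto simp: max_ball_def)
    have 1: "(\<lambda>n. infnorm (x - w (h n)) + 1 / real (Suc (h n))) \<longlonglongrightarrow> infnorm (x - z) + 0"
    proof (rule tendsto_add)
      show "(\<lambda>n. infnorm (x - w (h n))) \<longlonglongrightarrow> infnorm (x - z)"
        using lim by (intro tendsto_infnorm tendsto_diff tendsto_const) (simp add: o_def)
      show "(\<lambda>n. 1 / real (Suc (h n))) \<longlonglongrightarrow> 0"
        using LIMSEQ_subseq_LIMSEQ[OF lim_inverse_n'[THEN LIMSEQ_Suc] h] by (simp add: o_def)
    qed
    have "eventually (\<lambda>n. infnorm (x - w (h n)) + 1 / real (Suc (h n)) < r) sequentially"
      by (rule order_tendstoD(2)[OF 1]) (use x in simp)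
    then obtain n where "infnorm (x - w (h n)) + 1 / real (Suc (h n)) < r"
      by (auto simp: eventually_sequentially)
    then have "x \<in> {y. infnorm (y - w (h n)) \<le> r - 1 / real (Suc (h n))} \<inter> L (i (h n))"
      using x(2) by auto
    then show False using w(2) by blast
  qed
  then show ?A using z by blast
qed

lemma measurable_hole:
  fixes L :: "nat \<Rightarrow> 'x \<Rightarrow> (real ^ 'm) set"
  assumes Z: "compact Z" and L: "\<And>i x. x \<in> space M \<Longrightarrow> compact (L i x)"
    and dec: "\<And>i x. x \<in> space M \<Longrightarrow> L (Suc i) x \<subseteq> L i x"
    and meas: "\<And>i. L i \<in> M \<rightarrow>\<^sub>M count_space UNIV"
  shows "Measurable.pred M (\<lambda>x. \<exists>z\<in>Z. max_ball z r \<inter> (\<Inter>i. L i x) = {})"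
proof -
  have [measurable]: "Measurable.pred M (\<lambda>x. \<exists>z\<in>Z. {y. infnorm (y - z) \<le> r - 1 / real (Suc s)} \<inter> L i x = {})" for s i
    by (rule measurable_compose[OF meas]) simp
  have "Measurable.pred M (\<lambda>x. \<forall>s. \<exists>i. \<exists>z\<in>Z. {y. infnorm (y - z) \<le> r - 1 / real (Suc s)} \<inter> L i x = {})"
    by measurable
  also have "?this \<longleftrightarrow> ?thesis"
    by (intro measurable_cong hole_iff_finite_level[OF Z, symmetric] L dec)
  finally show ?thesis .
qed
lemma infnorm_less_iff_cart:
  fixes x :: "real ^ 'm"
  shows "infnorm x < r \<longleftrightarrow> (\<forall>i. \<bar>x $ i\<bar> < r)"
proof
  assume "infnorm x < r"
  then show "\<forall>i. \<bar>x $ i\<bar> < r" using component_le_infnorm_cart[of x] by (auto intro: le_less_trans)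
next
  assume *: "\<forall>i. \<bar>x $ i\<bar> < r"
  have "{\<bar>x $ i\<bar> |i. i \<in> UNIV} = range (\<lambda>i. \<bar>x $ i\<bar>)" by auto
  then have "infnorm x = Max (range (\<lambda>i. \<bar>x $ i\<bar>))"
    unfolding infnorm_cart by (simp add: cSup_eq_Max)
  also have "\<dots> < r" using * by simp
  finally show "infnorm x < r" .
qed

lemma mem_max_ball: "y \<in> max_ball z r \<longleftrightarrow> (\<forall>i. \<bar>y $ i - z $ i\<bar> < r)"
  by (simp add: max_ball_def infnorm_less_iff_cart)

text \<open>The centres of the balls of radius \<open>r\<close> contained in a half-open cube; unlike the cube, a compact set.\<close>

definition centres :: "nat \<Rightarrow> nat \<Rightarrow> ('m::finite \<Rightarrow> int) \<Rightarrow> real \<Rightarrow> (real ^ 'm) set" where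
  "centres k j a r = {z. \<forall>i. real_of_int (a i) / real k ^ j + r \<le> z $ i \<and> z $ i \<le> (real_of_int (a i) + 1) / real k ^ j - r}"

lemma compact_centres: "compact (centres k j a r)"
proof -
  have "centres k j a r = cbox (\<chi> i. real_of_int (a i) / real k ^ j + r) (\<chi> i. (real_of_int (a i) + 1) / real k ^ j - r)"
    by (auto simp: centres_def mem_box_cart)
  then show ?thesis by simp
qed

lemma compact_closed_adic_cube: "compact (closed_adic_cube k j a)"
proof -
  have "closed_adic_cube k j a = cbox (\<chi> i. real_of_int (a i) / real k ^ j) (\<chi> i. (real_of_int (a i) + 1) / real k ^ j)"
    by (auto simp: closed_adic_cube_def mem_box_cart)
  then show ?thesis by simp
qed

text \<open>An open ball does not reach the upper faces, so its containment in the half-open cube is a closed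
  condition on its centre.\<close>

lemma ball_in_cube_iff:
  assumes r: "r > 0"
  shows "z \<in> half_open_adic_cube k j a \<and> max_ball z r \<subseteq> half_open_adic_cube k j a - A \<longleftrightarrow>
    z \<in> centres k j a r \<and> max_ball z r \<inter> A = {}"
proof -
  define lo hi where "lo i = real_of_int (a i) / real k ^ j" and "hi i = (real_of_int (a i) + 1) / real k ^ j" for i
  have h: "x \<in> half_open_adic_cube k j a \<longleftrightarrow> (\<forall>i. lo i \<le> x $ i \<and> x $ i < hi i)" for x
    by (simp add: half_open_adic_cube_def lo_def hi_def)
  have c: "x \<in> centres k j a r \<longleftrightarrow> (\<forall>i. lo i + r \<le> x $ i \<and> x $ i \<le> hi i - r)" for x
    by (simp add: centres_def lo_def hi_def)
  have "z \<in> half_open_adic_cube k j a \<and> max_ball z r \<subseteq> half_open_adic_cube k j a \<longleftrightarrow> z \<in> centres k j a r"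
  proof
    assume *: "z \<in> half_open_adic_cube k j a \<and> max_ball z r \<subseteq> half_open_adic_cube k j a"
    have "lo i \<le> z $ i + t \<and> z $ i + t < hi i" if t: "\<bar>t\<bar> < r" for i t
    proof -
      have "z + axis i t \<in> max_ball z r" using t r by (auto simp: mem_max_ball axis_def)
      then have "z + axis i t \<in> half_open_adic_cube k j a" using * by blast
      then have "lo i \<le> (z + axis i t) $ i \<and> (z + axis i t) $ i < hi i" unfolding h by blast
      then show ?thesis by (simp add: axis_def)
    qed
    note t = this
    have "z $ i + r \<le> hi i" for i
    proof (rule dense_le_bounded[of "z $ i"])
      fix w assume "z $ i < w" "w < z $ i + r"
      then show "w \<le> hi i" using t[of "w - z $ i" i] by simp
    qed (use r in simp)
    moreover have "lo i \<le> z $ i - r" for i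
    proof (rule dense_ge_bounded[of _ "z $ i"])
      fix w assume "z $ i - r < w" "w < z $ i"
      then show "lo i \<le> w" using t[of "w - z $ i" i] by simp
    qed (use r in simp)
    ultimately show "z \<in> centres k j a r" unfolding c by (metis add_le_cancel_right diff_add_cancel)
  next
    assume z: "z \<in> centres k j a r"
    have "lo i \<le> y $ i \<and> y $ i < hi i" if "y \<in> max_ball z r" for y i
    proof -
      have "\<bar>y $ i - z $ i\<bar> < r" using that by (simp add: mem_max_ball)
      moreover have "lo i + r \<le> z $ i" "z $ i \<le> hi i - r" using z unfolding c by auto
      ultimately show ?thesis by linarith
    qed
    moreover have "z \<in> max_ball z r" using r by (simp add: mem_max_ball)
    ultimately show "z \<in> half_open_adic_cube k j a \<and> max_ball z r \<subseteq> half_open_adic_cube k j a"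
      unfolding subset_eq h by blast
  qed
  then show ?thesis by blast
qed

lemma has_hole_iff:
  assumes k: "k > 0" and "\<alpha> > 0"
  shows "has_hole k A \<alpha> j x \<longleftrightarrow>
    (\<exists>z\<in>centres k j (\<lambda>i. \<lfloor>x $ i * real k ^ j\<rfloor>) (\<alpha> / 2 / real k ^ j). max_ball z (\<alpha> / 2 / real k ^ j) \<inter> A = {})"
proof -
  have r: "1/2 * \<alpha> / real k ^ j = \<alpha> / 2 / real k ^ j" by simp
  have "\<alpha> / 2 / real k ^ j > 0" using assms by simp
  from ball_in_cube_iff[OF this, of _ k j "\<lambda>i. \<lfloor>x $ i * real k ^ j\<rfloor>" A] show ?thesis
    unfolding has_hole_def adic_cube_at_def r Bex_def by (metis (no_types, lifting))
qed

lemma max_ball_mono: "r \<le> s \<Longrightarrow> max_ball z r \<subseteq> max_ball z s"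
  by (auto simp: max_ball_def)

lemma has_hole_antimono:
  assumes "\<alpha> \<le> \<beta>" "has_hole k A \<beta> j x" shows "has_hole k A \<alpha> j x"
proof -
  have "1/2 * \<alpha> / real k ^ j \<le> 1/2 * \<beta> / real k ^ j" using assms(1) by (simp add: divide_right_mono)
  then show ?thesis using assms(2) max_ball_mono unfolding has_hole_def by (meson subset_trans)
qed

lemma hole_count_antimono: "\<alpha> \<le> \<beta> \<Longrightarrow> hole_count k A x \<beta> N \<le> hole_count k A x \<alpha> N"
  unfolding hole_count_def by (intro card_mono) (auto intro: has_hole_antimono)

lemma hole_count_sum: "real (hole_count k A x \<alpha> N) = (\<Sum>j=1..N. of_bool (has_hole k A \<alpha> j x))"
  by (simp add: hole_count_def Int_def conj_commute)

section \<open>Self-similarity of the cubes\<close>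

lemma cube_append_subset:
  assumes k: "k > 0" and w: "w \<in> lists (digits k)"
  shows "cube k (v @ w) \<subseteq> cube k v"
proof -
  have "int k ^ length w * corner k v i \<le> corner k (v @ w) i \<and> corner k (v @ w) i + 1 \<le> int k ^ length w * (corner k v i + 1)" for i
    using corner_bounds[OF w, of i] by (simp add: corner_append distrib_left)
  then show ?thesis
    unfolding cube_def length_append closed_adic_cube_subset_iff[OF k] by blast
qed

text \<open>The similarity that maps the unit cube onto the cube with address \<open>s\<close>.\<close>

definition zoom :: "nat \<Rightarrow> ('m::finite \<Rightarrow> int) list \<Rightarrow> real ^ 'm \<Rightarrow> real ^ 'm" where
  "zoom k s x = (\<chi> i. (x $ i + real_of_int (corner k s i)) / real k ^ length s)"

lemma zoom_surj:
  assumes "k > 0"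
  obtains x where "z = zoom k s x"
proof
  show "z = zoom k s (\<chi> i. z $ i * real k ^ length s - real_of_int (corner k s i))"
    using assms by (simp add: zoom_def vec_eq_iff)
qed

lemma zoom_cube:
  assumes k: "k > 0"
  shows "zoom k s x \<in> cube k (s @ w) \<longleftrightarrow> x \<in> cube k w"
proof -
  have pos: "0 < real k ^ length s" "0 < real k ^ length w" using k by auto
  have "real_of_int (corner k (s @ w) i) / real k ^ length (s @ w) = (real_of_int (corner k w i) / real k ^ length w + real_of_int (corner k s i)) / real k ^ length s"
    "(real_of_int (corner k (s @ w) i) + 1) / real k ^ length (s @ w) = ((real_of_int (corner k w i) + 1) / real k ^ length w + real_of_int (corner k s i)) / real k ^ length s" for i
    using pos by (simp_all add: corner_append power_add field_simps)
  then show ?thesis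
    using pos by (simp add: cube_def closed_adic_cube_def zoom_def divide_le_cancel)
qed

lemma zoom_centres:
  assumes k: "k > 0"
  shows "zoom k s z \<in> centres k (length s) (corner k s) (r / real k ^ length s) \<longleftrightarrow> z \<in> centres k 0 (\<lambda>_. 0) r"
proof -
  have pos: "0 < real k ^ length s" using k by auto
  have "real_of_int (corner k s i) / real k ^ length s + r / real k ^ length s = (r + real_of_int (corner k s i)) / real k ^ length s"
    "(real_of_int (corner k s i) + 1) / real k ^ length s - r / real k ^ length s = ((1 - r) + real_of_int (corner k s i)) / real k ^ length s" for i
    by (simp_all add: add_divide_distrib[symmetric] diff_divide_distrib[symmetric] algebra_simps)
  then show ?thesis
    using pos by (simp add: centres_def zoom_def divide_le_cancel)
qed

lemma zoom_ball:
  assumes k: "k > 0"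
  shows "zoom k s x \<in> max_ball (zoom k s z) (r / real k ^ length s) \<longleftrightarrow> x \<in> max_ball z r"
proof -
  have pos: "0 < real k ^ length s" using k by auto
  have "zoom k s x $ i - zoom k s z $ i = (x $ i - z $ i) / real k ^ length s" for i
    by (simp add: zoom_def diff_divide_distrib[symmetric])
  then show ?thesis using pos by (simp add: mem_max_ball divide_less_cancel)
qed

text \<open>The interior of a cube meets no other cube of the same generation.\<close>

lemma zoom_interior_unique:
  assumes k: "k > 0" and s: "s \<in> lists (digits k)" and v: "v \<in> lists (digits k)" "length v = length s"
    and x: "\<And>i. 0 < x $ i \<and> x $ i < 1" and mem: "zoom k s x \<in> cube k v"
  shows "v = s"
proof (rule corner_inj[OF v(1) s v(2)])
  show "corner k v = corner k s"
  proof
    fix i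
    have pos: "0 < real k ^ length s" using k by auto
    have "real_of_int (corner k v i) \<le> x $ i + real_of_int (corner k s i)"
      "x $ i + real_of_int (corner k s i) \<le> real_of_int (corner k v i) + 1"
      using mem v(2) pos by (auto simp: cube_def closed_adic_cube_def zoom_def divide_le_cancel)
    then show "corner k v i = corner k s i" using x[of i] by linarith
  qed
qed

section \<open>Holes seen from the spine\<close>

context mandelbrot
begin

definition stage :: "('m \<Rightarrow> int) env \<Rightarrow> nat \<Rightarrow> (real ^ 'm) set" where
  "stage y i = (\<Union>w\<in>{w \<in> lists digit_set. length w = i \<and> alive w y}. cube k w)"

definition retained :: "('m \<Rightarrow> int) env \<Rightarrow> (real ^ 'm) set" where
  "retained y = (\<Inter>i. stage y i)"

lemma stage_decreasing: "stage y (Suc i) \<subseteq> stage y i"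
proof
  fix x assume "x \<in> stage y (Suc i)"
  then obtain w where w: "w \<in> lists digit_set" "length w = Suc i" "alive w y" "x \<in> cube k w"
    by (auto simp: stage_def)
  then obtain v d where v: "w = v @ [d]" by (metis length_Suc_conv_rev)
  have "x \<in> cube k v" using cube_append_subset[OF k_pos, of "[d]" v] w by (auto simp: v)
  moreover have "v \<in> lists digit_set" "length v = i" "alive v y"
    using w by (auto simp: v alive_snoc)
  ultimately show "x \<in> stage y i" by (auto simp: stage_def)
qed

lemma finite_dlevel: "finite {w \<in> lists digit_set. length w = i}"
  by (rule finite_subset[OF _ SM.finite_dwords[of i]]) (auto simp: SM.dwords_def)

lemma compact_cube: "compact (cube k w)"
  by (simp add: cube_def compact_closed_adic_cube)

lemma compact_stage: "compact (stage y i)"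
proof -
  have "finite {w \<in> lists digit_set. length w = i \<and> alive w y}"
    by (rule finite_subset[OF _ finite_dlevel[of i]]) auto
  then show ?thesis unfolding stage_def by (intro compact_UN compact_cube)
qed

lemma limit_set_states: "limit_set k J (states y) = retained y"
proof -
  have "(\<Union>\<sigma>\<in>{\<sigma> \<in> level k CARD('m) i. states y \<sigma>}. J \<sigma>) = stage y i" for i
  proof -
    have "{w \<in> lists digit_set. length w = i \<and> alive w y} = addr ` {\<sigma> \<in> level k m i. states y \<sigma>}"
      unfolding bij_betw_imp_surj_on[OF bij_addr, symmetric] by (auto simp: level_def states_def)
    then have "stage y i = (\<Union>\<sigma>\<in>{\<sigma> \<in> level k m i. states y \<sigma>}. cube k (addr \<sigma>))"
      by (simp add: stage_def)
    also have "\<dots> = (\<Union>\<sigma>\<in>{\<sigma> \<in> level k m i. states y \<sigma>}. J \<sigma>)"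
      by (intro SUP_cong refl) (auto simp: level_def J_eq_cube_addr)
    finally show ?thesis by (simp add: dim)
  qed
  then show ?thesis by (simp add: limit_set_def retained_def)
qed

lemma J_prefix_decreasing:
  assumes \<eta>: "\<eta> \<in> space (inf_words k m)"
  shows "J (map \<eta> [0..<Suc i]) \<subseteq> J (map \<eta> [0..<i])"
proof -
  have "map \<eta> [0..<i] \<in> fin_words k m" "\<eta> i \<in> alphabet k m"
    using prefix_in_level[OF \<eta>, of i] letter_in_alphabet[OF \<eta>] by (auto simp: level_def)
  from bij_betwE[OF cube_system_child[OF this(1)]] this(2) show ?thesis by auto
qed

text \<open>The cubes along an infinite word are nested and compact with diameters tending to zero, so the point
  in the definition by description exists.\<close>

lemma point_of_in:
  assumes \<eta>: "\<eta> \<in> space (inf_words k m)"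
  shows "point_of J \<eta> \<in> J (map \<eta> [0..<i])"
proof -
  have J: "J (map \<eta> [0..<i]) = closed_adic_cube k i (J_corner (map \<eta> [0..<i]))" for i
    using J_eq_cube[of "map \<eta> [0..<i]"] prefix_in_level[OF \<eta>, of i] by (simp add: level_def)
  have "(\<Inter>i. J (map \<eta> [0..<i])) \<noteq> {}"
  proof (rule compact_nest)
    show "compact (J (map \<eta> [0..<n]))" for n by (simp add: J compact_closed_adic_cube)
    show "J (map \<eta> [0..<n]) \<noteq> {}" for n
    proof -
      have "(\<chi> i. real_of_int (J_corner (map \<eta> [0..<n]) i) / real k ^ n) \<in> J (map \<eta> [0..<n])"
        by (auto simp: J closed_adic_cube_def divide_right_mono)
      then show ?thesis by blast
    qed
    show "m' \<le> n \<Longrightarrow> J (map \<eta> [0..<n]) \<subseteq> J (map \<eta> [0..<m'])" for m' n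
      by (rule lift_Suc_antimono_le[of "\<lambda>n. J (map \<eta> [0..<n])"]) (rule J_prefix_decreasing[OF \<eta>])
  qed
  then obtain x where x: "x \<in> (\<Inter>i. J (map \<eta> [0..<i]))" by blast
  have "x' = x" if "x' \<in> (\<Inter>i. J (map \<eta> [0..<i]))" for x'
  proof -
    have "x' $ c = x $ c" for c
    proof -
      have "\<bar>x' $ c - x $ c\<bar> \<le> (1 / real k) ^ i" for i
      proof -
        have "x \<in> J (map \<eta> [0..<i])" "x' \<in> J (map \<eta> [0..<i])" using x that by blast+
        then have "real_of_int (J_corner (map \<eta> [0..<i]) c) / real k ^ i \<le> x $ c" "real_of_int (J_corner (map \<eta> [0..<i]) c) / real k ^ i \<le> x' $ c"
          "x $ c \<le> real_of_int (J_corner (map \<eta> [0..<i]) c) / real k ^ i + 1 / real k ^ i"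
          "x' $ c \<le> real_of_int (J_corner (map \<eta> [0..<i]) c) / real k ^ i + 1 / real k ^ i"
          unfolding J closed_adic_cube_def by (auto simp: add_divide_distrib)
        then show ?thesis by (auto simp: power_one_over abs_le_iff)
      qed
      moreover have "(\<lambda>i. (1 / real k) ^ i) \<longlonglongrightarrow> 0"
        using k by (intro LIMSEQ_power_zero) simp
      ultimately have "\<bar>x' $ c - x $ c\<bar> \<le> 0"
        by (intro LIMSEQ_le_const) auto
      then show ?thesis by simp
    qed
    then show ?thesis by (simp add: vec_eq_iff)
  qed
  with x have "(THE x. x \<in> (\<Inter>i. J (map \<eta> [0..<i]))) = x"
    by (intro the_equality)
  then show ?thesis using x by (simp add: point_of_def)
qed

section \<open>Measurability of the hole events\<close>

lemma measurable_prefix: "(\<lambda>\<eta>. map \<eta> [0..<n]) \<in> inf_words k m \<rightarrow>\<^sub>M count_space UNIV"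
  by (rule measurable_count_space_eq_countable[THEN iffD2])
    (auto simp: inf_words_atom cylinder_sets simp del: vimage_eq)

text \<open>Each coordinate is the limit of the lower corners of the cubes containing the point.\<close>

lemma measurable_point_of [measurable]: "(\<lambda>\<eta>. point_of J \<eta> $ c) \<in> borel_measurable (inf_words k m)"
proof (rule borel_measurable_LIMSEQ_real)
  fix \<eta> assume \<eta>: "\<eta> \<in> space (inf_words k m)"
  show "(\<lambda>i. real_of_int (J_corner (map \<eta> [0..<i]) c) / real k ^ i) \<longlonglongrightarrow> point_of J \<eta> $ c"
  proof (rule real_tendsto_sandwich)
    have J: "J (map \<eta> [0..<i]) = closed_adic_cube k i (J_corner (map \<eta> [0..<i]))" for i
      using J_eq_cube[of "map \<eta> [0..<i]"] prefix_in_level[OF \<eta>, of i] by (simp add: level_def)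
    have *: "real_of_int (J_corner (map \<eta> [0..<i]) c) / real k ^ i \<le> point_of J \<eta> $ c"
      "point_of J \<eta> $ c - (1 / real k) ^ i \<le> real_of_int (J_corner (map \<eta> [0..<i]) c) / real k ^ i" for i
      using point_of_in[OF \<eta>, of i] unfolding J closed_adic_cube_def
      by (auto simp: add_divide_distrib power_one_over algebra_simps)
    show "eventually (\<lambda>i. point_of J \<eta> $ c - (1 / real k) ^ i \<le> real_of_int (J_corner (map \<eta> [0..<i]) c) / real k ^ i) sequentially"
      "eventually (\<lambda>i. real_of_int (J_corner (map \<eta> [0..<i]) c) / real k ^ i \<le> point_of J \<eta> $ c) sequentially"
      using * by auto
    have "(\<lambda>i. point_of J \<eta> $ c - (1 / real k) ^ i) \<longlonglongrightarrow> point_of J \<eta> $ c - 0"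
      using k by (intro tendsto_diff tendsto_const LIMSEQ_power_zero) simp
    then show "(\<lambda>i. point_of J \<eta> $ c - (1 / real k) ^ i) \<longlonglongrightarrow> point_of J \<eta> $ c" by simp
  qed simp
next
  fix i
  show "(\<lambda>\<eta>. real_of_int (J_corner (map \<eta> [0..<i]) c) / real k ^ i) \<in> borel_measurable (inf_words k m)"
    by (rule measurable_compose[OF measurable_prefix]) simp
qed

text \<open>Realisations in a null set may fail to be hereditary, and then the stages of the limit set need not
  decrease.  The intersections of the first \<open>i\<close> stages do.\<close>

lemma measurable_hole_in_cube:
  "Measurable.pred P (\<lambda>\<omega>. \<exists>z\<in>centres k j a r. max_ball z r \<inter> limit_set k J \<omega> = {})"
proof -
  define L where "L i \<omega> = (\<Inter>l\<in>{..i}. \<Union>\<sigma>\<in>{\<sigma> \<in> chosen k m i \<omega>. length \<sigma> = l}. J \<sigma>)" for i \<omega>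
  have L: "L i \<omega> = (\<Inter>l\<in>{..i}. \<Union>\<sigma>\<in>{\<sigma> \<in> level k m l. \<omega> \<sigma>}. J \<sigma>)" for i \<omega>
    unfolding L_def by (intro INF_cong refl SUP_cong) (auto simp: chosen_def words_upto_def level_def)
  have "limit_set k J \<omega> = (\<Inter>i. L i \<omega>)" for \<omega>
    unfolding L limit_set_def dim by auto
  moreover have "Measurable.pred P (\<lambda>\<omega>. \<exists>z\<in>centres k j a r. max_ball z r \<inter> (\<Inter>i. L i \<omega>) = {})"
  proof (rule measurable_hole[OF compact_centres])
    have fin: "finite {\<sigma> \<in> level k m l. \<omega> \<sigma>}" for l \<omega> by (rule finite_subset[OF _ finite_level]) auto
    have "compact (\<Union>\<sigma>\<in>{\<sigma> \<in> level k m l. \<omega> \<sigma>}. J \<sigma>)" for l \<omega>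
      using fin by (intro compact_UN) (auto simp: level_def J_eq_cube compact_closed_adic_cube)
    then have c: "bounded (\<Union>\<sigma>\<in>{\<sigma> \<in> level k m l. \<omega> \<sigma>}. J \<sigma>)" "closed (\<Union>\<sigma>\<in>{\<sigma> \<in> level k m l. \<omega> \<sigma>}. J \<sigma>)" for l \<omega>
      by (auto simp only: compact_eq_bounded_closed)
    show "compact (L i \<omega>)" for i \<omega>
      unfolding L compact_eq_bounded_closed
      by (intro conjI closed_INT ballI c bounded_subset[OF c(1)[of 0 \<omega>]] INF_lower) simp
    show "L (Suc i) \<omega> \<subseteq> L i \<omega>" for i \<omega>
      unfolding L by (intro INF_superset_mono) auto
    show "L i \<in> P \<rightarrow>\<^sub>M count_space UNIV" for i
      unfolding L_def[abs_def] by (rule measurable_compose[OF measurable_chosen]) simp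
  qed
  ultimately show ?thesis by simp
qed

text \<open>The cube containing the point is one of countably many.\<close>

lemma measurable_has_hole [measurable]:
  assumes \<alpha>: "\<alpha> > 0"
  shows "Measurable.pred (inf_words k m \<Otimes>\<^sub>M P) (\<lambda>z. has_hole k (limit_set k J (snd z)) \<alpha> j (point_of J (fst z)))"
proof -
  let ?r = "\<alpha> / 2 / real k ^ j"
  have "has_hole k (limit_set k J (snd z)) \<alpha> j (point_of J (fst z)) \<longleftrightarrow>
    (\<exists>a. (\<forall>i. \<lfloor>point_of J (fst z) $ i * real k ^ j\<rfloor> = a i) \<and> (\<exists>x\<in>centres k j a ?r. max_ball x ?r \<inter> limit_set k J (snd z) = {}))" for z
    unfolding has_hole_iff[OF k_pos \<alpha>] by (auto simp: fun_eq_iff[symmetric])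
  moreover have "Measurable.pred (inf_words k m \<Otimes>\<^sub>M P) (\<lambda>z. \<exists>a. (\<forall>i. \<lfloor>point_of J (fst z) $ i * real k ^ j\<rfloor> = a i) \<and>
      (\<exists>x\<in>centres k j a ?r. max_ball x ?r \<inter> limit_set k J (snd z) = {}))"
  proof (intro pred_intros_countable pred_intros_logic)
    fix a :: "'m \<Rightarrow> int"
    show "Measurable.pred (inf_words k m \<Otimes>\<^sub>M P) (\<lambda>z. \<exists>x\<in>centres k j a ?r. max_ball x ?r \<inter> limit_set k J (snd z) = {})"
      by (rule measurable_compose[OF measurable_snd measurable_hole_in_cube])
    fix i
    show "Measurable.pred (inf_words k m \<Otimes>\<^sub>M P) (\<lambda>z. \<lfloor>point_of J (fst z) $ i * real k ^ j\<rfloor> = a i)"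
      by measurable
  qed
  ultimately show ?thesis by simp
qed

section \<open>Holes that depend on a finite block of sites\<close>

definition endpoint :: "('m \<Rightarrow> int) env \<Rightarrow> real ^ 'm" where
  "endpoint y = point_of J (branch y)"

lemma endpoint_in_cube:
  assumes y: "y \<in> space R"
  shows "endpoint y \<in> cube k (spine y n)"
proof -
  have "endpoint y \<in> J (map (branch y) [0..<n])"
    unfolding endpoint_def by (rule point_of_in[OF branch_in_space[OF y]])
  then show ?thesis
    using prefix_branch[OF y] decode[OF spine_digits[OF y, of n]] J_eq_cube_addr by metis
qed

lemma endpoint_retained:
  assumes y: "y \<in> space R" shows "endpoint y \<in> retained y"
  unfolding retained_def stage_def
  using endpoint_in_cube[OF y] spine_digits[OF y] alive_spine[of y] by auto (metis length_spine)

definition hole_event :: "real \<Rightarrow> ('m \<Rightarrow> int) env \<Rightarrow> bool" where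
  "hole_event \<alpha> y \<longleftrightarrow> (\<exists>z\<in>centres k 0 (\<lambda>_. 0) (\<alpha> / 2). max_ball z (\<alpha> / 2) \<inter> retained y = {})"

definition local_hole_event :: "nat \<Rightarrow> real \<Rightarrow> ('m \<Rightarrow> int) env \<Rightarrow> bool" where
  "local_hole_event n \<alpha> y \<longleftrightarrow> (\<exists>z\<in>centres k 0 (\<lambda>_. 0) (\<alpha> / 2). max_ball z (\<alpha> / 2) \<inter> (retained y \<union> cube k (spine y n)) = {})"

lemma hole_event_if_local: "local_hole_event n \<alpha> y \<Longrightarrow> hole_event \<alpha> y"
  by (auto simp: local_hole_event_def hole_event_def)

text \<open>The branch point belongs to the limit set and to the cube of generation \<open>n\<close>.  A ball avoiding this
  point avoids the cube after its radius is reduced by the side length of the cube.\<close>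

lemma local_if_hole_event:
  assumes y: "y \<in> space R" and h: "hole_event \<beta> y" and le: "\<alpha> + 2 / real k ^ n \<le> \<beta>"
  shows "local_hole_event n \<alpha> y"
proof -
  obtain z where z: "z \<in> centres k 0 (\<lambda>_. 0) (\<beta> / 2)" "max_ball z (\<beta> / 2) \<inter> retained y = {}"
    using h by (auto simp: hole_event_def)
  have kp: "0 < 1 / real k ^ n" using k_pos by simp
  have le': "\<alpha> / 2 + 1 / real k ^ n \<le> \<beta> / 2" using le by simp
  have "z \<in> centres k 0 (\<lambda>_. 0) (\<alpha> / 2)"
  proof -
    have "\<beta> / 2 \<le> z $ i" "z $ i \<le> 1 - \<beta> / 2" for i using z(1) by (auto simp: centres_def)
    then have "\<alpha> / 2 \<le> z $ i" "z $ i \<le> 1 - \<alpha> / 2" for i 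
      using le' kp by (smt (verit))+
    then show ?thesis by (simp add: centres_def)
  qed
  moreover have "max_ball z (\<alpha> / 2) \<inter> retained y = {}"
    using z(2) max_ball_mono[of "\<alpha> / 2" "\<beta> / 2" z] le' kp by (auto simp: disjoint_iff subset_eq)
  moreover have "max_ball z (\<alpha> / 2) \<inter> cube k (spine y n) = {}"
  proof (rule ccontr)
    assume "max_ball z (\<alpha> / 2) \<inter> cube k (spine y n) \<noteq> {}"
    then obtain u where u: "u \<in> max_ball z (\<alpha> / 2)" "u \<in> cube k (spine y n)" by auto
    have "\<bar>endpoint y $ i - z $ i\<bar> < \<beta> / 2" for i
    proof -
      have "\<bar>u $ i - z $ i\<bar> < \<alpha> / 2" using u(1) by (simp add: mem_max_ball)
      moreover have "\<bar>endpoint y $ i - u $ i\<bar> \<le> 1 / real k ^ n"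
      proof -
        define c where "c = real_of_int (corner k (spine y n) i) / real k ^ n"
        have "c \<le> u $ i \<and> u $ i \<le> c + 1 / real k ^ n" "c \<le> endpoint y $ i \<and> endpoint y $ i \<le> c + 1 / real k ^ n"
          using u(2) endpoint_in_cube[OF y, of n] unfolding cube_def closed_adic_cube_def
          by (auto simp: c_def add_divide_distrib)
        then show ?thesis by linarith
      qed
      ultimately show ?thesis using le' by linarith
    qed
    then have "endpoint y \<in> max_ball z (\<beta> / 2)" by (simp add: mem_max_ball)
    then show False using z(2) endpoint_retained[OF y] by blast
  qed
  ultimately show ?thesis unfolding local_hole_event_def by blast
qed

text \<open>A point of the limit set outside the cube around the branch point is covered, in each generation, by
  an alive word that does not extend the branch of height \<open>n\<close>.\<close>

lemma retained_local:
  assumes y: "y \<in> space R" and eq: "\<And>i. i < n \<Longrightarrow> y i = y' i"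
  shows "retained y \<subseteq> retained y' \<union> cube k (spine y n)"
proof
  fix x assume x: "x \<in> retained y"
  show "x \<in> retained y' \<union> cube k (spine y n)"
  proof (cases "x \<in> cube k (spine y n)")
    case False
    have "x \<in> stage y' i" for i
    proof -
      have "x \<in> stage y i" using x by (simp add: retained_def)
      then obtain w where w: "w \<in> lists digit_set" "length w = i" "alive w y" "x \<in> cube k w"
        by (auto simp: stage_def)
      have "\<not> prefix (spine y n) w"
      proof
        assume "prefix (spine y n) w"
        then obtain v where v: "w = spine y n @ v" by (auto simp: prefix_def)
        then have "x \<in> cube k (spine y n)"
          using cube_append_subset[OF k_pos, of v "spine y n"] w by auto
        then show False using False by simp
      qed
      then have "alive w y'" using w(3) alive_local[of n y y' w, OF eq] by blast
      then show ?thesis using w by (auto simp: stage_def)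
    qed
    then show ?thesis by (simp add: retained_def)
  qed simp
qed

lemma local_hole_event_cong:
  assumes y: "y \<in> space R" "y' \<in> space R" and eq: "\<And>i. i < n \<Longrightarrow> y i = y' i"
  shows "local_hole_event n \<alpha> y = local_hole_event n \<alpha> y'"
proof -
  have s: "spine y n = spine y' n" using eq by (auto simp: spine_def)
  have "retained y \<union> cube k (spine y n) = retained y' \<union> cube k (spine y' n)"
    using retained_local[OF y(1), of n y', OF eq] retained_local[OF y(2), of n y, OF eq[symmetric]] s by auto
  then show ?thesis by (simp add: local_hole_event_def)
qed

lemma measurable_local_hole_event [measurable]: "Measurable.pred R (local_hole_event n \<alpha>)"
proof -
  let ?Z = "centres k 0 (\<lambda>_. 0 :: int) (\<alpha> / 2)" and ?S = "{s \<in> lists digit_set. length s = n}"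
  have eq: "local_hole_event n \<alpha> y \<longleftrightarrow> (\<exists>s\<in>?S. spine y n = s \<and>
      (\<exists>z\<in>?Z. max_ball z (\<alpha> / 2) \<inter> (\<Inter>i. stage y i \<union> cube k s) = {}))" if "y \<in> space R" for y
  proof -
    have "(\<Inter>i. stage y i \<union> cube k s) = retained y \<union> cube k s" for s
      unfolding retained_def by blast
    moreover have "spine y n \<in> ?S" using spine_digits[OF that, of n] by simp
    ultimately show ?thesis unfolding local_hole_event_def by metis
  qed
  have "Measurable.pred R (\<lambda>y. \<exists>s\<in>?S. spine y n = s \<and>
      (\<exists>z\<in>?Z. max_ball z (\<alpha> / 2) \<inter> (\<Inter>i. stage y i \<union> cube k s) = {}))"
  proof (rule pred_intros_finite(4)[OF finite_dlevel])
    fix s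
    have [measurable]: "Measurable.pred R (\<lambda>y. spine y n = s)" by (rule SM.measurable_spine_eq)
    have [measurable]: "Measurable.pred R (\<lambda>y. \<exists>z\<in>?Z. max_ball z (\<alpha> / 2) \<inter> (\<Inter>i. stage y i \<union> cube k s) = {})"
    proof (rule measurable_hole[OF compact_centres])
      show "compact (stage y i \<union> cube k s)" for y i by (intro compact_Un compact_stage compact_cube)
      show "stage y (Suc i) \<union> cube k s \<subseteq> stage y i \<union> cube k s" for y i using stage_decreasing by blast
      have "(\<lambda>y. {w \<in> {w \<in> lists digit_set. length w = i}. alive w y}) \<in> R \<rightarrow>\<^sub>M count_space UNIV" for i
        by (rule measurable_Collect_subset[OF finite_dlevel]) (rule SM.measurable_alive)
      then have "(\<lambda>y. (\<Union>w\<in>{w \<in> {w \<in> lists digit_set. length w = i}. alive w y}. cube k w) \<union> cube k s) \<in> R \<rightarrow>\<^sub>M count_space UNIV" for i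
        by (rule measurable_compose) simp
      then show "(\<lambda>y. stage y i \<union> cube k s) \<in> R \<rightarrow>\<^sub>M count_space UNIV" for i
        by (simp add: stage_def conj_assoc)
    qed
    show "Measurable.pred R (\<lambda>y. spine y n = s \<and> (\<exists>z\<in>?Z. max_ball z (\<alpha> / 2) \<inter> (\<Inter>i. stage y i \<union> cube k s) = {}))"
      by measurable
  qed
  also have "?this \<longleftrightarrow> ?thesis" by (rule measurable_cong) (rule eq[symmetric])
  finally show ?thesis .
qed

text \<open>In the interior of a branch cube the limit set consists of the part generated inside this cube.\<close>

lemma retained_zoom:
  assumes y: "y \<in> space R" and x: "\<And>i. 0 < x $ i \<and> x $ i < 1"
  shows "zoom k (spine y n) x \<in> retained y \<longleftrightarrow> x \<in> retained (\<lambda>i. y (i + n))"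
proof
  let ?s = "spine y n"
  assume z: "zoom k ?s x \<in> retained y"
  have "x \<in> stage (\<lambda>i. y (i + n)) i" for i
  proof -
    have "zoom k ?s x \<in> stage y (n + i)" using z by (simp add: retained_def)
    then obtain v where v: "v \<in> lists digit_set" "length v = n + i" "alive v y" "zoom k ?s x \<in> cube k v"
      by (auto simp: stage_def)
    have tv: "take n v \<in> lists digit_set" "drop n v \<in> lists digit_set" using v(1) by (auto dest: in_set_takeD in_set_dropD)
    have "zoom k ?s x \<in> cube k (take n v)"
      using cube_append_subset[OF k_pos tv(2), of "take n v"] v(4) by auto
    then have "take n v = ?s"
      using tv v(2) by (intro zoom_interior_unique[OF k_pos spine_digits[OF y] _ _ x]) auto
    then have v': "v = ?s @ drop n v" by (metis append_take_drop_id)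
    have "x \<in> cube k (drop n v)" using v(4) zoom_cube[OF k_pos, of ?s x "drop n v"] v' by simp
    moreover have "alive (drop n v) (\<lambda>i. y (i + n))" using v(3) v' alive_spine_append by metis
    ultimately show ?thesis using tv v(2) by (auto simp: stage_def)
  qed
  then show "x \<in> retained (\<lambda>i. y (i + n))" by (simp add: retained_def)
next
  let ?s = "spine y n"
  assume x': "x \<in> retained (\<lambda>i. y (i + n))"
  have later: "zoom k ?s x \<in> stage y (n + i)" for i
  proof -
    have "x \<in> stage (\<lambda>i. y (i + n)) i" using x' by (simp add: retained_def)
    then obtain w where w: "w \<in> lists digit_set" "length w = i" "alive w (\<lambda>i. y (i + n))" "x \<in> cube k w"
      by (auto simp: stage_def)
    then have "zoom k ?s x \<in> cube k (?s @ w)" by (simp add: zoom_cube[OF k_pos])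
    moreover have "alive (?s @ w) y" using w(3) by (simp add: alive_spine_append)
    moreover have "?s @ w \<in> lists digit_set" "length (?s @ w) = n + i" using w spine_digits[OF y, of n] by auto
    ultimately show ?thesis unfolding stage_def by blast
  qed
  have "zoom k ?s x \<in> stage y i" for i
  proof -
    have "stage y (n + i) \<subseteq> stage y i"
      by (rule lift_Suc_antimono_le[of "stage y", OF stage_decreasing]) simp
    then show ?thesis using later[of i] by blast
  qed
  then show "zoom k ?s x \<in> retained y" by (simp add: retained_def)
qed

section \<open>Holes along the spine are a stationary sequence\<close>

text \<open>In no coordinate does the expansion of the branch point end with the digit \<open>k - 1\<close> repeated; this
  keeps the branch point off the upper faces of its cubes.\<close>

definition regular :: "('m \<Rightarrow> int) env \<Rightarrow> bool" where
  "regular y \<longleftrightarrow> (\<forall>c j. \<exists>n\<ge>j. fst (y n) c \<noteq> int k - 1)"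

text \<open>If the branch point lay on an upper face of one of its cubes, it would lie on the corresponding upper
  face of all later ones, and all later digits would be \<open>k - 1\<close>.\<close>

lemma floor_endpoint:
  assumes y: "y \<in> space R" and reg: "regular y"
  shows "\<lfloor>endpoint y $ c * real k ^ j\<rfloor> = corner k (spine y j) c"
proof (rule ccontr)
  let ?x = "endpoint y $ c"
  have bd: "real_of_int (corner k (spine y n) c) \<le> ?x * real k ^ n" "?x * real k ^ n \<le> real_of_int (corner k (spine y n) c) + 1" for n
    using endpoint_in_cube[OF y, of n] k_pos unfolding cube_def closed_adic_cube_def by (auto simp: divide_le_eq le_divide_eq)
  assume "\<lfloor>?x * real k ^ j\<rfloor> \<noteq> corner k (spine y j) c"
  then have top: "?x * real k ^ j = real_of_int (corner k (spine y j) c + 1)"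
    using bd[of j] by linarith
  have step: "?x * real k ^ Suc n = real_of_int (corner k (spine y (Suc n)) c + 1) \<and> fst (y n) c = int k - 1"
    if "?x * real k ^ n = real_of_int (corner k (spine y n) c + 1)" for n
  proof -
    have "fst (y n) \<in> digit_set" using y by (simp add: SM.space_model)
    then have d: "fst (y n) c < int k" by (simp add: digits_def)
    have c: "corner k (spine y (Suc n)) c = int k * corner k (spine y n) c + fst (y n) c"
      by (simp add: spine_Suc)
    have "?x * real k ^ Suc n = real k * (?x * real k ^ n)" by (simp only: power_Suc mult_ac)
    also have "\<dots> = real_of_int (int k * (corner k (spine y n) c + 1))" unfolding that by simp
    finally have "?x * real k ^ Suc n = real_of_int (int k * (corner k (spine y n) c + 1))" .
    moreover from this have "int k * (corner k (spine y n) c + 1) \<le> corner k (spine y (Suc n)) c + 1"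
      using bd(2)[of "Suc n"] by linarith
    ultimately show ?thesis using d c by (simp add: distrib_left)
  qed
  have "?x * real k ^ n = real_of_int (corner k (spine y n) c + 1)" if "n \<ge> j" for n
    using that by (induction rule: dec_induct) (use top step in auto)
  then have "fst (y n) c = int k - 1" if "n \<ge> j" for n using step that by blast
  then show False using reg by (auto simp: regular_def)
qed

text \<open>Holes at scale \<open>j\<close> are transported to scale \<open>0\<close> by the similarity of the branch cube.  The balls in
  question stay in the interior of the unit cube, where the limit sets correspond to each other.\<close>

lemma has_hole_model_iff:
  assumes y: "y \<in> space R" and reg: "regular y" and \<alpha>: "\<alpha> > 0"
  shows "has_hole k (retained y) \<alpha> j (endpoint y) \<longleftrightarrow> hole_event \<alpha> (\<lambda>i. y (i + j))"
proof -
  let ?s = "spine y j" and ?r = "\<alpha> / 2" and ?y' = "\<lambda>i. y (i + j)"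
  have key: "max_ball (zoom k ?s z) (?r / real k ^ j) \<inter> retained y = {} \<longleftrightarrow> max_ball z ?r \<inter> retained ?y' = {}"
    if z: "z \<in> centres k 0 (\<lambda>_. 0) ?r" for z
  proof -
    have int: "0 < x $ i \<and> x $ i < 1" if "x \<in> max_ball z ?r" for x i
    proof -
      have "\<bar>x $ i - z $ i\<bar> < ?r" using that by (simp add: mem_max_ball)
      moreover have "?r \<le> z $ i" "z $ i \<le> 1 - ?r" using z by (auto simp: centres_def)
      ultimately show ?thesis by linarith
    qed
    have b: "zoom k ?s x \<in> max_ball (zoom k ?s z) (?r / real k ^ j) \<longleftrightarrow> x \<in> max_ball z ?r" for x
      using zoom_ball[OF k_pos, of ?s x z ?r] by simp
    show ?thesis
    proof (intro iffI equals0I)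
      fix x assume e: "max_ball (zoom k ?s z) (?r / real k ^ j) \<inter> retained y = {}" and x: "x \<in> max_ball z ?r \<inter> retained ?y'"
      then have "zoom k ?s x \<in> retained y" using retained_zoom[OF y, of x j] int by blast
      moreover have "zoom k ?s x \<in> max_ball (zoom k ?s z) (?r / real k ^ j)" using x b by blast
      ultimately show False using e by blast
    next
      fix u assume e: "max_ball z ?r \<inter> retained ?y' = {}" and u: "u \<in> max_ball (zoom k ?s z) (?r / real k ^ j) \<inter> retained y"
      obtain x where x: "u = zoom k ?s x" using zoom_surj[OF k_pos] by blast
      have "x \<in> max_ball z ?r" using u b by (simp add: x)
      moreover from this have "x \<in> retained ?y'" using u retained_zoom[OF y, of x j] int by (auto simp: x)
      ultimately show False using e by blast
    qed
  qed
  have fl: "(\<lambda>i. \<lfloor>endpoint y $ i * real k ^ j\<rfloor>) = corner k ?s" using floor_endpoint[OF y reg] by auto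
  have "has_hole k (retained y) \<alpha> j (endpoint y) \<longleftrightarrow>
    (\<exists>z\<in>centres k j (corner k ?s) (?r / real k ^ j). max_ball z (?r / real k ^ j) \<inter> retained y = {})"
    unfolding has_hole_iff[OF k_pos \<alpha>] fl by (rule refl)
  also have "\<dots> \<longleftrightarrow> hole_event \<alpha> ?y'"
  proof
    assume "\<exists>z\<in>centres k j (corner k ?s) (?r / real k ^ j). max_ball z (?r / real k ^ j) \<inter> retained y = {}"
    then obtain u where u: "u \<in> centres k j (corner k ?s) (?r / real k ^ j)" "max_ball u (?r / real k ^ j) \<inter> retained y = {}" by blast
    obtain z where z: "u = zoom k ?s z" using zoom_surj[OF k_pos] by blast
    have "z \<in> centres k 0 (\<lambda>_. 0) ?r" using u(1) zoom_centres[OF k_pos, of ?s z ?r] by (simp add: z)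
    then show "hole_event \<alpha> ?y'" using key[of z] u(2) by (auto simp: hole_event_def z)
  next
    assume "hole_event \<alpha> ?y'"
    then obtain z where z: "z \<in> centres k 0 (\<lambda>_. 0) ?r" "max_ball z ?r \<inter> retained ?y' = {}" by (auto simp: hole_event_def)
    then have "zoom k ?s z \<in> centres k j (corner k ?s) (?r / real k ^ j)" using zoom_centres[OF k_pos, of ?s z ?r] by simp
    then show "\<exists>z\<in>centres k j (corner k ?s) (?r / real k ^ j). max_ball z (?r / real k ^ j) \<inter> retained y = {}"
      using key[OF z(1)] z(2) by blast
  qed
  finally show ?thesis .
qed

lemma hole_event_stages: "hole_event \<alpha> y \<longleftrightarrow> (\<exists>z\<in>centres k 0 (\<lambda>_. 0) (\<alpha> / 2). max_ball z (\<alpha> / 2) \<inter> (\<Inter>i. stage y i) = {})"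
  by (simp add: hole_event_def retained_def)

lemma measurable_hole_event [measurable]: "Measurable.pred R (hole_event \<alpha>)"
  unfolding hole_event_stages[abs_def]
proof (rule measurable_hole[where L = "\<lambda>i y. stage y i", OF compact_centres compact_stage stage_decreasing])
  fix i
  have "(\<lambda>y. {w \<in> {w \<in> lists digit_set. length w = i}. alive w y}) \<in> R \<rightarrow>\<^sub>M count_space UNIV"
    by (rule measurable_Collect_subset[OF finite_dlevel]) (rule SM.measurable_alive)
  then have "(\<lambda>y. \<Union>w\<in>{w \<in> {w \<in> lists digit_set. length w = i}. alive w y}. cube k w) \<in> R \<rightarrow>\<^sub>M count_space UNIV"
    by (rule measurable_compose) simp
  then show "(\<lambda>y. stage y i) \<in> R \<rightarrow>\<^sub>M count_space UNIV"
    by (simp add: stage_def conj_assoc)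
qed

sublocale RP: prob_space R
  by (rule SM.prob_space_model)

text \<open>The digits of the branch are independent and avoid \<open>k - 1\<close> in a given coordinate with positive
  probability.\<close>

lemma AE_regular: "AE y in R. regular y"
proof -
  have "AE y in R. \<exists>n\<ge>j. fst (y n) c \<noteq> int k - 1" for c j
  proof -
    define X where "X = {x \<in> space (site digit_set p). fst x c = int k - 1}"
    define q where "q = measure (site digit_set p) X"
    have Xm: "X \<in> sets (site digit_set p)"
    proof -
      have "fst \<in> site digit_set p \<rightarrow>\<^sub>M uniform_count_measure digit_set"
        unfolding site_def by (rule measurable_fst)
      moreover have "{d \<in> digit_set. d c = int k - 1} \<in> sets (uniform_count_measure digit_set)"
        by (simp add: sets_uniform_count_measure)
      ultimately have "fst -` {d \<in> digit_set. d c = int k - 1} \<inter> space (site digit_set p) \<in> sets (site digit_set p)"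
        by (rule measurable_sets)
      also have "fst -` {d \<in> digit_set. d c = int k - 1} \<inter> space (site digit_set p) = X"
        by (auto simp: X_def site_def space_pair_measure space_uniform_count_measure)
      finally show ?thesis .
    qed
    have "q < 1"
    proof -
      \<comment> \<open>The zero digit vector has positive probability and differs from \<open>k - 1\<close> because \<open>k \<ge> 2\<close>.\<close>
      define Y where "Y = {x \<in> space (site digit_set p). fst x = (\<lambda>_. 0) \<and> (\<forall>w\<in>{}. snd x w = undefined)}"
      have z: "(\<lambda>_. 0) \<in> digit_set" using k by (simp add: digits_def)
      have Ym: "Y \<in> sets (site digit_set p)"
        unfolding Y_def by (rule SM.emeasure_site(1)[OF z]) simp
      have "emeasure (site digit_set p) Y = ennreal (1 / card digit_set)"
        unfolding Y_def using SM.emeasure_site(2)[OF z, of "{}"] by simp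
      then have "measure (site digit_set p) Y = 1 / card digit_set"
        by (simp add: measure_def)
      then have "0 < measure (site digit_set p) Y" using SM.D by (simp add: card_gt_0_iff)
      moreover have "X \<inter> Y = {}"
      proof (rule equals0I)
        fix x assume "x \<in> X \<inter> Y"
        then have "fst x c = int k - 1" "fst x = (\<lambda>_. 0)" unfolding X_def Y_def by blast+
        then show False using k by simp
      qed
      then have "measure (site digit_set p) (X \<union> Y) = q + measure (site digit_set p) Y"
        unfolding q_def by (rule SM.site.finite_measure_Union[OF Xm Ym])
      moreover have "measure (site digit_set p) (X \<union> Y) \<le> 1" by simp
      ultimately show "q < 1" by linarith
    qed
    define B where "B = {y \<in> space R. \<forall>n\<ge>j. fst (y n) c = int k - 1}"
    have Bm: "B \<in> sets R"
    proof -
      have [measurable]: "Measurable.pred R (\<lambda>y. fst (y n) c = int k - 1)" for n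
        by (rule measurable_compose[OF SM.measurable_digit]) simp
      show ?thesis unfolding B_def by measurable
    qed
    have "measure R B \<le> q ^ N" for N
    proof -
      let ?E = "{y \<in> space R. \<forall>n\<in>{j..<j+N}. y n \<in> X}"
      have "?E \<in> sets R"
        unfolding model_def using Xm by (intro sets.sets_Collect_finite_All sets_Collect_single') (auto simp: Collect_conj_eq Int_absorb1 sets.sets_into_space)
      moreover have "B \<subseteq> ?E"
        unfolding B_def X_def model_def by (auto simp: space_PiM PiE_iff)
      ultimately have "measure R B \<le> measure R ?E" by (intro RP.finite_measure_mono)
      also have "measure R ?E = q ^ N"
      proof -
        have "emeasure R ?E = (\<Prod>n\<in>{j..<j+N}. emeasure (site digit_set p) X)"
          unfolding model_def using Xm by (intro SM.seq.emeasure_PiM_Collect) auto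
        then have "emeasure R ?E = ennreal (q ^ N)"
          by (simp add: q_def SM.site.emeasure_eq_measure ennreal_power)
        then show ?thesis by (simp add: measure_def q_def)
      qed
      finally show ?thesis .
    qed
    moreover have "(\<lambda>N. q ^ N) \<longlonglongrightarrow> 0"
      using \<open>q < 1\<close> by (intro LIMSEQ_power_zero) (simp add: q_def)
    ultimately have "measure R B \<le> 0" by (intro LIMSEQ_le_const) auto
    then have "measure R B = 0" using measure_nonneg[of R B] by linarith
    then have "emeasure R B = 0" by (simp add: RP.emeasure_eq_measure)
    then have "AE y in R. y \<notin> B" using Bm by (intro AE_not_in) auto
    then show ?thesis using AE_space by eventually_elim (auto simp: B_def)
  qed
  then show ?thesis unfolding regular_def by (simp add: AE_all_countable)
qed

text \<open>The hole indicator at scale \<open>0\<close> and the hole event of the model agree off the null set of irregular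
  sequences.\<close>

lemma expected_hole_eq:
  assumes \<alpha>: "\<alpha> > 0"
  shows "expected_hole k p J P \<alpha> = measure R {y \<in> space R. hole_event \<alpha> y}"
proof -
  have ind: "hole_indicator k J \<alpha> = (\<lambda>z. of_bool (has_hole k (limit_set k J (snd z)) \<alpha> 0 (point_of J (fst z))))"
    by (auto simp: hole_indicator_def fun_eq_iff)
  have [measurable]: "hole_indicator k J \<alpha> \<in> borel_measurable (inf_words k m \<Otimes>\<^sub>M P)"
    unfolding ind using measurable_has_hole[OF \<alpha>, of 0] by measurable
  have "expected_hole k p J P \<alpha> = (\<integral>y. hole_indicator k J \<alpha> (realise y) \<partial>R)"
    unfolding expected_hole_def Q_eq_distr_model by (rule integral_distr) measurable
  also have "\<dots> = (\<integral>y. indicator {y \<in> space R. hole_event \<alpha> y} y \<partial>R)"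
  proof (rule integral_cong_AE)
    show "AE y in R. hole_indicator k J \<alpha> (realise y) = indicator {y \<in> space R. hole_event \<alpha> y} y"
      using AE_regular AE_space
    proof eventually_elim
      case (elim y)
      then show ?case
        using has_hole_model_iff[OF elim(2,1) \<alpha>, of 0]
        by (simp add: ind realise_def limit_set_states endpoint_def indicator_def)
    qed
  qed measurable
  also have "\<dots> = measure R {y \<in> space R. hole_event \<alpha> y}" by simp
  finally show ?thesis .
qed

section \<open>Mean porosity\<close>

definition hole_freq :: "real \<Rightarrow> (nat \<Rightarrow> nat) \<times> (nat list \<Rightarrow> bool) \<Rightarrow> nat \<Rightarrow> real" where
  "hole_freq \<alpha> z N = real (hole_count k (limit_set k J (snd z)) (point_of J (fst z)) \<alpha> N) / real N"

text \<open>The strong law for the block events lies between the hole frequencies for the two parameters, and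
  their probability lies between the two expectations.\<close>

lemma AE_model_bounds:
  assumes \<alpha>: "0 < \<alpha>" "\<alpha> < \<beta>" and \<epsilon>: "\<epsilon> > 0"
  shows "AE y in R. eventually (\<lambda>N. expected_hole k p J P \<beta> - \<epsilon> \<le> hole_freq \<alpha> (realise y) N \<and>
    hole_freq \<beta> (realise y) N \<le> expected_hole k p J P \<alpha> + \<epsilon>) sequentially"
proof -
  have lim0: "(\<lambda>n. 2 * (1 / real k) ^ n) \<longlonglongrightarrow> 2 * 0"
    using k by (intro tendsto_mult tendsto_const LIMSEQ_power_zero) simp
  have "eventually (\<lambda>n. 2 * (1 / real k) ^ n < \<beta> - \<alpha>) sequentially"
    by (rule order_tendstoD(2)[OF lim0]) (use \<alpha> in simp)
  then obtain n where "2 * (1 / real k) ^ n < \<beta> - \<alpha>"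
    by (auto simp: eventually_sequentially)
  then have n: "\<alpha> + 2 / real k ^ n \<le> \<beta>"
    by (simp add: power_one_over)
  define f where "f y = (of_bool (local_hole_event n \<alpha> y) :: real)" for y
  have [measurable]: "f \<in> borel_measurable R" unfolding f_def[abs_def] by measurable
  have "AE y in R. (\<lambda>N. (\<Sum>j=1..N. f (\<lambda>i. y (i + j))) / real N) \<longlonglongrightarrow> (\<integral>y. f y \<partial>R)"
    unfolding model_def
  proof (rule SM.seq.slln_block_factor)
    show "f \<in> borel_measurable (Pi\<^sub>M UNIV (\<lambda>i. site digit_set p))"
      using \<open>f \<in> borel_measurable R\<close> by (simp add: model_def)
    show "f y = f y'" if "y \<in> space (Pi\<^sub>M UNIV (\<lambda>i. site digit_set p))" "y' \<in> space (Pi\<^sub>M UNIV (\<lambda>i. site digit_set p))"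
      "\<And>i. i < n \<Longrightarrow> y i = y' i" for y y'
      using local_hole_event_cong[of y y' n \<alpha>] that by (simp add: f_def model_def)
  qed (simp add: f_def)
  moreover have Ef: "(\<integral>y. f y \<partial>R) = measure R {y \<in> space R. local_hole_event n \<alpha> y}"
  proof -
    have "(\<integral>y. f y \<partial>R) = (\<integral>y. indicator {y \<in> space R. local_hole_event n \<alpha> y} y \<partial>R)"
      by (intro Bochner_Integration.integral_cong) (auto simp: f_def)
    then show ?thesis by simp
  qed
  have \<beta>: "\<beta> > 0" using \<alpha> by simp
  have up: "(\<integral>y. f y \<partial>R) \<le> expected_hole k p J P \<alpha>"
    unfolding Ef expected_hole_eq[OF \<alpha>(1)] by (intro RP.finite_measure_mono) (auto dest: hole_event_if_local)
  have lo: "expected_hole k p J P \<beta> \<le> (\<integral>y. f y \<partial>R)"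
    unfolding Ef expected_hole_eq[OF \<beta>] by (intro RP.finite_measure_mono) (auto intro: local_if_hole_event[OF _ _ n])
  show ?thesis
    using calculation AE_regular AE_space
  proof eventually_elim
    case (elim y)
    have sh: "(\<lambda>i. y (i + j)) \<in> space R" for j using elim(3) by (simp add: SM.space_model)
    have freq: "hole_freq \<gamma> (realise y) N = (\<Sum>j=1..N. of_bool (hole_event \<gamma> (\<lambda>i. y (i + j)))) / real N" if "\<gamma> > 0" for \<gamma> N
      using has_hole_model_iff[OF elim(3,2) that]
      by (simp add: hole_freq_def hole_count_sum realise_def limit_set_states endpoint_def)
    have 1: "(\<Sum>j=1..N. f (\<lambda>i. y (i + j))) / real N \<le> hole_freq \<alpha> (realise y) N" for N
      unfolding freq[OF \<alpha>(1)] by (intro divide_right_mono sum_mono) (auto simp: f_def dest: hole_event_if_local)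
    have 2: "hole_freq \<beta> (realise y) N \<le> (\<Sum>j=1..N. f (\<lambda>i. y (i + j))) / real N" for N
      unfolding freq[OF \<beta>] by (intro divide_right_mono sum_mono) (auto simp: f_def intro: local_if_hole_event[OF sh _ n])
    have "eventually (\<lambda>N. (\<integral>y. f y \<partial>R) - \<epsilon> < (\<Sum>j=1..N. f (\<lambda>i. y (i + j))) / real N) sequentially"
      "eventually (\<lambda>N. (\<Sum>j=1..N. f (\<lambda>i. y (i + j))) / real N < (\<integral>y. f y \<partial>R) + \<epsilon>) sequentially"
      by (rule order_tendstoD(1)[OF elim(1)], use \<epsilon> in simp, rule order_tendstoD(2)[OF elim(1)], use \<epsilon> in simp)
    then show ?case
    proof eventually_elim
      case (elim N)
      then show ?case using 1[of N] 2[of N] up lo by linarith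
    qed
  qed
qed

lemma AE_bounds:
  assumes \<alpha>: "0 < \<alpha>" "\<alpha> < \<beta>" and \<epsilon>: "\<epsilon> > 0"
  shows "AE z in Q. eventually (\<lambda>N. expected_hole k p J P \<beta> - \<epsilon> \<le> hole_freq \<alpha> z N \<and>
    hole_freq \<beta> z N \<le> expected_hole k p J P \<alpha> + \<epsilon>) sequentially"
proof -
  have [measurable]: "(\<lambda>z. hole_freq \<gamma> z N) \<in> borel_measurable (inf_words k m \<Otimes>\<^sub>M P)" if "\<gamma> > 0" for \<gamma> N
    unfolding hole_freq_def hole_count_sum using measurable_has_hole[OF that] by measurable
  have [measurable]: "(\<lambda>z. hole_freq \<alpha> z N) \<in> borel_measurable (inf_words k m \<Otimes>\<^sub>M P)"
    "(\<lambda>z. hole_freq \<beta> z N) \<in> borel_measurable (inf_words k m \<Otimes>\<^sub>M P)" for N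
    using \<alpha> by auto
  have m: "{z \<in> space (inf_words k m \<Otimes>\<^sub>M P). eventually (\<lambda>N. expected_hole k p J P \<beta> - \<epsilon> \<le> hole_freq \<alpha> z N \<and>
    hole_freq \<beta> z N \<le> expected_hole k p J P \<alpha> + \<epsilon>) sequentially} \<in> sets (inf_words k m \<Otimes>\<^sub>M P)"
    unfolding eventually_sequentially by measurable
  show ?thesis
    unfolding Q_eq_distr_model AE_distr_iff[OF measurable_realise m] by (rule AE_model_bounds[OF assms])
qed

text \<open>Countably many conditions that hold almost surely and control the frequencies for all real parameters
  by monotonicity.\<close>

definition squeezed :: "(nat \<Rightarrow> nat) \<times> (nat list \<Rightarrow> bool) \<Rightarrow> bool" where
  "squeezed z \<longleftrightarrow> (\<forall>a b :: rat. \<forall>s :: nat. 0 < a \<longrightarrow> a < b \<longrightarrow>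
    eventually (\<lambda>N. expected_hole k p J P (of_rat b) - 1 / real (Suc s) \<le> hole_freq (of_rat a) z N \<and>
      hole_freq (of_rat b) z N \<le> expected_hole k p J P (of_rat a) + 1 / real (Suc s)) sequentially)"

lemma AE_squeezed: "AE z in Q. squeezed z"
  unfolding squeezed_def AE_all_countable
proof (intro allI)
  fix a b :: rat and s :: nat
  show "AE z in Q. 0 < a \<longrightarrow> a < b \<longrightarrow>
    eventually (\<lambda>N. expected_hole k p J P (of_rat b) - 1 / real (Suc s) \<le> hole_freq (of_rat a) z N \<and>
      hole_freq (of_rat b) z N \<le> expected_hole k p J P (of_rat a) + 1 / real (Suc s)) sequentially"
  proof (cases "0 < a \<and> a < b")
    case True
    then have "AE z in Q. eventually (\<lambda>N. expected_hole k p J P (of_rat b) - 1 / real (Suc s) \<le> hole_freq (of_rat a) z N \<and>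
      hole_freq (of_rat b) z N \<le> expected_hole k p J P (of_rat a) + 1 / real (Suc s)) sequentially"
      by (intro AE_bounds) (auto simp: of_rat_less)
    then show ?thesis by eventually_elim simp
  qed auto
qed

lemma hole_freq_antimono: "\<alpha> \<le> \<beta> \<Longrightarrow> hole_freq \<beta> z N \<le> hole_freq \<alpha> z N"
  unfolding hole_freq_def by (intro divide_right_mono of_nat_mono hole_count_antimono) auto

text \<open>Rational parameters on both sides of \<open>\<beta>\<close>, still close to \<open>\<alpha>\<close>, enclose the frequencies for \<open>\<beta>\<close>.\<close>

lemma squeezed_near_continuity:
  assumes z: "squeezed z" and \<alpha>: "0 < \<alpha>" "isCont (expected_hole k p J P) \<alpha>" and \<epsilon>: "\<epsilon> > 0"
  shows "\<exists>\<delta>>0. \<forall>\<beta>. \<bar>\<beta> - \<alpha>\<bar> < \<delta> \<longrightarrow>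
    eventually (\<lambda>N. \<bar>hole_freq \<beta> z N - expected_hole k p J P \<alpha>\<bar> \<le> \<epsilon>) sequentially"
proof -
  let ?e = "expected_hole k p J P"
  obtain \<delta>0 where \<delta>0: "\<delta>0 > 0" "\<And>\<beta>. \<bar>\<beta> - \<alpha>\<bar> < \<delta>0 \<Longrightarrow> \<bar>?e \<beta> - ?e \<alpha>\<bar> < \<epsilon> / 2"
    using \<alpha>(2) \<epsilon> unfolding continuous_at_eps_delta dist_real_def by (metis half_gt_zero)
  \<comment> \<open>The bound by \<open>\<alpha>\<close> keeps the rational parameters chosen below positive.\<close>
  define \<delta> where "\<delta> = min \<delta>0 \<alpha>"
  have \<delta>: "\<delta> > 0" "\<delta> \<le> \<delta>0" "\<delta> \<le> \<alpha>" using \<delta>0 \<alpha> by (auto simp: \<delta>_def)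
  obtain s where s: "1 / real (Suc s) < \<epsilon> / 2"
    using reals_Archimedean[of "\<epsilon> / 2"] \<epsilon> by (auto simp: inverse_eq_divide)
  have "eventually (\<lambda>N. \<bar>hole_freq \<beta> z N - ?e \<alpha>\<bar> \<le> \<epsilon>) sequentially" if \<beta>: "\<bar>\<beta> - \<alpha>\<bar> < \<delta>" for \<beta>
  proof -
    have "\<alpha> - \<delta> < \<beta>" "\<beta> < \<alpha> + \<delta>" using \<beta> by linarith+
    obtain a b c d :: rat where abcd: "\<alpha> - \<delta> < of_rat a" "of_rat a < (of_rat b :: real)" "of_rat b < \<beta>"
      "\<beta> < of_rat c" "of_rat c < (of_rat d :: real)" "of_rat d < \<alpha> + \<delta>"
    proof -
      obtain b where b: "\<alpha> - \<delta> < of_rat b" "of_rat b < \<beta>" using of_rat_dense[OF \<open>\<alpha> - \<delta> < \<beta>\<close>] by blast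
      obtain a where a: "\<alpha> - \<delta> < of_rat a" "of_rat a < (of_rat b :: real)" using of_rat_dense[OF b(1)] by blast
      obtain c where c: "\<beta> < of_rat c" "of_rat c < \<alpha> + \<delta>" using of_rat_dense[OF \<open>\<beta> < \<alpha> + \<delta>\<close>] by blast
      obtain d where d: "of_rat c < (of_rat d :: real)" "of_rat d < \<alpha> + \<delta>" using of_rat_dense[OF c(2)] by blast
      show ?thesis by (rule that[OF a b(2) c(1) d])
    qed
    have "0 < (of_rat a :: real)" using abcd(1) \<delta>(3) by linarith
    then have ab: "0 < a" "a < b" using abcd(2) by (simp_all add: of_rat_less)
    have "0 < (of_rat c :: real)" using abcd(4) \<open>\<alpha> - \<delta> < \<beta>\<close> \<delta>(3) by linarith
    then have cd: "0 < c" "c < d" using abcd(5) by (simp_all add: of_rat_less)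
    have ea: "?e (of_rat a) < ?e \<alpha> + \<epsilon> / 2" using \<delta>0(2)[of "of_rat a"] abcd \<beta> \<delta>(2) by linarith
    have ed: "?e \<alpha> - \<epsilon> / 2 < ?e (of_rat d)" using \<delta>0(2)[of "of_rat d"] abcd \<beta> \<delta>(2) by linarith
    have "eventually (\<lambda>N. hole_freq (of_rat b) z N \<le> ?e (of_rat a) + 1 / real (Suc s)) sequentially"
      using z ab unfolding squeezed_def by (blast intro: eventually_mono)
    moreover have "eventually (\<lambda>N. ?e (of_rat d) - 1 / real (Suc s) \<le> hole_freq (of_rat c) z N) sequentially"
      using z cd unfolding squeezed_def by (blast intro: eventually_mono)
    ultimately show ?thesis
    proof eventually_elim
      case (elim N)
      have "hole_freq \<beta> z N \<le> hole_freq (of_rat b) z N" "hole_freq (of_rat c) z N \<le> hole_freq \<beta> z N"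
        using abcd by (auto intro!: hole_freq_antimono)
      then show ?case using elim ea ed s by linarith
    qed
  qed
  then show ?thesis using \<delta>(1) by blast
qed

lemma squeezed_limit:
  assumes z: "squeezed z" and \<alpha>: "0 < \<alpha>" "isCont (expected_hole k p J P) \<alpha>"
  shows "hole_freq \<alpha> z \<longlonglongrightarrow> expected_hole k p J P \<alpha>"
proof (rule tendstoI)
  fix \<epsilon> :: real assume "\<epsilon> > 0"
  then have "\<epsilon> / 2 > 0" by simp
  from squeezed_near_continuity[OF z \<alpha> this] have "eventually (\<lambda>N. \<bar>hole_freq \<alpha> z N - expected_hole k p J P \<alpha>\<bar> \<le> \<epsilon> / 2) sequentially"
    by auto
  then show "eventually (\<lambda>N. dist (hole_freq \<alpha> z N) (expected_hole k p J P \<alpha>) < \<epsilon>) sequentially"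
    by eventually_elim (use \<open>\<epsilon> > 0\<close> in \<open>simp add: dist_real_def\<close>)
qed

text \<open>Whenever the mean porosity exists for a parameter near a continuity point, it is a limit of
  frequencies that are eventually close to the expectation there.\<close>

lemma squeezed_porosity:
  assumes z: "squeezed (\<eta>, \<omega>)" and \<alpha>: "\<alpha> \<in> {0<..<1} - exceptional_set k p J P"
  shows "mean_porosity_exists k (limit_set k J \<omega>) (point_of J \<eta>) \<alpha>"
    and "mean_porosity k (limit_set k J \<omega>) (point_of J \<eta>) \<alpha> = expected_hole k p J P \<alpha>"
    and "continuous (at \<alpha> within {\<beta> \<in> {0<..<1}. mean_porosity_exists k (limit_set k J \<omega>) (point_of J \<eta>) \<beta>})
      (mean_porosity k (limit_set k J \<omega>) (point_of J \<eta>))"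
proof -
  let ?K = "limit_set k J \<omega>" and ?x = "point_of J \<eta>" and ?e = "expected_hole k p J P"
  have a: "0 < \<alpha>" "isCont ?e \<alpha>" using \<alpha> by (auto simp: exceptional_set_def)
  have f: "(\<lambda>i. real (hole_count k ?K ?x \<beta> i) / real i) = hole_freq \<beta> (\<eta>, \<omega>)" for \<beta>
    by (simp add: hole_freq_def fun_eq_iff)
  have lim: "hole_freq \<alpha> (\<eta>, \<omega>) \<longlonglongrightarrow> ?e \<alpha>" by (rule squeezed_limit[OF z a])
  show "mean_porosity_exists k ?K ?x \<alpha>"
    unfolding mean_porosity_exists_def f using lim by (rule convergentI)
  show val: "mean_porosity k ?K ?x \<alpha> = ?e \<alpha>"
    unfolding mean_porosity_def f using lim by (rule limI)
  show "continuous (at \<alpha> within {\<beta> \<in> {0<..<1}. mean_porosity_exists k ?K ?x \<beta>}) (mean_porosity k ?K ?x)"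
    unfolding continuous_within_eps_delta
  proof (intro allI impI)
    fix \<epsilon> :: real assume "\<epsilon> > 0"
    then have "\<epsilon> / 2 > 0" by simp
    from squeezed_near_continuity[OF z a this] obtain \<delta> where \<delta>: "\<delta> > 0"
      "\<And>\<beta>. \<bar>\<beta> - \<alpha>\<bar> < \<delta> \<Longrightarrow> eventually (\<lambda>N. \<bar>hole_freq \<beta> (\<eta>, \<omega>) N - ?e \<alpha>\<bar> \<le> \<epsilon> / 2) sequentially"
      by blast
    have "dist (mean_porosity k ?K ?x \<beta>) (mean_porosity k ?K ?x \<alpha>) < \<epsilon>"
      if \<beta>: "mean_porosity_exists k ?K ?x \<beta>" "dist \<beta> \<alpha> < \<delta>" for \<beta>
    proof -
      have "hole_freq \<beta> (\<eta>, \<omega>) \<longlonglongrightarrow> mean_porosity k ?K ?x \<beta>"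
        using \<beta>(1) unfolding mean_porosity_exists_def mean_porosity_def f convergent_LIMSEQ_iff .
      then have "(\<lambda>N. \<bar>hole_freq \<beta> (\<eta>, \<omega>) N - ?e \<alpha>\<bar>) \<longlonglongrightarrow> \<bar>mean_porosity k ?K ?x \<beta> - ?e \<alpha>\<bar>"
        by (intro tendsto_rabs tendsto_diff tendsto_const)
      then have "\<bar>mean_porosity k ?K ?x \<beta> - ?e \<alpha>\<bar> \<le> \<epsilon> / 2"
        using \<delta>(2)[of \<beta>] \<beta>(2) by (intro tendsto_upperbound) (auto simp: dist_real_def)
      then show ?thesis using \<open>\<epsilon> > 0\<close> by (simp add: val dist_real_def)
    qed
    then show "\<exists>\<delta>>0. \<forall>\<beta>\<in>{\<beta> \<in> {0<..<1}. mean_porosity_exists k ?K ?x \<beta>}. dist \<beta> \<alpha> < \<delta> \<longrightarrow>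
        dist (mean_porosity k ?K ?x \<beta>) (mean_porosity k ?K ?x \<alpha>) < \<epsilon>"
      using \<delta>(1) by blast
  qed
qed

end

theorem theorem4p5:
  fixes k :: nat and p :: real
    and J :: "nat list \<Rightarrow> (real ^ 'm) set"
    and P :: "(nat list \<Rightarrow> bool) measure"
  assumes "k \<ge> 2"
    and "1 / real k ^ CARD('m) < p" and "p \<le> 1"
    and "cube_system k J"
    and "percolation_law k CARD('m) p P"
  shows "(AE (\<eta>, \<omega>) in size_biased_measure k p J P.
            \<forall>\<alpha> \<in> {0<..<1} - exceptional_set k p J P.
              mean_porosity_exists k (limit_set k J \<omega>) (point_of J \<eta>) \<alpha> \<and>
              mean_porosity k (limit_set k J \<omega>) (point_of J \<eta>) \<alpha> = expected_hole k p J P \<alpha>) \<and>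
         (AE (\<eta>, \<omega>) in size_biased_measure k p J P.
            \<forall>\<alpha> \<in> {0<..<1} - exceptional_set k p J P.
              mean_porosity_exists k (limit_set k J \<omega>) (point_of J \<eta>) \<alpha> \<and>
              continuous
                (at \<alpha> within {\<beta> \<in> {0<..<1}. mean_porosity_exists k (limit_set k J \<omega>) (point_of J \<eta>) \<beta>})
                (mean_porosity k (limit_set k J \<omega>) (point_of J \<eta>)))"
proof -
  interpret mandelbrot k "CARD('m)" p P J
    using assms by unfold_locales auto
  show ?thesis
  proof
    show "AE (\<eta>, \<omega>) in size_biased_measure k p J P.
            \<forall>\<alpha> \<in> {0<..<1} - exceptional_set k p J P.
              mean_porosity_exists k (limit_set k J \<omega>) (point_of J \<eta>) \<alpha> \<and>
              mean_porosity k (limit_set k J \<omega>) (point_of J \<eta>) \<alpha> = expected_hole k p J P \<alpha>"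
      using AE_squeezed by eventually_elim (auto simp only: split_paired_all case_prod_conv intro!: squeezed_porosity(1,2))
    show "AE (\<eta>, \<omega>) in size_biased_measure k p J P.
            \<forall>\<alpha> \<in> {0<..<1} - exceptional_set k p J P.
              mean_porosity_exists k (limit_set k J \<omega>) (point_of J \<eta>) \<alpha> \<and>
              continuous
                (at \<alpha> within {\<beta> \<in> {0<..<1}. mean_porosity_exists k (limit_set k J \<omega>) (point_of J \<eta>) \<beta>})
                (mean_porosity k (limit_set k J \<omega>) (point_of J \<eta>))"
      using AE_squeezed by eventually_elim (auto simp only: split_paired_all case_prod_conv intro!: squeezed_porosity(1,3))
  qed
qed

end
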